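(* For every $n\ge 1$, the generating function of the monomial Chern numbers of the normal bundle $\nu(\mathbb{CP}^n)$ of the complex projective space $\mathbb{CP}^n$ is $$C^\nu(\mathbb{CP}^n,t)=(n+1)\,L_n(t_1,\dots,t_n),$$ where $L_n$ is the $n$-th Lagrange inversion polynomial.
   Context: **Lagrange inversion polynomials.** For a formal power series $f(x)=x+\sum_{n\ge1}a_nx^{n+1}$ let $g(y)=y+\sum_{n\ge1}b_ny^{n+1}$ be its compositional inverse, $g(f(x))\equiv x$. The coefficients are given by $b_n=L_n(a_1,\dots,a_n)$ with universal polynomials $L_n\in\mathbb Z[a_1,\dots,a_n]$, called the Lagrange inversion polynomials (e.g. $L_1=-a_1$, $L_2=-a_2+2a_1^2$, $L_3=-a_3+5a_1a_2-5a_1^3$). **Monomial Chern numbers.** Let $M^n$ be a compact complex manifold of complex dimension $n$, with tangent bundle $\tau M^n$ and (stable) normal bundle $\nu M^n$, so that $\tau M^n\oplus \nu M^n$ is stably trivial. For a partition $\lambda=(\lambda_1\ge\dots\ge\lambda_k)$ with $|\lambda|=\lambda_1+\dots+\lambda_k=n$ and a complex vector bundle $\xi$ on $M^n$, $c_\lambda(\xi)\in H^{2n}(M^n,\mathbb Z)$ is the characteristic class corresponding to the monomial symmetric function $m_\lambda$ in the Chern roots of $\xi$. (Equivalently, the total class $\mathcal C(\xi,t)=\sum_\lambda c_\lambda(\xi)t_\lambda$ equals $\prod_j(1+x_jt_1+x_j^2t_2+\cdots)$ with $x_j$ the Chern roots of $\xi$; it is multiplicative under direct sums, and $\mathcal C(\tau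 M^n,t)\,\mathcal C(\nu M^n,t)=1$.) Put $c^\nu_\lambda(M^n)=(c_\lambda(\nu M^n),\langle M^n\rangle)$, where $\langle M^n\rangle$ is the fundamental cycle, and $$C^\nu(M^n,t)=\sum_{\lambda:|\lambda|=n}c^\nu_\lambda(M^n)\,t_\lambda,\qquad t_\lambda=t_{\lambda_1}\cdots t_{\lambda_k}.$$ *)

theory Defs
  imports
    "HOL-Analysis.Analysis"
    "HOL-Homology.Homology"
    "HOL-Computational_Algebra.Formal_Power_Series"
    "HOL-Library.Multiset"
    "HOL-Library.Nat_Bijection"
    "Jordan_Normal_Form.Determinant"
begin

section \<open>Polynomials in countably many variables\<close>

type_synonym zpoly = "(nat \<Rightarrow>\<^sub>0 nat) \<Rightarrow>\<^sub>0 int"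

definition zvar :: "nat \<Rightarrow> zpoly" where
  "zvar i = Poly_Mapping.single (Poly_Mapping.single i 1) 1"

text \<open>Substitution \<open>P(a 0, a 1, \<dots>)\<close>. The target ring need not be commutative (cochains are not),
  so the factors of each monomial are multiplied in the order of their indices.\<close>

definition zeval :: "(nat \<Rightarrow> 'r::ring_1) \<Rightarrow> zpoly \<Rightarrow> 'r" where
  "zeval a P = (\<Sum>m\<in>Poly_Mapping.keys P. of_int (Poly_Mapping.lookup P m) *
     (\<Prod>i\<leftarrow>sorted_list_of_set (Poly_Mapping.keys m). a i ^ Poly_Mapping.lookup m i))"


subsection \<open>Lagrange inversion polynomials\<close>

text \<open>The generic series \<open>x + a\<^sub>1 x\<^sup>2 + a\<^sub>2 x\<^sup>3 + \<dots>\<close> over \<open>\<int>[a\<^sub>1, a\<^sub>2, \<dots>]\<close>.\<close>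

definition generic_series :: "zpoly fps" where
  "generic_series = Abs_fps (\<lambda>k. if k = 0 then 0 else if k = 1 then 1 else zvar (k - 1))"

definition lagrange_poly :: "nat \<Rightarrow> zpoly" where
  "lagrange_poly n = fps_nth (THE g. fps_compose g generic_series = fps_X) (n + 1)"


subsection \<open>Monomial symmetric functions\<close>

text \<open>A partition is the multiset of its (positive) parts.\<close>

definition partitions_of :: "nat \<Rightarrow> nat multiset set" where
  "partitions_of n = {lam. 0 \<notin># lam \<and> \<Sum>\<^sub># lam = n}"

definition esym :: "nat \<Rightarrow> nat \<Rightarrow> zpoly" where
  "esym N i = (\<Sum>S\<in>{S. S \<subseteq> {..<N} \<and> card S = i}. \<Prod>j\<in>S. zvar j)"

definition msym :: "nat \<Rightarrow> nat multiset \<Rightarrow> zpoly" where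
  "msym N lam = (\<Sum>m\<in>{m. Poly_Mapping.keys m \<subseteq> {..<N} \<and>
     image_mset (Poly_Mapping.lookup m) (mset_set (Poly_Mapping.keys m)) = lam}.
       Poly_Mapping.single m 1)"

text \<open>The polynomial (it is unique) in the variables \<open>e\<^sub>1, e\<^sub>2, \<dots>\<close> that expresses \<open>m\<^sub>\<lambda>\<close> through the
  elementary symmetric functions, for any number \<open>N\<close> of roots.\<close>

definition msym_in_esym :: "nat multiset \<Rightarrow> zpoly" where
  "msym_in_esym lam = (SOME P. (\<forall>m\<in>Poly_Mapping.keys P. 0 \<notin> Poly_Mapping.keys m) \<and>
     (\<forall>N. zeval (esym N) P = msym N lam))"


section \<open>Singular cochains\<close>

definition front_face :: "nat \<Rightarrow> ((nat \<Rightarrow> real) \<Rightarrow> 'a) \<Rightarrow> (nat \<Rightarrow> real) \<Rightarrow> 'a" where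
  "front_face p s = restrict s (standard_simplex p)"

definition back_face :: "nat \<Rightarrow> nat \<Rightarrow> ((nat \<Rightarrow> real) \<Rightarrow> 'a) \<Rightarrow> (nat \<Rightarrow> real) \<Rightarrow> 'a" where
  "back_face p q s = restrict (\<lambda>x. s (\<lambda>i. if i < p then 0 else x (i - p))) (standard_simplex q)"

text \<open>An element is a family of integral cochains, one in each degree, defined on all functions;
  the values in degree \<open>n\<close> depend only on the restriction to the standard \<open>n\<close>-simplex. The space
  enters only through the simplices on which a cochain is evaluated.\<close>

typedef 'a cochain = "{a :: nat \<Rightarrow> ((nat \<Rightarrow> real) \<Rightarrow> 'a) \<Rightarrow> int.
    \<forall>n s. a n (restrict s (standard_simplex n)) = a n s}"
  morphisms cochain_val Abs_cochain
  by (rule exI[of _ "\<lambda>_ _. 0"]) simp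

setup_lifting type_definition_cochain

lemma standard_simplex_le: "p \<le> q \<Longrightarrow> x \<in> standard_simplex p \<Longrightarrow> x \<in> standard_simplex q"
  using standard_simplex_mono by blast

lemma back_shift_in_simplex:
  assumes "x \<in> standard_simplex q"
  shows "(\<lambda>i. if i < p then 0 else x (i - p)) \<in> standard_simplex (p + q)"
proof -
  have "(\<Sum>i\<le>p + q. if i < p then 0 else x (i - p)) = (\<Sum>i\<in>{p..p + q}. x (i - p))"
    by (rule sum.mono_neutral_cong_right) auto
  also have "\<dots> = (\<Sum>i\<le>q. x i)"
    by (rule sum.reindex_bij_witness[of _ "\<lambda>i. i + p" "\<lambda>i. i - p"]) auto
  finally show ?thesis
    using assms by (auto simp: standard_simplex_def)
qed

lemma front_front: "j \<le> k \<Longrightarrow> front_face j (front_face k s) = front_face j s"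
  by (auto simp: front_face_def restrict_def fun_eq_iff intro: standard_simplex_le)

lemma back_back: "back_face j q (back_face i (j + q) s) = back_face (i + j) q s"
proof -
  have *: "(\<lambda>k. if k < i then 0 else if k - i < j then 0 else x (k - i - j)) =
      (\<lambda>k. if k < i + j then 0 else x (k - (i + j)))" for x :: "nat \<Rightarrow> real"
    by (auto simp: fun_eq_iff)
  show ?thesis
    by (auto simp: back_face_def restrict_def fun_eq_iff back_shift_in_simplex *)
qed

lemma front_back: "q \<le> r \<Longrightarrow> front_face q (back_face p r s) = back_face p q (front_face (p + q) s)"
  by (auto simp: front_face_def back_face_def restrict_def fun_eq_iff back_shift_in_simplex
      intro: standard_simplex_le)

lemma face_restrict:
  "p \<le> n \<Longrightarrow> front_face p (restrict s (standard_simplex n)) = front_face p s"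
  "p + q = n \<Longrightarrow> back_face p q (restrict s (standard_simplex n)) = back_face p q s"
  by (auto simp: front_face_def back_face_def restrict_def fun_eq_iff back_shift_in_simplex
      intro: standard_simplex_le)

lemma back_face_0: "back_face 0 n s = restrict s (standard_simplex n)"
  by (simp add: back_face_def)

text \<open>The ring structure given by the cup product.\<close>

instantiation cochain :: (type) ring_1
begin

lift_definition zero_cochain :: "'a cochain" is "\<lambda>_ _. 0" by simp
lift_definition one_cochain :: "'a cochain" is "\<lambda>n _. if n = 0 then 1 else 0" by simp
lift_definition plus_cochain :: "'a cochain \<Rightarrow> 'a cochain \<Rightarrow> 'a cochain"
  is "\<lambda>a b n s. a n s + b n s" by simp
lift_definition minus_cochain :: "'a cochain \<Rightarrow> 'a cochain \<Rightarrow> 'a cochain"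
  is "\<lambda>a b n s. a n s - b n s" by simp
lift_definition uminus_cochain :: "'a cochain \<Rightarrow> 'a cochain"
  is "\<lambda>a n s. - a n s" by simp
lift_definition times_cochain :: "'a cochain \<Rightarrow> 'a cochain \<Rightarrow> 'a cochain"
  is "\<lambda>a b n s. \<Sum>p = 0..n. a p (front_face p s) * b (n - p) (back_face p (n - p) s)"
  by (simp add: face_restrict)

instance
proof
  fix a b c :: "'a cochain"
  show "a * b * c = a * (b * c)"
  proof transfer
    fix a b c :: "nat \<Rightarrow> ((nat \<Rightarrow> real) \<Rightarrow> 'a) \<Rightarrow> int"
    show "(\<lambda>n s. \<Sum>p = 0..n. (\<Sum>q = 0..p. a q (front_face q (front_face p s)) *
            b (p - q) (back_face q (p - q) (front_face p s))) * c (n - p) (back_face p (n - p) s)) =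
          (\<lambda>n s. \<Sum>p = 0..n. a p (front_face p s) * (\<Sum>q = 0..n - p.
            b q (front_face q (back_face p (n - p) s)) *
            c (n - p - q) (back_face q (n - p - q) (back_face p (n - p) s))))"
      (is "?L = ?R")
    proof (intro ext)
      fix n s
      let ?f = "\<lambda>i j k. a i (front_face i s) * b j (back_face i j (front_face (i + j) s)) *
        c k (back_face (n - k) k s)"
      have "?L n s = (\<Sum>p = 0..n. \<Sum>q = 0..p. ?f q (p - q) (n - p))"
        by (auto simp: sum_distrib_right front_front intro!: sum.cong)
      also have "\<dots> = (\<Sum>p = 0..n. \<Sum>q = 0..n - p. ?f p q (n - p - q))"
        by (rule fps_mult_assoc_lemma)
      also have "\<dots> = ?R n s"
      proof (intro sum.cong refl)
        fix p assume "p \<in> {0..n}"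
        show "(\<Sum>q = 0..n - p. ?f p q (n - p - q)) = a p (front_face p s) * (\<Sum>q = 0..n - p.
            b q (front_face q (back_face p (n - p) s)) *
            c (n - p - q) (back_face q (n - p - q) (back_face p (n - p) s)))"
          unfolding sum_distrib_left
        proof (intro sum.cong refl)
          fix q assume q: "q \<in> {0..n - p}"
          then have "n - (n - p - q) = p + q" "q + (n - p - q) = n - p"
            using \<open>p \<in> {0..n}\<close> by auto
          then have "back_face (n - (n - p - q)) (n - p - q) s =
              back_face q (n - p - q) (back_face p (n - p) s)"
            using back_back[of q "n - p - q" p s] by simp
          then show "?f p q (n - p - q) = a p (front_face p s) *
              (b q (front_face q (back_face p (n - p) s)) *
               c (n - p - q) (back_face q (n - p - q) (back_face p (n - p) s)))"
            using q by (simp add: front_back mult.assoc)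
        qed
      qed
      finally show "?L n s = ?R n s" .
    qed
  qed
  show "1 * a = a"
  proof transfer
    fix a :: "nat \<Rightarrow> ((nat \<Rightarrow> real) \<Rightarrow> 'a) \<Rightarrow> int"
    assume a: "\<forall>n s. a n (restrict s (standard_simplex n)) = a n s"
    show "(\<lambda>n s. \<Sum>p = 0..n. (if p = 0 then 1 else 0) * a (n - p) (back_face p (n - p) s)) = a"
    proof (intro ext)
      fix n s
      have "(\<Sum>p = 0..n. (if p = 0 then 1 else 0) * a (n - p) (back_face p (n - p) s)) =
          (\<Sum>p = 0..n. if p = 0 then a n (back_face 0 n s) else 0)"
        by (rule sum.cong) auto
      then show "(\<Sum>p = 0..n. (if p = 0 then 1 else 0) * a (n - p) (back_face p (n - p) s)) = a n s"
        using a by (simp add: back_face_0)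
    qed
  qed
  show "a * 1 = a"
  proof transfer
    fix a :: "nat \<Rightarrow> ((nat \<Rightarrow> real) \<Rightarrow> 'a) \<Rightarrow> int"
    assume a: "\<forall>n s. a n (restrict s (standard_simplex n)) = a n s"
    show "(\<lambda>n s. \<Sum>p = 0..n. a p (front_face p s) * (if n - p = 0 then 1 else 0)) = a"
    proof (intro ext)
      fix n s
      have "(\<Sum>p = 0..n. a p (front_face p s) * (if n - p = 0 then 1 else 0)) =
          (\<Sum>p = 0..n. if p = n then a n (front_face n s) else 0)"
        by (rule sum.cong) auto
      then show "(\<Sum>p = 0..n. a p (front_face p s) * (if n - p = 0 then 1 else 0)) = a n s"
        using a by (simp add: front_face_def)
    qed
  qed
  show "(a + b) * c = a * c + b * c" "a * (b + c) = a * b + a * c"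
    by (transfer; simp add: fun_eq_iff algebra_simps sum.distrib; fail)+
  show "(0::'a cochain) \<noteq> 1"
    by transfer (auto dest!: fun_cong[of _ _ "0::nat"] simp: fun_eq_iff)
qed (transfer; simp add: algebra_simps fun_eq_iff; fail)+

end

lift_definition cochain_pullback :: "('a \<Rightarrow> 'b) \<Rightarrow> 'b cochain \<Rightarrow> 'a cochain"
  is "\<lambda>f a n s. a n (simplex_map n f s)"
proof -
  fix f :: "'a \<Rightarrow> 'b" and a :: "nat \<Rightarrow> ((nat \<Rightarrow> real) \<Rightarrow> 'b) \<Rightarrow> int" and n s
  have "simplex_map n f (restrict s (standard_simplex n)) = simplex_map n f s"
    by (auto simp: simplex_map_def restrict_def fun_eq_iff)
  then show "a n (simplex_map n f (restrict s (standard_simplex n))) = a n (simplex_map n f s)"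
    by simp
qed

definition pairing :: "nat \<Rightarrow> 'a cochain \<Rightarrow> 'a chain \<Rightarrow> int" where
  "pairing p a z = (\<Sum>s\<in>Poly_Mapping.keys z. Poly_Mapping.lookup z s * cochain_val a p s)"

text \<open>Cocycles of \<open>X\<close> concentrated in degree \<open>p\<close>, and equality in \<open>H\<^sup>p(X; \<int>)\<close>.\<close>

definition cocycle :: "nat \<Rightarrow> 'a topology \<Rightarrow> 'a cochain \<Rightarrow> bool" where
  "cocycle p X a \<longleftrightarrow> (\<forall>q s. q \<noteq> p \<longrightarrow> cochain_val a q s = 0) \<and>
     (\<forall>s. singular_simplex (Suc p) X s \<longrightarrow> pairing p a (chain_boundary (Suc p) (frag_of s)) = 0)"

definition cohomologous :: "nat \<Rightarrow> 'a topology \<Rightarrow> 'a cochain \<Rightarrow> 'a cochain \<Rightarrow> bool" where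
  "cohomologous p X a b \<longleftrightarrow> (\<exists>e. \<forall>s. singular_simplex p X s \<longrightarrow>
     cochain_val a p s - cochain_val b p s = pairing (p - 1) e (chain_boundary p (frag_of s)))"

text \<open>Cap product of a \<open>p\<close>-cochain with a \<open>(p + q)\<close>-chain.\<close>

definition cap :: "nat \<Rightarrow> nat \<Rightarrow> 'a cochain \<Rightarrow> 'a chain \<Rightarrow> 'a chain" where
  "cap p q a = frag_extend (\<lambda>s. frag_cmul (cochain_val a p (front_face p s))
     (frag_of (back_face p q s)))"


section \<open>Complex vector bundles\<close>

text \<open>A bundle is given by transition functions: over \<open>cov E i \<inter> cov E j\<close> the coordinates of a
  vector satisfy \<open>v\<^sub>i = trn E i j x \<cdot> v\<^sub>j\<close>. Countable covers suffice, as all base spaces below are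
  compact.\<close>

record 'p vbundle =
  rk :: nat
  idx :: "nat set"
  cov :: "nat \<Rightarrow> 'p set"
  trn :: "nat \<Rightarrow> nat \<Rightarrow> 'p \<Rightarrow> complex Matrix.mat"

definition continuous_matrix :: "'p topology \<Rightarrow> 'p set \<Rightarrow> nat \<Rightarrow> ('p \<Rightarrow> complex Matrix.mat) \<Rightarrow> bool" where
  "continuous_matrix X U r g \<longleftrightarrow> (\<forall>x\<in>U. g x \<in> carrier_mat r r) \<and>
     (\<forall>a<r. \<forall>b<r. continuous_map (subtopology X U) euclidean (\<lambda>x. g x $$ (a, b)))"

definition vector_bundle :: "'p topology \<Rightarrow> 'p vbundle \<Rightarrow> bool" where
  "vector_bundle X E \<longleftrightarrow>
     (\<forall>i\<in>idx E. openin X (cov E i)) \<and> (\<Union>i\<in>idx E. cov E i) = topspace X \<and>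
     (\<forall>i\<in>idx E. \<forall>j\<in>idx E. continuous_matrix X (cov E i \<inter> cov E j) (rk E) (trn E i j)) \<and>
     (\<forall>i\<in>idx E. \<forall>x\<in>cov E i. trn E i i x = 1\<^sub>m (rk E)) \<and>
     (\<forall>i\<in>idx E. \<forall>j\<in>idx E. \<forall>k\<in>idx E. \<forall>x\<in>cov E i \<inter> cov E j \<inter> cov E k.
        trn E i j x * trn E j k x = trn E i k x)"

definition bundle_iso :: "'p topology \<Rightarrow> 'p vbundle \<Rightarrow> 'p vbundle \<Rightarrow> bool" where
  "bundle_iso X E F \<longleftrightarrow> rk E = rk F \<and> (\<exists>h.
     (\<forall>a\<in>idx F. \<forall>i\<in>idx E. continuous_matrix X (cov F a \<inter> cov E i) (rk E) (h a i) \<and>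
        (\<forall>x\<in>cov F a \<inter> cov E i. invertible_mat (h a i x))) \<and>
     (\<forall>a\<in>idx F. \<forall>b\<in>idx F. \<forall>i\<in>idx E. \<forall>j\<in>idx E.
        \<forall>x\<in>cov F a \<inter> cov F b \<inter> cov E i \<inter> cov E j.
          trn F a b x * h b j x = h a i x * trn E i j x))"

definition trivial_bundle :: "'p topology \<Rightarrow> nat \<Rightarrow> 'p vbundle" where
  "trivial_bundle X r = \<lparr>rk = r, idx = {0}, cov = (\<lambda>_. topspace X), trn = (\<lambda>_ _ _. 1\<^sub>m r)\<rparr>"

definition pullback_bundle :: "'p topology \<Rightarrow> ('p \<Rightarrow> 'q) \<Rightarrow> 'q vbundle \<Rightarrow> 'p vbundle" where
  "pullback_bundle X f E = \<lparr>rk = rk E, idx = idx E, cov = (\<lambda>i. topspace X \<inter> f -` cov E i),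
     trn = (\<lambda>i j x. trn E i j (f x))\<rparr>"

definition direct_sum :: "'p vbundle \<Rightarrow> 'p vbundle \<Rightarrow> 'p vbundle" where
  "direct_sum E F = \<lparr>rk = rk E + rk F, idx = prod_encode ` (idx E \<times> idx F),
     cov = (\<lambda>k. cov E (fst (prod_decode k)) \<inter> cov F (snd (prod_decode k))),
     trn = (\<lambda>k l x. four_block_mat
       (trn E (fst (prod_decode k)) (fst (prod_decode l)) x) (0\<^sub>m (rk E) (rk F))
       (0\<^sub>m (rk F) (rk E)) (trn F (snd (prod_decode k)) (snd (prod_decode l)) x))\<rparr>"

definition stably_trivial :: "'p topology \<Rightarrow> 'p vbundle \<Rightarrow> bool" where
  "stably_trivial X E \<longleftrightarrow>
     (\<exists>k m. bundle_iso X (direct_sum E (trivial_bundle X k)) (trivial_bundle X m))"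


section \<open>Complex manifolds\<close>

text \<open>\<open>\<complex>\<^sup>n\<close> is the set of functions \<open>nat \<Rightarrow> complex\<close> supported in \<open>{..<n}\<close>; each \<open>mchart M i\<close> maps
  \<open>mdom M i\<close> onto an open subset of it.\<close>

record 'p cmanifold =
  mtop :: "'p topology"
  mdim :: nat
  midx :: "nat set"
  mdom :: "nat \<Rightarrow> 'p set"
  mchart :: "nat \<Rightarrow> 'p \<Rightarrow> nat \<Rightarrow> complex"

definition mchart_inv :: "'p cmanifold \<Rightarrow> nat \<Rightarrow> (nat \<Rightarrow> complex) \<Rightarrow> 'p" where
  "mchart_inv M i = inv_into (mdom M i) (mchart M i)"

text \<open>The transition functions are the holomorphic Jacobian matrices of the coordinate changes.\<close>

definition tangent_bundle :: "'p cmanifold \<Rightarrow> 'p vbundle" where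
  "tangent_bundle M = \<lparr>rk = mdim M, idx = midx M, cov = mdom M,
     trn = (\<lambda>i j x. Matrix.mat (mdim M) (mdim M) (\<lambda>(a, b).
       deriv (\<lambda>z. mchart M i (mchart_inv M j ((mchart M j x)(b := z))) a) (mchart M j x b)))\<rparr>"

text \<open>The identification \<open>\<real>\<^sup>2\<^sup>n = \<complex>\<^sup>n\<close> with real coordinates \<open>(Re w\<^sub>0, Im w\<^sub>0, Re w\<^sub>1, Im w\<^sub>1, \<dots>)\<close>,
  which gives the complex orientation.\<close>

definition complexify :: "(nat \<Rightarrow> real) \<Rightarrow> nat \<Rightarrow> complex" where
  "complexify y = (\<lambda>a. Complex (y (2 * a)) (y (2 * a + 1)))"

definition positive_simplex :: "nat \<Rightarrow> (nat \<Rightarrow> nat \<Rightarrow> real) \<Rightarrow> bool" where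
  "positive_simplex m l \<longleftrightarrow> (\<forall>k\<le>m. \<forall>j\<ge>m. l k j = 0) \<and>
     Determinant.det (Matrix.mat m m (\<lambda>(a, b). l (Suc b) a - l 0 a)) > 0"

text \<open>A cycle represents the fundamental class if its image in \<open>H\<^sub>2\<^sub>n(M, M - {x})\<close> is, for every
  point \<open>x\<close>, the local orientation at \<open>x\<close>, i.e. the class of a positively oriented affine simplex
  in a chart which contains \<open>x\<close> in its interior.\<close>

definition fundamental_cycle :: "'p cmanifold \<Rightarrow> 'p chain \<Rightarrow> bool" where
  "fundamental_cycle M mu \<longleftrightarrow>
     singular_relcycle (2 * mdim M) (mtop M) {} mu \<and>
     (\<forall>i\<in>midx M. \<forall>l y.
        positive_simplex (2 * mdim M) l \<and>
        (\<forall>x\<in>standard_simplex (2 * mdim M).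
           complexify (oriented_simplex (2 * mdim M) l x) \<in> mchart M i ` mdom M i) \<and>
        y \<in> standard_simplex (2 * mdim M) \<and> (\<forall>k\<le>2 * mdim M. 0 < y k) \<longrightarrow>
        homologous_rel (2 * mdim M) (mtop M)
          (topspace (mtop M) - {mchart_inv M i (complexify (oriented_simplex (2 * mdim M) l y))})
          mu
          (frag_of (simplex_map (2 * mdim M) (mchart_inv M i \<circ> complexify)
             (oriented_simplex (2 * mdim M) l))))"


section \<open>Complex projective space\<close>

text \<open>Points are one-dimensional subspaces of \<open>\<complex>\<^sup>n\<^sup>+\<^sup>1\<close>, the functions supported in \<open>{..n}\<close>. Thus
  \<open>\<complex>P\<^sup>n\<^sup>-\<^sup>1\<close> is literally the hyperplane of \<open>\<complex>P\<^sup>n\<close> where the last coordinate vanishes.\<close>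

type_synonym cline = "(nat \<Rightarrow> complex) set"

definition cspan :: "(nat \<Rightarrow> complex) \<Rightarrow> cline" where
  "cspan z = range (\<lambda>c i. c * z i)"

definition punctured_space :: "nat \<Rightarrow> (nat \<Rightarrow> complex) set" where
  "punctured_space n = {z. z \<noteq> (\<lambda>_. 0) \<and> (\<forall>i>n. z i = 0)}"

text \<open>The quotient topology of \<open>\<complex>\<^sup>n\<^sup>+\<^sup>1 - {0}\<close>.\<close>

definition cp_top :: "nat \<Rightarrow> cline topology" where
  "cp_top n = topology (\<lambda>U. U \<subseteq> cspan ` punctured_space n \<and>
     openin (top_of_set (punctured_space n)) {z \<in> punctured_space n. cspan z \<in> U})"

lemma openin_cp_top:
  "openin (cp_top n) U \<longleftrightarrow> U \<subseteq> cspan ` punctured_space n \<and>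
     openin (top_of_set (punctured_space n)) {z \<in> punctured_space n. cspan z \<in> U}"
proof -
  let ?S = "punctured_space n"
  let ?P = "\<lambda>U. {z \<in> ?S. cspan z \<in> U}"
  have 1: "?P (U \<inter> V) = ?P U \<inter> ?P V" for U V by auto
  have 2: "?P (\<Union>K) = \<Union>(?P ` K)" for K by auto
  have "istopology (\<lambda>U. U \<subseteq> cspan ` ?S \<and> openin (top_of_set ?S) (?P U))"
    unfolding istopology_def 1 2 by (auto intro!: openin_Int openin_Union)
  then show ?thesis
    by (simp add: cp_top_def topology_inverse')
qed

definition homog :: "cline \<Rightarrow> nat \<Rightarrow> complex" where
  "homog L = (SOME z. z \<in> L \<and> z \<noteq> (\<lambda>_. 0))"

definition cp_dom :: "nat \<Rightarrow> nat \<Rightarrow> cline set" where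
  "cp_dom n j = {L \<in> cspan ` punctured_space n. homog L j \<noteq> 0}"

text \<open>Affine coordinates \<open>z\<^sub>a / z\<^sub>j\<close> with \<open>a \<noteq> j\<close>.\<close>

definition cp_chart :: "nat \<Rightarrow> nat \<Rightarrow> cline \<Rightarrow> nat \<Rightarrow> complex" where
  "cp_chart n j L a =
     (if a < n then homog L (if a < j then a else Suc a) / homog L j else 0)"

definition CP :: "nat \<Rightarrow> cline cmanifold" where
  "CP n = \<lparr>mtop = cp_top n, mdim = n, midx = {..n}, mdom = cp_dom n, mchart = cp_chart n\<rparr>"

text \<open>The dual of the tautological line bundle. The tautological bundle has over \<open>cp_dom n j\<close> the
  frame \<open>z / z\<^sub>j\<close>, hence the transition functions \<open>z\<^sub>i / z\<^sub>j\<close>.\<close>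

definition hyperplane_bundle :: "nat \<Rightarrow> cline vbundle" where
  "hyperplane_bundle n = \<lparr>rk = 1, idx = {..n}, cov = cp_dom n,
     trn = (\<lambda>i j L. Matrix.mat 1 1 (\<lambda>_. homog L j / homog L i))\<rparr>"


section \<open>Chern classes\<close>

text \<open>Hirzebruch's axioms, which determine the Chern classes on compact Hausdorff spaces; \<open>c X E i\<close>
  is a cocycle representing \<open>c\<^sub>i(E) \<in> H\<^sup>2\<^sup>i(X; \<int>)\<close>. The normalization reads \<open>c(\<eta>\<^sub>n) = 1 + h\<^sub>n\<close> for
  the hyperplane bundle \<open>\<eta>\<^sub>n\<close>, where \<open>h\<^sub>n\<close> is the Poincare dual of the hyperplane:
  \<open>h\<^sub>n \<inter> [\<complex>P\<^sup>n] = [\<complex>P\<^sup>n\<^sup>-\<^sup>1]\<close>. All spaces have points of the type in which \<open>\<complex>P\<^sup>n\<close> lives, because HOL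
  cannot quantify over types inside a formula.\<close>

definition chern_classes ::
    "(cline topology \<Rightarrow> cline vbundle \<Rightarrow> nat \<Rightarrow> cline cochain) \<Rightarrow> bool" where
  "chern_classes c \<longleftrightarrow>
     (\<forall>X E. compact_space X \<and> Hausdorff_space X \<and> vector_bundle X E \<longrightarrow>
        (\<forall>i. cocycle (2 * i) X (c X E i)) \<and> cohomologous 0 X (c X E 0) 1 \<and>
        (\<forall>i>rk E. cohomologous (2 * i) X (c X E i) 0)) \<and>
     (\<forall>X E F i. compact_space X \<and> Hausdorff_space X \<and> vector_bundle X E \<and> vector_bundle X F \<and>
        bundle_iso X E F \<longrightarrow> cohomologous (2 * i) X (c X E i) (c X F i)) \<and>
     (\<forall>X Y f E i. compact_space X \<and> Hausdorff_space X \<and> compact_space Y \<and> Hausdorff_space Y \<and>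
        continuous_map X Y f \<and> vector_bundle Y E \<longrightarrow>
        cohomologous (2 * i) X (c X (pullback_bundle X f E) i) (cochain_pullback f (c Y E i))) \<and>
     (\<forall>X E F k. compact_space X \<and> Hausdorff_space X \<and> vector_bundle X E \<and> vector_bundle X F \<longrightarrow>
        cohomologous (2 * k) X (c X (direct_sum E F) k) (\<Sum>i\<le>k. c X E i * c X F (k - i))) \<and>
     (\<forall>n mu. n \<ge> 1 \<and> fundamental_cycle (CP n) mu \<longrightarrow>
        (\<exists>mu'. fundamental_cycle (CP (n - 1)) mu' \<and>
           homologous_rel (2 * (n - 1)) (cp_top n) {}
             (cap 2 (2 * (n - 1)) (c (cp_top n) (hyperplane_bundle n) 1) mu) mu'))"

text \<open>The argument \<open>e\<close> is the sequence of Chern classes of the bundle.\<close>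

definition monomial_chern_class :: "nat multiset \<Rightarrow> (nat \<Rightarrow> 'p cochain) \<Rightarrow> 'p cochain" where
  "monomial_chern_class lam e = zeval e (msym_in_esym lam)"

definition chern_number_gf :: "nat \<Rightarrow> (nat \<Rightarrow> 'p cochain) \<Rightarrow> 'p chain \<Rightarrow> zpoly" where
  "chern_number_gf n e mu = (\<Sum>lam\<in>partitions_of n.
     of_int (pairing (2 * n) (monomial_chern_class lam e) mu) * (\<Prod>i\<in>#lam. zvar i))"

end

theory Submission
  imports Defs
begin

text \<open>
  By the Euler sequence, \<open>T \<oplus> \<epsilon> \<cong> \<eta>\<^sup>n\<^sup>+\<^sup>1\<close> for the hyperplane bundle \<open>\<eta>\<close>, so the Chern class of the normal
  bundle is \<open>(1 + h)\<^sup>-\<^sup>(\<^sup>n\<^sup>+\<^sup>1\<^sup>)\<close> with \<open>h = c\<^sub>1(\<eta>)\<close>, as if it had \<open>-(n + 1)\<close> Chern roots, all equal to \<open>h\<close>. For \<open>N\<close>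
  equal roots \<open>h\<close>, the sum of \<open>m\<^sub>\<lambda> t\<^sub>\<lambda>\<close> over the partitions of \<open>n\<close> is the degree \<open>n\<close> part of
  \<open>(1 + t\<^sub>1 h + t\<^sub>2 h\<^sup>2 + \<dots>)\<^sup>N\<close>; both sides are polynomial in \<open>N\<close>, hence this persists for \<open>N = -(n + 1)\<close>. As
  \<open>\<langle>h\<^sup>n, [\<complex>P\<^sup>n]\<rangle> = 1\<close>, the generating function is the coefficient of \<open>x\<^sup>n\<close> in \<open>(x / f(x))\<^sup>n\<^sup>+\<^sup>1\<close> for
  \<open>f(x) = x + t\<^sub>1 x\<^sup>2 + t\<^sub>2 x\<^sup>3 + \<dots>\<close>, which is \<open>(n + 1) L\<^sub>n\<close> by Lagrange inversion.

  Up to coboundaries, all Chern classes in question are integral multiples of powers of the single cochain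
  \<open>h\<close>, so graded commutativity of the cup product is not needed.
\<close>

section \<open>Evaluation of polynomials\<close>

text \<open>The polynomial \<open>msym_in_esym lam\<close> is a choice, so the first obstacle is its
  existence: the fundamental theorem on symmetric functions, with one polynomial good for every
  number N of roots. Afterwards it is known only through its values on the elementary symmetric
  functions of N = 0, 1, 2, ... roots. A negative number of roots is not among these values, which
  forces the passage through polynomial functions of N. The second obstacle is that Chern classes
  are cochains given up to coboundaries, in a ring that is not commutative. They are compared by a
  relation \<open>coh\<close> on inhomogeneous cochains, compatible with sums and with products of
  closed cochains, so that \<open>zeval\<close> can be carried from the Chern classes to integral
  multiples of the powers of h. The one numerical input, <h^n, [CP^n]> = 1, comes by induction from
  the normalization axiom: capping with h turns [CP^n] into [CP^(n-1)], down to the point CP^0,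
  where the local orientation condition fixes the fundamental class itself.\<close>

lemma zeval_superset:
  fixes a :: "nat \<Rightarrow> 'r::comm_ring_1"
  assumes "finite A" "Poly_Mapping.keys P \<subseteq> A"
  shows "zeval a P = (\<Sum>m\<in>A. of_int (Poly_Mapping.lookup P m) *
     (\<Prod>i\<in>Poly_Mapping.keys m. a i ^ Poly_Mapping.lookup m i))"
proof -
  have "zeval a P = (\<Sum>m\<in>Poly_Mapping.keys P. of_int (Poly_Mapping.lookup P m) *
     (\<Prod>i\<in>Poly_Mapping.keys m. a i ^ Poly_Mapping.lookup m i))"
    unfolding zeval_def by (intro sum.cong refl) (simp add: prod.distinct_set_conv_list[symmetric])
  also have "\<dots> = (\<Sum>m\<in>A. of_int (Poly_Mapping.lookup P m) *
     (\<Prod>i\<in>Poly_Mapping.keys m. a i ^ Poly_Mapping.lookup m i))"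
    using assms by (intro sum.mono_neutral_left) (auto simp: in_keys_iff)
  finally show ?thesis .
qed

lemma zeval_0 [simp]: "zeval a 0 = 0"
  by (simp add: zeval_def)

lemma zeval_add:
  fixes a :: "nat \<Rightarrow> 'r::comm_ring_1"
  shows "zeval a (P + Q) = zeval a P + zeval a Q"
proof -
  let ?A = "Poly_Mapping.keys P \<union> Poly_Mapping.keys Q"
  have "Poly_Mapping.keys (P + Q) \<subseteq> ?A"
    by (rule keys_add)
  then show ?thesis
    by (simp add: zeval_superset[of ?A] lookup_add algebra_simps sum.distrib)
qed

lemma zeval_single:
  fixes a :: "nat \<Rightarrow> 'r::comm_ring_1"
  shows "zeval a (Poly_Mapping.single m c) =
    of_int c * (\<Prod>i\<in>Poly_Mapping.keys m. a i ^ Poly_Mapping.lookup m i)"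
  by (simp add: zeval_superset[of "{m}"])

lemma zeval_of_int [simp]: "zeval (a :: nat \<Rightarrow> 'r::comm_ring_1) (of_int c) = of_int c"
  unfolding single_of_int[symmetric] by (subst zeval_single) simp

lemma zeval_1 [simp]: "zeval (a :: nat \<Rightarrow> 'r::comm_ring_1) 1 = 1"
  using zeval_of_int[of a 1] by simp

lemma zeval_zvar [simp]: "zeval (a :: nat \<Rightarrow> 'r::comm_ring_1) (zvar i) = a i"
  by (simp add: zvar_def zeval_single)

lemma zeval_uminus: "zeval (a :: nat \<Rightarrow> 'r::comm_ring_1) (- P) = - zeval a P"
  using zeval_add[of a P "- P"] by (simp add: add_eq_0_iff)

lemma zeval_diff: "zeval (a :: nat \<Rightarrow> 'r::comm_ring_1) (P - Q) = zeval a P - zeval a Q"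
  using zeval_add[of a P "- Q"] by (simp add: zeval_uminus)

lemma zeval_sum: "zeval (a :: nat \<Rightarrow> 'r::comm_ring_1) (sum f A) = (\<Sum>i\<in>A. zeval a (f i))"
  by (induction A rule: infinite_finite_induct) (auto simp: zeval_add)

text \<open>\<open>update_induct\<close> updates only at keys outside the support, where an update
  is an addition; this turns it into induction over sums of monomials.\<close>

lemma poly_mapping_induct_add [case_names zero single_add]:
  fixes P :: "'k \<Rightarrow>\<^sub>0 'v::comm_monoid_add"
  assumes "Q 0" and "\<And>m c P. Q P \<Longrightarrow> Q (Poly_Mapping.single m c + P)"
  shows "Q P"
proof (induction P rule: update_induct)
  case const
  then show ?case using assms(1) .
next
  case (update f a b)
  have "Poly_Mapping.update a b f = Poly_Mapping.single a b + f"
    using update(1) by (intro poly_mapping_eqI) (auto simp: lookup_update lookup_add lookup_single in_keys_iff when_def)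
  with assms(2)[OF update(3)] show ?case by simp
qed

lemma monomial_add:
  fixes a :: "nat \<Rightarrow> 'r::comm_ring_1"
  shows "(\<Prod>i\<in>Poly_Mapping.keys (m + m'). a i ^ Poly_Mapping.lookup (m + m') i) =
    (\<Prod>i\<in>Poly_Mapping.keys m. a i ^ Poly_Mapping.lookup m i) *
    (\<Prod>i\<in>Poly_Mapping.keys m'. a i ^ Poly_Mapping.lookup m' i)"
proof -
  let ?A = "Poly_Mapping.keys m \<union> Poly_Mapping.keys m'"
  have *: "(\<Prod>i\<in>Poly_Mapping.keys k. a i ^ Poly_Mapping.lookup k i) =
      (\<Prod>i\<in>?A. a i ^ Poly_Mapping.lookup k i)" if "Poly_Mapping.keys k \<subseteq> ?A" for k :: "nat \<Rightarrow>\<^sub>0 nat"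
    using that by (intro prod.mono_neutral_left) (auto simp: in_keys_iff)
  show ?thesis
    unfolding *[OF keys_add] *[OF Un_upper1] *[OF Un_upper2]
    by (simp add: lookup_add power_add prod.distrib)
qed

lemma zeval_mult:
  fixes a :: "nat \<Rightarrow> 'r::comm_ring_1"
  shows "zeval a (P * Q) = zeval a P * zeval a Q"
proof (induction P rule: poly_mapping_induct_add)
  case (single_add m c P)
  have "zeval a (Poly_Mapping.single m c * Q) = zeval a (Poly_Mapping.single m c) * zeval a Q"
    by (induction Q rule: poly_mapping_induct_add)
      (simp_all add: distrib_left zeval_add mult_single zeval_single monomial_add algebra_simps)
  with single_add show ?case
    by (simp add: distrib_right zeval_add)
qed simp

lemma zeval_prod: "zeval (a :: nat \<Rightarrow> 'r::comm_ring_1) (prod f A) = (\<Prod>i\<in>A. zeval a (f i))"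
  by (induction A rule: infinite_finite_induct) (auto simp: zeval_mult)

lemma zeval_power: "zeval (a :: nat \<Rightarrow> 'r::comm_ring_1) (P ^ n) = zeval a P ^ n"
  by (induction n) (auto simp: zeval_mult)

lemma zeval_zeval:
  fixes a :: "nat \<Rightarrow> 'r::comm_ring_1"
  shows "zeval a (zeval b P) = zeval (\<lambda>i. zeval a (b i)) P"
  by (simp add: zeval_superset[of "Poly_Mapping.keys P"] zeval_sum zeval_mult zeval_prod zeval_power)

text \<open>The degree in the roots of a monomial whose variable of index i stands for e_i.
  Multiples of h^i put in for the variables multiply to a multiple of h^wt.\<close>

definition wt :: "(nat \<Rightarrow>\<^sub>0 nat) \<Rightarrow> nat" where
  "wt m = (\<Sum>i\<in>Poly_Mapping.keys m. i * Poly_Mapping.lookup m i)"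

lemma power_of_int_mult: "(of_int k * h) ^ n = of_int (k ^ n) * (h :: 'r::ring_1) ^ n"
proof (induction n)
  case (Suc n)
  have "h * (of_int (k ^ n) * h ^ n) = of_int (k ^ n) * (h * h ^ n)"
    using mult_of_int_commute[of "k ^ n" h] by (metis mult.assoc)
  with Suc show ?case
    by (simp add: mult.assoc)
qed simp

text \<open>Integral multiples of powers of one element commute, so each ordered product collapses
  to a single power even in a noncommutative ring. Serves cochains and power series alike.\<close>

lemma zeval_powers:
  fixes h :: "'r::ring_1"
  shows "zeval (\<lambda>i. of_int (k i) * h ^ i) P = (\<Sum>m\<in>Poly_Mapping.keys P.
    of_int (Poly_Mapping.lookup P m * (\<Prod>i\<in>Poly_Mapping.keys m. k i ^ Poly_Mapping.lookup m i)) * h ^ wt m)"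
  unfolding zeval_def
proof (intro sum.cong refl)
  fix m :: "nat \<Rightarrow>\<^sub>0 nat"
  have *: "(\<Prod>i\<leftarrow>xs. (of_int (k i) * h ^ i) ^ Poly_Mapping.lookup m i) =
     of_int (\<Prod>i\<leftarrow>xs. k i ^ Poly_Mapping.lookup m i) * h ^ (\<Sum>i\<leftarrow>xs. i * Poly_Mapping.lookup m i)" for xs
  proof (induction xs)
    case (Cons x xs)
    let ?r = "of_int (\<Prod>i\<leftarrow>xs. k i ^ Poly_Mapping.lookup m i) :: 'r"
    let ?e = "x * Poly_Mapping.lookup m x"
    have "h ^ ?e * (?r * z) = ?r * (h ^ ?e * z)" for z
      by (metis mult.assoc mult_of_int_commute)
    then show ?case
      using Cons by (simp add: power_of_int_mult power_mult[symmetric] power_add mult.assoc del: of_int_power)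
  qed simp
  show "of_int (Poly_Mapping.lookup P m) *
      (\<Prod>i\<leftarrow>sorted_list_of_set (Poly_Mapping.keys m). (of_int (k i) * h ^ i) ^ Poly_Mapping.lookup m i) =
      of_int (Poly_Mapping.lookup P m * (\<Prod>i\<in>Poly_Mapping.keys m. k i ^ Poly_Mapping.lookup m i)) * h ^ wt m"
    unfolding * wt_def
    by (simp add: prod.distinct_set_conv_list[symmetric] sum.distinct_set_conv_list[symmetric] mult.assoc)
qed

section \<open>Monomial symmetric functions as polynomials in the elementary ones\<close>

text \<open>Zero exponents are not recorded, so a shape is a partition; two monomials have the same
  shape exactly if a permutation of the variables takes one to the other.\<close>

definition shape :: "(nat \<Rightarrow>\<^sub>0 nat) \<Rightarrow> nat multiset" where
  "shape m = image_mset (Poly_Mapping.lookup m) (mset_set (Poly_Mapping.keys m))"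

lemma zero_notin_shape: "0 \<notin># shape m"
  by (auto simp: shape_def in_keys_iff)

lemma size_shape: "size (shape m) = card (Poly_Mapping.keys m)"
  by (simp add: shape_def)

lemma sum_shape: "\<Sum>\<^sub># (shape m) = (\<Sum>i\<in>Poly_Mapping.keys m. Poly_Mapping.lookup m i)"
  by (simp add: shape_def sum_unfold_sum_mset)

text \<open>Comparing the exponents of two monomials over a common set of variables requires the
  zero exponents to be counted as well.\<close>

lemma shape_superset:
  assumes "finite A" "Poly_Mapping.keys m \<subseteq> A"
  shows "image_mset (Poly_Mapping.lookup m) (mset_set A) =
    shape m + replicate_mset (card A - card (Poly_Mapping.keys m)) 0"
proof -
  let ?K = "Poly_Mapping.keys m"
  have "mset_set A = mset_set ?K + mset_set (A - ?K)"
    using assms by (metis Diff_partition Diff_disjoint finite_Diff finite_keys mset_set_Union)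
  moreover have "image_mset (Poly_Mapping.lookup m) (mset_set (A - ?K)) = image_mset (\<lambda>_. 0) (mset_set (A - ?K))"
    using assms by (intro image_mset_cong) (auto simp: in_keys_iff)
  moreover have "card (A - ?K) = card A - card ?K"
    using assms by (intro card_Diff_subset) auto
  ultimately show ?thesis
    by (simp add: shape_def image_mset_const_eq)
qed

lemma finite_shape_set: "finite {m. Poly_Mapping.keys m \<subseteq> {..<N::nat} \<and> shape m = lam}"
proof -
  let ?S = "{f. \<forall>x. (x \<in> {..<N} \<longrightarrow> f x \<in> set_mset lam \<union> {0}) \<and> (x \<notin> {..<N} \<longrightarrow> f x = (0::nat))}"
  have "finite (Poly_Mapping.lookup ` {m. Poly_Mapping.keys m \<subseteq> {..<N} \<and> shape m = lam})"
  proof (rule finite_subset)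
    show "finite ?S"
      by (rule finite_set_of_finite_funs) auto
    show "Poly_Mapping.lookup ` {m. Poly_Mapping.keys m \<subseteq> {..<N} \<and> shape m = lam} \<subseteq> ?S"
    proof clarsimp
      fix m :: "nat \<Rightarrow>\<^sub>0 nat" and x assume m: "Poly_Mapping.keys m \<subseteq> {..<N}"
      show "(x < N \<longrightarrow> Poly_Mapping.lookup m x = 0 \<or> Poly_Mapping.lookup m x \<in># shape m) \<and>
         (\<not> x < N \<longrightarrow> Poly_Mapping.lookup m x = 0)"
      proof (cases "x \<in> Poly_Mapping.keys m")
        case True
        then have "Poly_Mapping.lookup m x \<in># shape m"
          by (simp add: shape_def)
        with True m show ?thesis by auto
      qed (auto simp: in_keys_iff)
    qed
  qed
  then show ?thesis
    by (rule finite_imageD) (rule inj_onI, erule poly_mapping.lookup_inject[THEN iffD1])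
qed

lemma lookup_sum_single_1:
  assumes "finite A"
  shows "Poly_Mapping.lookup (\<Sum>x\<in>A. Poly_Mapping.single (f x) (1::int)) m = int (card {x \<in> A. f x = m})"
proof -
  have "Poly_Mapping.lookup (\<Sum>x\<in>A. Poly_Mapping.single (f x) (1::int)) m = (\<Sum>x\<in>A. if f x = m then 1 else 0)"
    by (auto simp: lookup_sum lookup_single when_def intro!: sum.cong)
  also have "\<dots> = int (card {x \<in> A. f x = m})"
    using assms by (simp add: sum.inter_filter[symmetric])
  finally show ?thesis .
qed

lemma lookup_msym:
  "Poly_Mapping.lookup (msym N lam) m = (if Poly_Mapping.keys m \<subseteq> {..<N} \<and> shape m = lam then 1 else 0)"
proof -
  let ?A = "{m. Poly_Mapping.keys m \<subseteq> {..<N} \<and> shape m = lam}"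
  have "{x \<in> ?A. x = m} = (if m \<in> ?A then {m} else {})"
    by auto
  then have "int (card {x \<in> ?A. x = m}) = (if m \<in> ?A then 1 else 0)"
    by (simp only: if_distrib[of card] card.empty) simp
  then show ?thesis
    using lookup_sum_single_1[OF finite_shape_set, of "\<lambda>x. x" N lam m] by (simp add: msym_def shape_def)
qed

section \<open>Pieri coefficients: the product of m_mu and e_k\<close>

definition indic :: "nat set \<Rightarrow> (nat \<Rightarrow>\<^sub>0 nat)" where
  "indic S = (\<Sum>j\<in>S. Poly_Mapping.single j 1)"

lemma lookup_indic: "finite S \<Longrightarrow> Poly_Mapping.lookup (indic S) j = (if j \<in> S then 1 else 0)"
  by (simp add: indic_def lookup_sum lookup_single when_def)

lemma keys_indic: "finite S \<Longrightarrow> Poly_Mapping.keys (indic S) = S"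
  by (simp only: set_eq_iff in_keys_iff lookup_indic) simp

lemma prod_zvar: "finite S \<Longrightarrow> (\<Prod>j\<in>S. zvar j) = Poly_Mapping.single (indic S) 1"
  by (induction S rule: finite_induct) (auto simp: zvar_def indic_def mult_single)

lemma keys_add_nat: "Poly_Mapping.keys (m + m' :: 'a \<Rightarrow>\<^sub>0 nat) = Poly_Mapping.keys m \<union> Poly_Mapping.keys m'"
  by (simp only: set_eq_iff Un_iff in_keys_iff lookup_add add_is_0) simp

text \<open>The coefficient of the monomial \<open>x\<^sup>m\<close> in \<open>m\<^sub>\<mu> e\<^sub>k\<close>, for any number of variables that contains those of \<open>m\<close>.\<close>

definition pieri :: "nat multiset \<Rightarrow> nat \<Rightarrow> (nat \<Rightarrow>\<^sub>0 nat) \<Rightarrow> nat" where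
  "pieri mu k m = card {(m', S). shape m' = mu \<and> finite S \<and> card S = k \<and> m' + indic S = m}"

text \<open>Both factors have coefficients 0 and 1 only, so factorizations are counted. Exponents
  cannot cancel, hence the factors of a monomial in the first \<open>N\<close> variables involve
  only these variables, and the count is independent of \<open>N\<close>.\<close>

lemma lookup_msym_mult_esym:
  "Poly_Mapping.lookup (msym N mu * esym N k) m =
    (if Poly_Mapping.keys m \<subseteq> {..<N} then int (pieri mu k m) else 0)"
proof -
  let ?A = "{m. Poly_Mapping.keys m \<subseteq> {..<N} \<and> shape m = mu}" and ?B = "{S. S \<subseteq> {..<N} \<and> card S = k}"
  have fB: "finite ?B" by simp
  have e: "esym N k = (\<Sum>S\<in>?B. Poly_Mapping.single (indic S) 1)"
    unfolding esym_def by (intro sum.cong refl prod_zvar) (auto intro: finite_subset)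
  have m: "msym N mu = (\<Sum>m\<in>?A. Poly_Mapping.single m 1)"
    by (simp add: msym_def shape_def)
  have "msym N mu * esym N k = (\<Sum>x\<in>?A \<times> ?B. Poly_Mapping.single (fst x + indic (snd x)) 1)"
    unfolding e m by (simp add: sum_product sum.cartesian_product mult_single split_beta)
  then have "Poly_Mapping.lookup (msym N mu * esym N k) m =
      int (card {x \<in> ?A \<times> ?B. fst x + indic (snd x) = m})"
    using lookup_sum_single_1[of "?A \<times> ?B" "\<lambda>x. fst x + indic (snd x)" m] finite_shape_set[of N mu] fB
    by simp
  moreover have "{x \<in> ?A \<times> ?B. fst x + indic (snd x) = m} =
     (if Poly_Mapping.keys m \<subseteq> {..<N} then {(m', S). shape m' = mu \<and> finite S \<and> card S = k \<and> m' + indic S = m} else {})"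
  proof -
    have "finite S" if "S \<subseteq> {..<N}" for S
      using that by (rule finite_subset) simp
    then show ?thesis
      by (auto simp: keys_add_nat keys_indic)
  qed
  ultimately show ?thesis
    by (simp add: pieri_def if_distrib[of card])
qed

lemma map_key_indic:
  assumes "bij p" "finite S"
  shows "Poly_Mapping.map_key p (indic S) = indic (p -` S)"
proof -
  have "finite (p -` S)"
    using assms by (simp add: bij_is_inj finite_vimageI)
  then show ?thesis
    using assms by (intro poly_mapping_eqI) (auto simp: map_key.rep_eq bij_is_inj lookup_indic)
qed

lemma shape_map_key:
  assumes "bij p"
  shows "shape (Poly_Mapping.map_key p m) = shape m"
proof -
  have K: "Poly_Mapping.keys (Poly_Mapping.map_key p m) = p -` Poly_Mapping.keys m"
    using assms by (simp add: bij_is_inj keys_map_key)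
  have "image_mset p (mset_set (p -` Poly_Mapping.keys m)) = mset_set (p ` (p -` Poly_Mapping.keys m))"
    using assms by (intro image_mset_mset_set) (auto simp: bij_is_inj inj_on_subset[of p UNIV])
  also have "p ` (p -` Poly_Mapping.keys m) = Poly_Mapping.keys m"
    using assms by (simp add: bij_is_surj surj_image_vimage_eq)
  finally have *: "mset_set (Poly_Mapping.keys m) = image_mset p (mset_set (p -` Poly_Mapping.keys m))" ..
  show ?thesis
    unfolding shape_def K *
    using assms by (simp add: multiset.map_comp o_def map_key.rep_eq bij_is_inj)
qed

text \<open>A permutation of the variables maps factorizations injectively to factorizations. The
  inequality suffices, as it gets applied in both directions.\<close>

lemma pieri_map_key_le:
  assumes "bij p"
  shows "pieri mu k m \<le> pieri mu k (Poly_Mapping.map_key p m)"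
proof -
  let ?A = "\<lambda>m. {(m', S). shape m' = mu \<and> finite S \<and> card S = k \<and> m' + indic S = m}"
  let ?f = "\<lambda>(m', S). (Poly_Mapping.map_key p m', p -` S)"
  have inj: "inj p" using assms by (rule bij_is_inj)
  have fin: "finite (?A m)" for m
  proof -
    obtain N where "Poly_Mapping.keys m \<subseteq> {..<N}"
      using finite_nat_iff_bounded[of "Poly_Mapping.keys m"] by auto
    \<comment> \<open>Both factors of \<open>m\<close> use only variables of \<open>m\<close>, which
      leaves finitely many factorizations.\<close>
    then have "?A m \<subseteq> {m. Poly_Mapping.keys m \<subseteq> {..<N} \<and> shape m = mu} \<times> Pow {..<N}"
      by (auto simp: keys_add_nat keys_indic)
    moreover have "finite ({m. Poly_Mapping.keys m \<subseteq> {..<N} \<and> shape m = mu} \<times> Pow {..<N})"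
      using finite_shape_set by simp
    ultimately show ?thesis
      by (rule finite_subset)
  qed
  have "card (?A m) \<le> card (?A (Poly_Mapping.map_key p m))"
  proof (rule card_inj_on_le)
    have "inj_on ?f UNIV"
    proof (rule inj_onI, clarsimp)
      fix a b S T assume ab: "Poly_Mapping.map_key p a = Poly_Mapping.map_key p b" and ST: "p -` S = p -` T"
      have "Poly_Mapping.lookup a (p x) = Poly_Mapping.lookup b (p x)" for x
        using arg_cong[OF ab, of "\<lambda>q. Poly_Mapping.lookup q x"] inj by (simp add: map_key.rep_eq)
      then have "a = b"
        using bij_is_surj[OF assms] by (intro poly_mapping_eqI) (metis surjD)
      moreover have "S = T"
        using ST bij_is_surj[OF assms] by (metis surj_image_vimage_eq)
      ultimately show "a = b \<and> S = T" ..
    qed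
    then show "inj_on ?f (?A m)"
      by (rule inj_on_subset) simp
    show "?f ` ?A m \<subseteq> ?A (Poly_Mapping.map_key p m)"
    proof clarsimp
      fix m' :: "nat \<Rightarrow>\<^sub>0 nat" and S :: "nat set" assume "finite S"
      then show "shape (Poly_Mapping.map_key p m') = shape m' \<and> finite (p -` S) \<and> card (p -` S) = card S \<and>
        Poly_Mapping.map_key p m' + indic (p -` S) = Poly_Mapping.map_key p (m' + indic S)"
        using assms inj by (simp add: shape_map_key map_key_plus map_key_indic finite_vimageI card_vimage_inj bij_is_surj)
    qed
    show "finite (?A (Poly_Mapping.map_key p m))"
      by (rule fin)
  qed
  then show ?thesis
    by (simp add: pieri_def)
qed

text \<open>Symmetry of the product: after padding with zeros over the union of the supports,
  monomials of equal shape differ by a permutation of the variables.\<close>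

lemma pieri_cong:
  assumes "shape m1 = shape m2"
  shows "pieri mu k m1 = pieri mu k m2"
proof -
  have *: "pieri mu k m2 \<le> pieri mu k m1" if "shape m1 = shape m2" for m1 m2
  proof -
    let ?A = "Poly_Mapping.keys m1 \<union> Poly_Mapping.keys m2"
    have "card (Poly_Mapping.keys m1) = card (Poly_Mapping.keys m2)"
      using that by (metis size_shape)
    then have "image_mset (Poly_Mapping.lookup m1) (mset_set ?A) = image_mset (Poly_Mapping.lookup m2) (mset_set ?A)"
      using that by (simp add: shape_superset)
    then obtain p where p: "p permutes ?A" "\<forall>x\<in>?A. Poly_Mapping.lookup m1 x = Poly_Mapping.lookup m2 (p x)"
      using image_mset_eq_implies_permutes[of ?A "Poly_Mapping.lookup m1" "Poly_Mapping.lookup m2"] by auto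
    have "m1 = Poly_Mapping.map_key p m2"
    proof (rule poly_mapping_eqI)
      fix x
      show "Poly_Mapping.lookup m1 x = Poly_Mapping.lookup (Poly_Mapping.map_key p m2) x"
      proof (cases "x \<in> ?A")
        case False
        then have "p x = x" using p(1) by (simp add: permutes_not_in)
        with False show ?thesis
          using permutes_inj[OF p(1)] by (simp add: map_key.rep_eq in_keys_iff)
      qed (use p permutes_inj[OF p(1)] in \<open>auto simp: map_key.rep_eq\<close>)
    qed
    then show ?thesis
      using pieri_map_key_le[OF permutes_bij[OF p(1)], of mu k m2] by simp
  qed
  show ?thesis
    using *[OF assms] *[OF assms[symmetric]] by simp
qed

lemma sum_shape_superset:
  assumes "finite A" "Poly_Mapping.keys m \<subseteq> A"
  shows "\<Sum>\<^sub># (shape m) = (\<Sum>i\<in>A. Poly_Mapping.lookup m i)"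
  unfolding sum_shape using assms by (intro sum.mono_neutral_left) (auto simp: in_keys_iff)

lemma sum_shape_add_indic:
  assumes "finite S"
  shows "\<Sum>\<^sub># (shape (m + indic S)) = \<Sum>\<^sub># (shape m) + card S"
proof -
  let ?A = "Poly_Mapping.keys m \<union> S"
  have "\<Sum>\<^sub># (shape (m + indic S)) = (\<Sum>i\<in>?A. Poly_Mapping.lookup (m + indic S) i)"
    using assms by (intro sum_shape_superset) (auto simp: keys_add_nat keys_indic)
  also have "\<dots> = (\<Sum>i\<in>?A. Poly_Mapping.lookup m i) + (\<Sum>i\<in>?A. if i \<in> S then 1 else 0)"
    using assms by (simp add: lookup_add lookup_indic sum.distrib)
  also have "(\<Sum>i\<in>?A. if i \<in> S then 1 else 0) = card (?A \<inter> S)"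
    using assms by (simp add: sum.inter_restrict[symmetric])
  also have "?A \<inter> S = S" by auto
  finally show ?thesis
    using assms by (simp add: sum_shape_superset[of ?A])
qed

text \<open>Degrees add up under multiplication, and each of the \<open>k\<close> variables taken
  from e_k survives in the product.\<close>

lemma pieri_nonzero:
  assumes "pieri mu k m \<noteq> 0"
  shows "\<Sum>\<^sub># (shape m) = \<Sum>\<^sub># mu + k" "k \<le> size (shape m)"
proof -
  have "{(m', S). shape m' = mu \<and> finite S \<and> card S = k \<and> m' + indic S = m} \<noteq> {}"
    using assms unfolding pieri_def by (metis card.empty)
  then obtain m' S where *: "shape m' = mu" "finite S" "card S = k" "m' + indic S = m"
    by auto
  show "\<Sum>\<^sub># (shape m) = \<Sum>\<^sub># mu + k"
    using * sum_shape_add_indic by blast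
  have "S \<subseteq> Poly_Mapping.keys m"
    using * by (auto simp: keys_add_nat keys_indic)
  then show "k \<le> size (shape m)"
    using * by (auto simp: size_shape card_mono)
qed

text \<open>Removes the first column of the Young diagram.\<close>

definition pred_parts :: "nat multiset \<Rightarrow> nat multiset" where
  "pred_parts lam = filter_mset (\<lambda>p. p \<noteq> 0) (image_mset (\<lambda>p. p - 1) lam)"

text \<open>Shows that the nonzero members together with the size determine the multiset.\<close>

lemma mset_eq_filter_nonzero:
  fixes M :: "nat multiset"
  shows "M = filter_mset (\<lambda>p. p \<noteq> 0) M + replicate_mset (size M - size (filter_mset (\<lambda>p. p \<noteq> 0) M)) 0"
proof -
  have "M = filter_mset (\<lambda>p. p \<noteq> 0) M + filter_mset (\<lambda>p. p = 0) M"
    using multiset_partition[of M "\<lambda>p. p \<noteq> 0"] by simp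
  moreover have "filter_mset (\<lambda>p. p = 0) M = replicate_mset (size (filter_mset (\<lambda>p. p = 0) M)) 0"
    using filter_mset_eq_conv filter_eq_replicate_mset size_replicate_mset by metis
  moreover have "size (filter_mset (\<lambda>p. p = 0) M) = size M - size (filter_mset (\<lambda>p. p \<noteq> 0) M)"
    using calculation(1) by (metis add_diff_cancel_left' size_union)
  ultimately show ?thesis by metis
qed

lemma image_Suc_pred:
  assumes "0 \<notin># lam"
  shows "image_mset Suc (image_mset (\<lambda>p. p - 1) lam) = lam"
proof -
  have "image_mset Suc (image_mset (\<lambda>p. p - 1) lam) = image_mset (\<lambda>p. p) lam"
    unfolding multiset.map_comp by (intro image_mset_cong) (use assms in \<open>auto intro!: Suc_pred gr0I\<close>)
  then show ?thesis by simp
qed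

text \<open>The set \<open>S\<close> taken from e_k is forced to be the whole support of
  \<open>m\<close>, so \<open>m'\<close> is \<open>m\<close> with every exponent lowered by one;
  raising the padded exponents by \<open>Suc\<close> undoes \<open>pred_parts\<close>.\<close>

lemma pieri_top:
  assumes lam: "0 \<notin># lam" and k: "size (shape m) = size lam"
  shows "pieri (pred_parts lam) (size lam) m = (if shape m = lam then 1 else 0)"
proof -
  let ?K = "Poly_Mapping.keys m"
  have key: "shape m' = pred_parts lam \<longleftrightarrow> shape m = lam" if m: "m = m' + indic ?K" for m'
  proof -
    have sub: "Poly_Mapping.keys m' \<subseteq> ?K"
      using m by (metis Un_upper1 keys_add_nat)
    \<comment> \<open>\<open>X\<close> keeps the zero exponents of \<open>m'\<close> on the support
      of \<open>m\<close>; if \<open>m\<close> has shape \<open>lam\<close>, they come from the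
      parts 1, which \<open>pred_parts\<close> discards.\<close>
    define X where "X = image_mset (Poly_Mapping.lookup m') (mset_set ?K)"
    have X: "X = shape m' + replicate_mset (card ?K - card (Poly_Mapping.keys m')) 0"
      unfolding X_def by (rule shape_superset) (use sub in auto)
    have fX: "filter_mset (\<lambda>p. p \<noteq> 0) X = shape m'"
      unfolding X using zero_notin_shape[of m'] by (intro multiset_eqI) (auto simp: not_in_iff)
    have sX: "size X = size lam"
      using k by (simp add: X_def size_shape)
    have "image_mset Suc X = shape m"
      unfolding X_def shape_def multiset.map_comp
    proof (intro image_mset_cong)
      fix x assume "x \<in># mset_set ?K"
      then have "x \<in> ?K" by simp
      then show "(Suc \<circ> Poly_Mapping.lookup m') x = Poly_Mapping.lookup m x"
        by (subst m) (simp add: lookup_add lookup_indic)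
    qed
    then have "shape m = lam \<longleftrightarrow> image_mset Suc X = image_mset Suc (image_mset (\<lambda>p. p - 1) lam)"
      using image_Suc_pred[OF lam] by simp
    also have "\<dots> \<longleftrightarrow> X = image_mset (\<lambda>p. p - 1) lam"
      using inj_eq[OF multiset.inj_map[OF inj_Suc]] .
    also have "\<dots> \<longleftrightarrow> shape m' = pred_parts lam"
      using mset_eq_filter_nonzero[of X] mset_eq_filter_nonzero[of "image_mset (\<lambda>p. p - 1) lam"] fX sX
      unfolding pred_parts_def by (metis size_image_mset)
    finally show ?thesis ..
  qed
  have "m = (m - indic ?K) + indic ?K"
    by (intro poly_mapping_eqI) (auto simp: lookup_add lookup_minus lookup_indic in_keys_iff)
  moreover have "S = ?K" if "finite S" "card S = size lam" "m' + indic S = m" for m' S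
  proof -
    have "S \<subseteq> ?K" using that by (auto simp: keys_add_nat keys_indic)
    moreover have "card S = card ?K" using that k by (simp add: size_shape)
    ultimately show ?thesis by (intro card_subset_eq) auto
  qed
  ultimately have "{(m', S). shape m' = pred_parts lam \<and> finite S \<and> card S = size lam \<and> m' + indic S = m} =
     (if shape m = lam then {(m - indic ?K, ?K)} else {})"
    using key k by (fastforce simp: size_shape)
  then show ?thesis
    by (simp add: pieri_def if_distrib[of card])
qed

section \<open>Reduction of m_lambda to elementary symmetric functions\<close>

lemma finite_partitions_of: "finite (partitions_of n)"
proof (rule finite_subset)
  show "partitions_of n \<subseteq> mset ` {xs. set xs \<subseteq> {..n} \<and> length xs \<le> n}"
  proof
    fix lam assume lam: "lam \<in> partitions_of n"
    obtain xs where xs: "lam = mset xs"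
      by (metis ex_mset)
    have "0 \<notin> set xs" "sum_list xs = n"
      using lam xs by (auto simp: partitions_of_def sum_mset_sum_list)
    then have "set xs \<subseteq> {..n}" "length xs \<le> n"
      using member_le_sum_list[of _ xs] sum_list_mono[of xs "\<lambda>_. 1" "\<lambda>x. x"]
      by (auto simp: sum_list_triv Suc_le_eq intro!: gr0I)
    with xs show "lam \<in> mset ` {xs. set xs \<subseteq> {..n} \<and> length xs \<le> n}"
      by auto
  qed
  show "finite (mset ` {xs. set xs \<subseteq> {..n} \<and> length xs \<le> n})"
    by (intro finite_imageI finite_lists_length_le) simp
qed

lemma size_le_sum_partition:
  assumes "0 \<notin># lam"
  shows "size lam \<le> \<Sum>\<^sub># lam"
  using assms by (induction lam) auto

lemma shape_in_partitions_of: "shape m \<in> partitions_of (\<Sum>\<^sub># (shape m))"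
  by (simp add: partitions_of_def zero_notin_shape)

lemma sum_pred_parts:
assumes "0 \<notin># lam"
shows "\<Sum>\<^sub># (pred_parts lam) + size lam = \<Sum>\<^sub># lam"
proof -
  have "\<Sum>\<^sub># (pred_parts lam) = \<Sum>\<^sub># (image_mset (\<lambda>p. p - 1) lam)"
    unfolding pred_parts_def
    by (subst (2) mset_eq_filter_nonzero) simp
  moreover have "\<Sum>\<^sub># (image_mset Suc M) = \<Sum>\<^sub># M + size M" for M
    by (induction M) auto
  ultimately show ?thesis
    using image_Suc_pred[OF assms] by (metis size_image_mset)
qed

text \<open>Every monomial of \<open>m\<^sub>\<mu> e\<^sub>k\<close> has at least \<open>k\<close> variables, and if it has exactly \<open>k\<close>, then \<open>e\<^sub>k\<close>
  contributes each of them once. Hence, if \<open>\<lambda>\<close> has \<open>k\<close> parts and \<open>\<mu>\<close> is \<open>\<lambda>\<close> with all parts decreased by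
  one, then \<open>m\<^sub>\<mu> e\<^sub>k\<close> is \<open>m\<^sub>\<lambda>\<close> up to terms with more than \<open>k\<close> parts.\<close>

lemma msym_expansion:
  assumes "0 \<notin># lam"
  shows "\<exists>c :: nat multiset \<Rightarrow> int. \<forall>N. msym N lam = msym N (pred_parts lam) * esym N (size lam) -
    (\<Sum>nu\<in>{nu \<in> partitions_of (\<Sum>\<^sub># lam). size lam < size nu}. of_int (c nu) * msym N nu)"
proof -
  let ?k = "size lam" and ?mu = "pred_parts lam"
  let ?V = "{nu \<in> partitions_of (\<Sum>\<^sub># lam). ?k < size nu}"
  \<comment> \<open>By \<open>pieri_cong\<close> any monomial of shape \<open>nu\<close> gives the
    same coefficient, and \<open>N\<close> does not enter it. The value 0 is a default for multisets
    that are no shape.\<close>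
  define c where "c nu = (if \<exists>m. shape m = nu then int (pieri ?mu ?k (SOME m. shape m = nu)) else 0)" for nu
  have c: "c (shape m) = int (pieri ?mu ?k m)" for m
    unfolding c_def using pieri_cong[of "SOME x. shape x = shape m" m ?mu ?k] someI[of "\<lambda>x. shape x = shape m" m]
    by auto
  have fin: "finite ?V" using finite_partitions_of by simp
  have lk: "Poly_Mapping.lookup (of_int a * msym N nu) m =
      (if Poly_Mapping.keys m \<subseteq> {..<N} \<and> shape m = nu then a else 0)" for a N nu m
    by (simp add: single_of_int[symmetric] mult_map_scale_conv_mult[symmetric] map.rep_eq lookup_msym when_def)
  have "msym N lam = msym N ?mu * esym N ?k - (\<Sum>nu\<in>?V. of_int (c nu) * msym N nu)" for N
  proof (rule poly_mapping_eqI)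
    fix m :: "nat \<Rightarrow>\<^sub>0 nat"
    let ?P = "Poly_Mapping.keys m \<subseteq> {..<N}"
    have "Poly_Mapping.lookup (\<Sum>nu\<in>?V. of_int (c nu) * msym N nu) m =
        (\<Sum>nu\<in>?V. if nu = shape m then (if ?P then c nu else 0) else 0)"
      unfolding lookup_sum lk by (intro sum.cong) auto
    also have "\<dots> = (if shape m \<in> ?V \<and> ?P then int (pieri ?mu ?k m) else 0)"
      using fin by (simp add: c)
    finally have 1: "Poly_Mapping.lookup (\<Sum>nu\<in>?V. of_int (c nu) * msym N nu) m =
        (if shape m \<in> ?V \<and> ?P then int (pieri ?mu ?k m) else 0)" .
    \<comment> \<open>Outside \<open>?V\<close> a nonzero coefficient forces exactly
      \<open>?k\<close> variables, and then \<open>pieri_top\<close> applies.\<close>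
    have 2: "pieri ?mu ?k m = (if shape m = lam then 1 else 0)" if "shape m \<notin> ?V"
    proof (cases "size (shape m) = ?k")
      case False
      moreover have "shape m \<noteq> lam" using False by auto
      moreover have "pieri ?mu ?k m = 0"
      proof (rule ccontr)
        assume "pieri ?mu ?k m \<noteq> 0"
        from pieri_nonzero[OF this] sum_pred_parts[OF assms] False have "shape m \<in> ?V"
          using shape_in_partitions_of[of m] by auto
        with that show False by contradiction
      qed
      ultimately show ?thesis by simp
    qed (rule pieri_top[OF assms])
    show "Poly_Mapping.lookup (msym N lam) m =
        Poly_Mapping.lookup (msym N ?mu * esym N ?k - (\<Sum>nu\<in>?V. of_int (c nu) * msym N nu)) m"
      unfolding lookup_minus 1 lookup_msym_mult_esym lookup_msym using 2 by auto
  qed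
  then show ?thesis by blast
qed

text \<open>A family over all numbers of roots, since a single polynomial has to work for every
  \<open>N\<close>; for m_lambda this is the property by which \<open>msym_in_esym\<close> is
  chosen.\<close>

definition in_esym_ring :: "(nat \<Rightarrow> zpoly) \<Rightarrow> bool" where
  "in_esym_ring F \<longleftrightarrow>
    (\<exists>P. (\<forall>m\<in>Poly_Mapping.keys P. 0 \<notin> Poly_Mapping.keys m) \<and> (\<forall>N. zeval (esym N) P = F N))"

lemma in_esym_ring_of_int: "in_esym_ring (\<lambda>N. of_int c)"
proof -
  have "Poly_Mapping.keys (of_int c :: zpoly) \<subseteq> {0}"
    unfolding single_of_int[symmetric] by simp
  then show ?thesis
    unfolding in_esym_ring_def by (intro exI[of _ "of_int c"]) auto
qed

lemma in_esym_ring_esym: "k > 0 \<Longrightarrow> in_esym_ring (\<lambda>N. esym N k)"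
proof -
  assume "k > 0"
  moreover have "Poly_Mapping.keys (zvar k) = {Poly_Mapping.single k 1}"
    by (simp add: zvar_def)
  ultimately show ?thesis
    unfolding in_esym_ring_def by (intro exI[of _ "zvar k"]) auto
qed

lemma in_esym_ring_diff:
  assumes "in_esym_ring F" "in_esym_ring G"
  shows "in_esym_ring (\<lambda>N. F N - G N)"
proof -
  obtain P Q where *: "\<forall>m\<in>Poly_Mapping.keys P. 0 \<notin> Poly_Mapping.keys m" "\<forall>N. zeval (esym N) P = F N"
    "\<forall>m\<in>Poly_Mapping.keys Q. 0 \<notin> Poly_Mapping.keys m" "\<forall>N. zeval (esym N) Q = G N"
    using assms unfolding in_esym_ring_def by blast
  then show ?thesis
    unfolding in_esym_ring_def using keys_diff[of P Q]
    by (intro exI[of _ "P - Q"]) (auto simp: zeval_diff)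
qed

lemma in_esym_ring_mult:
  assumes "in_esym_ring F" "in_esym_ring G"
  shows "in_esym_ring (\<lambda>N. F N * G N)"
proof -
  obtain P Q where *: "\<forall>m\<in>Poly_Mapping.keys P. 0 \<notin> Poly_Mapping.keys m" "\<forall>N. zeval (esym N) P = F N"
    "\<forall>m\<in>Poly_Mapping.keys Q. 0 \<notin> Poly_Mapping.keys m" "\<forall>N. zeval (esym N) Q = G N"
    using assms unfolding in_esym_ring_def by blast
  have "0 \<notin> Poly_Mapping.keys m" if m: "m \<in> Poly_Mapping.keys (P * Q)" for m
  proof -
    obtain a b where "a \<in> Poly_Mapping.keys P" "b \<in> Poly_Mapping.keys Q" "m = a + b"
      using m keys_mult[of P Q] by blast
    with * show ?thesis by (simp add: keys_add_nat)
  qed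
  with * show ?thesis
    unfolding in_esym_ring_def by (intro exI[of _ "P * Q"]) (auto simp: zeval_mult)
qed

lemma in_esym_ring_sum:
  assumes "\<And>i. i \<in> A \<Longrightarrow> in_esym_ring (F i)"
  shows "in_esym_ring (\<lambda>N. \<Sum>i\<in>A. F i N)"
  using assms
proof (induction A rule: infinite_finite_induct)
  case (insert x A)
  have "in_esym_ring (\<lambda>N. F x N - (of_int 0 - (\<Sum>i\<in>A. F i N)))"
    using insert by (intro in_esym_ring_diff in_esym_ring_of_int) auto
  then show ?case using insert by simp
qed (use in_esym_ring_of_int[of 0] in auto)

text \<open>In \<open>msym_expansion\<close>, \<open>pred_parts lam\<close> has smaller degree,
  while the correction terms have the same degree but more parts. The number of parts is bounded by
  the degree, so the lexicographic measure decreases.\<close>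

theorem in_esym_ring_msym:
  assumes "0 \<notin># lam"
  shows "in_esym_ring (\<lambda>N. msym N lam)"
  using assms
proof (induction "(\<Sum>\<^sub># lam, \<Sum>\<^sub># lam - size lam)" arbitrary: lam rule: wf_induct_rule[OF wf_lex_prod[OF wf_less_than wf_less_than]])
  case less: (1 lam)
  show ?case
  proof (cases "lam = {#}")
    \<comment> \<open>The empty partition is its own \<open>pred_parts\<close>, so the descent must
      stop there.\<close>
    case True
    have "{m :: nat \<Rightarrow>\<^sub>0 nat. Poly_Mapping.keys m \<subseteq> {..<N} \<and> shape m = {#}} = {0}" for N
      by (auto simp: shape_def mset_set_empty_iff)
    then have "msym N lam = of_int 1" for N
      by (simp add: True msym_def shape_def)
    then show ?thesis
      using in_esym_ring_of_int[of 1] by simp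
  next
    case False
    obtain c :: "nat multiset \<Rightarrow> int" where c: "\<And>N. msym N lam = msym N (pred_parts lam) * esym N (size lam) -
      (\<Sum>nu\<in>{nu \<in> partitions_of (\<Sum>\<^sub># lam). size lam < size nu}. of_int (c nu) * msym N nu)"
      using msym_expansion[OF less.prems] by blast
    show ?thesis
      unfolding c
    proof (intro in_esym_ring_diff in_esym_ring_sum in_esym_ring_mult in_esym_ring_of_int in_esym_ring_esym)
      show "size lam > 0" using False nonempty_has_size by blast
      show "in_esym_ring (\<lambda>N. msym N (pred_parts lam))"
        using sum_pred_parts[OF less.prems] nonempty_has_size[of lam] False
        by (intro less.hyps) (auto simp: pred_parts_def)
    next
      fix nu assume "nu \<in> {nu \<in> partitions_of (\<Sum>\<^sub># lam). size lam < size nu}"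
      then show "in_esym_ring (\<lambda>N. msym N nu)"
        using size_le_sum_partition[of nu] by (intro less.hyps) (auto simp: partitions_of_def)
    qed
  qed
qed

text \<open>Existence discharges the choice operator; from here on the chosen polynomial is accessed
  through these identities.\<close>

lemma msym_in_esym:
  assumes "0 \<notin># lam"
  shows "zeval (esym N) (msym_in_esym lam) = msym N lam"
  using someI_ex[OF in_esym_ring_msym[OF assms, unfolded in_esym_ring_def]]
  unfolding msym_in_esym_def by auto

section \<open>Lagrange inversion\<close>
unbundle fps_syntax
unbundle no vec_syntax
no_notation Matrix.vec_index (infixl "$" 100)

lemma fps_power_nth_diag:
  fixes f :: "'a::comm_ring_1 fps"
  assumes "f $ 0 = 0"
  shows "(f ^ n) $ n = (f $ 1) ^ n"
  using startsby_zero_power_nth_same[OF assms] .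

text \<open>The library has compositional inverses only over fields.\<close>

fun left_compinv :: "'a::comm_ring_1 fps \<Rightarrow> nat \<Rightarrow> 'a" where
  "left_compinv f n = (if n = 1 then 1 else 0) - (\<Sum>i\<in>{..<n}. left_compinv f i * (f ^ i) $ n)"

declare left_compinv.simps [simp del]

text \<open>As \<open>f ^ n\<close> has leading coefficient 1 at x^n, the n-th equation can be
  solved for the n-th coefficient without division.\<close>

lemma left_compinv:
  fixes f :: "'a::comm_ring_1 fps"
  assumes "f $ 0 = 0" "f $ 1 = 1"
  shows "Abs_fps (left_compinv f) oo f = fps_X"
proof (rule fps_ext)
  fix n
  have "(Abs_fps (left_compinv f) oo f) $ n = (\<Sum>i\<in>{0..n}. left_compinv f i * (f ^ i) $ n)"
    by (simp add: fps_compose_nth)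
  also have "{0..n} = insert n {..<n}" by auto
  also have "(\<Sum>i\<in>insert n {..<n}. left_compinv f i * (f ^ i) $ n) =
      left_compinv f n + (\<Sum>i\<in>{..<n}. left_compinv f i * (f ^ i) $ n)"
    using assms by (simp add: fps_power_nth_diag)
  also have "\<dots> = fps_X $ n"
    by (subst left_compinv.simps) simp
  finally show "(Abs_fps (left_compinv f) oo f) $ n = fps_X $ n" .
qed

text \<open>Since \<open>b ^ j\<close> has no terms below x^j, the composition can be truncated at
  the same bound \<open>n\<close> in all the coefficients involved.\<close>

lemma fps_compose_mult_nth:
  fixes a b h :: "'a::comm_ring_1 fps"
  assumes "b $ 0 = 0"
  shows "((a oo b) * h) $ n = (\<Sum>j\<le>n. a $ j * (b ^ j * h) $ n)"
proof -
  have *: "(a oo b) $ i = (\<Sum>j\<le>n. a $ j * (b ^ j) $ i)" if "i \<le> n" for i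
    unfolding fps_compose_nth
  proof (rule sum.mono_neutral_left)
    show "\<forall>j\<in>{..n} - {0..i}. a $ j * (b ^ j) $ i = 0"
      using startsby_zero_power_prefix[OF assms] by auto
  qed (use that in auto)
  have "((a oo b) * h) $ n = (\<Sum>i=0..n. (\<Sum>j\<le>n. a $ j * (b ^ j) $ i) * h $ (n - i))"
    by (simp add: fps_mult_nth *)
  also have "\<dots> = (\<Sum>j\<le>n. \<Sum>i=0..n. a $ j * (b ^ j) $ i * h $ (n - i))"
    unfolding sum_distrib_right by (rule sum.swap)
  also have "\<dots> = (\<Sum>j\<le>n. a $ j * (b ^ j * h) $ n)"
    by (simp add: fps_mult_nth sum_distrib_left mult.assoc)
  finally show ?thesis .
qed

text \<open>In characteristic zero \<open>[x\<^sup>m] \<psi>\<^sup>m\<^sup>+\<^sup>1 f' = 0\<close> for \<open>f = x / \<psi>\<close> and \<open>m > 0\<close>, because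
  \<open>m \<psi>\<^sup>m\<^sup>+\<^sup>1 f' = m \<psi>\<^sup>m - x (\<psi>\<^sup>m)'\<close>.\<close>

theorem lagrange_inversion:
  fixes F psi g :: "'a::{idom, ring_char_0} fps"
  assumes F0: "F $ 0 = 1" and inv: "F * psi = 1" and g: "g oo (fps_X * F) = fps_X"
  shows "of_nat (n + 1) * g $ (n + 1) = (psi ^ (n + 1)) $ n"
proof -
  let ?f = "fps_X * F"
  have f0: "?f $ 0 = 0" by simp
  have psi0: "psi $ 0 = 1"
    using arg_cong[OF inv, of "\<lambda>h. h $ 0"] F0 by simp
  have df: "fps_deriv ?f = F + fps_X * fps_deriv F"
    by simp
  have one: "(fps_deriv g oo ?f) * fps_deriv ?f = 1"
    using arg_cong[OF g, of fps_deriv] fps_compose_deriv[OF f0, of g] by simp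
  \<comment> \<open>Multiplying the derivative of \<open>F * psi = 1\<close> by \<open>psi\<close>
    takes the place of the quotient rule.\<close>
  have dpsi: "fps_deriv psi = - (psi ^ 2 * fps_deriv F)"
  proof -
    have "F * fps_deriv psi + fps_deriv F * psi = 0"
      using arg_cong[OF inv, of fps_deriv] by simp
    then have "psi * (F * fps_deriv psi + fps_deriv F * psi) = 0" by simp
    then have "(F * psi) * fps_deriv psi + psi ^ 2 * fps_deriv F = 0"
      by (simp add: algebra_simps power2_eq_square)
    then show ?thesis
      unfolding inv by (simp add: add_eq_0_iff2)
  qed
  have zero: "(psi ^ (m + 1) * fps_deriv ?f) $ m = (if m = 0 then 1 else 0)" for m
  proof (cases "m = 0")
    case True
    then show ?thesis by (simp add: df F0 psi0)
  next
    case False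
    then obtain q where q: "m = Suc q"
      using not0_implies_Suc by blast
    have "fps_deriv (psi ^ m) = of_nat m * (fps_deriv psi * psi ^ q)"
      unfolding fps_deriv_power q fps_of_nat by simp
    then have "fps_X * fps_deriv (psi ^ m) = fps_X * (of_nat m * (- (psi ^ 2 * fps_deriv F) * psi ^ q))"
      by (simp only: dpsi)
    also have "\<dots> = - (of_nat m * (psi ^ (m + 1) * (fps_X * fps_deriv F)))"
      by (simp add: q power2_eq_square mult_ac del: of_nat_Suc)
    finally have "fps_X * fps_deriv (psi ^ m) = - (of_nat m * (psi ^ (m + 1) * (fps_X * fps_deriv F)))" .
    moreover have "psi ^ (m + 1) * F = psi ^ m"
      using inv by (simp add: mult.commute mult.left_commute mult.assoc[symmetric])
    ultimately have "of_nat m * (psi ^ (m + 1) * fps_deriv ?f) =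
        of_nat m * psi ^ m - fps_X * fps_deriv (psi ^ m)"
      unfolding df by (simp add: algebra_simps)
    then have "(of_nat m * (psi ^ (m + 1) * fps_deriv ?f)) $ m =
        (of_nat m * psi ^ m - fps_X * fps_deriv (psi ^ m)) $ m" by simp
    \<comment> \<open>Multiplication by x after differentiation multiplies the coefficient of x^m by
      m.\<close>
    also have "\<dots> = 0"
      using False by (simp add: fps_of_nat[symmetric] fps_X_mult_nth del: fps_of_nat)
    \<comment> \<open>The factor m cancels because the coefficients form a domain of characteristic
      zero.\<close>
    finally show ?thesis
      using False by (simp add: fps_of_nat[symmetric] del: fps_of_nat)
  qed
  \<comment> \<open>The factor 1 = (g' o f) f' is inserted in order to expand g' o f in powers of f,
    after which \<open>zero\<close> evaluates every term.\<close>
  have "psi ^ (n + 1) = (fps_deriv g oo ?f) * (psi ^ (n + 1) * fps_deriv ?f)"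
    using one by (simp add: mult.commute mult.left_commute mult.assoc[symmetric])
  then have "(psi ^ (n + 1)) $ n = (\<Sum>j\<le>n. fps_deriv g $ j * (?f ^ j * (psi ^ (n + 1) * fps_deriv ?f)) $ n)"
    using fps_compose_mult_nth[OF f0] by metis
  also have "\<dots> = (\<Sum>j\<le>n. if j = n then fps_deriv g $ n else 0)"
  proof (intro sum.cong refl)
    fix j assume "j \<in> {..n}"
    then obtain m where m: "n = j + m"
      by (auto simp: le_iff_add)
    \<comment> \<open>Since f^j = x^j F^j, the power of F cancels j factors psi and x^j shifts the
      coefficient from n to m.\<close>
    have "F ^ j * psi ^ (n + 1) = psi ^ (m + 1)"
      using inv by (simp add: m power_add mult.assoc[symmetric] power_mult_distrib[symmetric])
    moreover have "?f ^ j * (psi ^ (n + 1) * fps_deriv ?f) = fps_X ^ j * ((F ^ j * psi ^ (n + 1)) * fps_deriv ?f)"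
      by (simp only: power_mult_distrib mult_ac)
    ultimately have "?f ^ j * (psi ^ (n + 1) * fps_deriv ?f) = fps_X ^ j * (psi ^ (m + 1) * fps_deriv ?f)"
      by (simp only:)
    then have "(?f ^ j * (psi ^ (n + 1) * fps_deriv ?f)) $ n = (psi ^ (m + 1) * fps_deriv ?f) $ m"
      by (simp only: fps_X_power_mult_nth m) simp
    also have "\<dots> = (if j = n then 1 else 0)"
      unfolding zero m by simp
    finally show "fps_deriv g $ j * (?f ^ j * (psi ^ (n + 1) * fps_deriv ?f)) $ n =
        (if j = n then fps_deriv g $ n else 0)"
      by simp
  qed
  also have "\<dots> = of_nat (n + 1) * g $ (n + 1)"
    by simp
  finally show ?thesis ..
qed

text \<open>The coefficient of x^i in (1 + x)^(-(n + 1)), in an integral form.\<close>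

definition neg_binom :: "nat \<Rightarrow> nat \<Rightarrow> int" where
  "neg_binom n i = (- 1) ^ i * int ((n + i) choose i)"

lemma neg_binom_gchoose: "rat_of_int (neg_binom n i) = (- of_nat (n + 1)) gchoose i"
  unfolding neg_binom_def gbinomial_minus
  by (simp add: binomial_gbinomial algebra_simps)

text \<open>(1 + x)^(n + 1) (1 + x)^(-(n + 1)) = 1, coefficient by coefficient: Vandermonde's
  identity over the rationals.\<close>

lemma neg_binom_convolution:
  "(\<Sum>i\<le>m. int ((n + 1) choose i) * neg_binom n (m - i)) = (if m = 0 then 1 else 0)"
proof -
  have "rat_of_int (\<Sum>i\<le>m. int ((n + 1) choose i) * neg_binom n (m - i)) =
      (\<Sum>i\<le>m. (of_nat (n + 1) gchoose i) * ((- of_nat (n + 1)) gchoose (m - i)))"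
    by (simp add: neg_binom_gchoose binomial_gbinomial del: of_nat_Suc of_nat_add)
  also have "\<dots> = (of_nat (n + 1) + - of_nat (n + 1)) gchoose m"
    using gbinomial_Vandermonde[of "rat_of_nat (n + 1)" "- rat_of_nat (n + 1)" m] by (simp add: atLeast0AtMost)
  also have "\<dots> = rat_of_int (if m = 0 then 1 else 0)"
    by (cases m) (auto simp: gbinomial_0_left)
  finally show ?thesis
    by (simp only: of_int_eq_iff)
qed

section \<open>The exponent \<open>-(n + 1)\<close>\<close>

text \<open>The coefficient of x^n after \<open>k i\<close> x^i is put in for the variable of index
  i, see \<open>fps_nth_zeval_powers\<close>. The general target ring allows the passage from
  integers to rationals.\<close>

definition weighted_eval :: "nat \<Rightarrow> zpoly \<Rightarrow> (nat \<Rightarrow> 'a::comm_ring_1) \<Rightarrow> 'a" where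
  "weighted_eval n P k = (\<Sum>m\<in>{m \<in> Poly_Mapping.keys P. wt m = n}.
     of_int (Poly_Mapping.lookup P m) * (\<Prod>i\<in>Poly_Mapping.keys m. k i ^ Poly_Mapping.lookup m i))"

lemma of_int_weighted_eval: "of_int (weighted_eval n P k) = weighted_eval n P (\<lambda>i. of_int (k i))"
  by (simp add: weighted_eval_def)

section \<open>Polynomial functions on the rationals\<close>

definition polynomial_fun :: "(rat \<Rightarrow> rat) \<Rightarrow> bool" where
  "polynomial_fun f \<longleftrightarrow> (\<exists>p. \<forall>x. f x = poly p x)"

lemma polynomial_fun_const: "polynomial_fun (\<lambda>x. c)"
  unfolding polynomial_fun_def by (rule exI[of _ "[:c:]"]) simp

lemma polynomial_fun_id: "polynomial_fun (\<lambda>x. x)"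
  unfolding polynomial_fun_def by (rule exI[of _ "[:0, 1:]"]) simp

lemma polynomial_fun_add: "polynomial_fun f \<Longrightarrow> polynomial_fun g \<Longrightarrow> polynomial_fun (\<lambda>x. f x + g x)"
  unfolding polynomial_fun_def by (metis poly_add)

lemma polynomial_fun_diff: "polynomial_fun f \<Longrightarrow> polynomial_fun g \<Longrightarrow> polynomial_fun (\<lambda>x. f x - g x)"
  unfolding polynomial_fun_def by (metis poly_diff)

lemma polynomial_fun_mult: "polynomial_fun f \<Longrightarrow> polynomial_fun g \<Longrightarrow> polynomial_fun (\<lambda>x. f x * g x)"
  unfolding polynomial_fun_def by (metis poly_mult)

lemma polynomial_fun_sum: "(\<And>i. i \<in> A \<Longrightarrow> polynomial_fun (f i)) \<Longrightarrow> polynomial_fun (\<lambda>x. \<Sum>i\<in>A. f i x)"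
  by (induction A rule: infinite_finite_induct) (auto intro: polynomial_fun_const polynomial_fun_add)

lemma polynomial_fun_prod: "(\<And>i. i \<in> A \<Longrightarrow> polynomial_fun (f i)) \<Longrightarrow> polynomial_fun (\<lambda>x. \<Prod>i\<in>A. f i x)"
  by (induction A rule: infinite_finite_induct) (auto intro: polynomial_fun_const polynomial_fun_mult)

lemma polynomial_fun_power: "polynomial_fun f \<Longrightarrow> polynomial_fun (\<lambda>x. f x ^ n)"
  by (induction n) (auto intro: polynomial_fun_const polynomial_fun_mult)

lemma polynomial_fun_gchoose: "polynomial_fun (\<lambda>x. x gchoose i)"
proof -
  have "polynomial_fun (\<lambda>x. (\<Prod>j\<in>{0..<i}. x - of_nat j) * inverse (fact i))"
    by (intro polynomial_fun_mult polynomial_fun_prod polynomial_fun_diff polynomial_fun_const polynomial_fun_id)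
  then show ?thesis
    by (simp add: gbinomial_prod_rev field_simps)
qed

lemma polynomial_fun_weighted_eval: "polynomial_fun (\<lambda>x. weighted_eval n P (\<lambda>i. x gchoose i))"
  unfolding weighted_eval_def
  by (intro polynomial_fun_sum polynomial_fun_mult polynomial_fun_const polynomial_fun_prod
      polynomial_fun_power polynomial_fun_gchoose)

text \<open>All natural numbers are roots of the difference, too many for a nonzero
  polynomial.\<close>

lemma polynomial_fun_eqI:
  assumes "polynomial_fun f" "polynomial_fun g" "\<And>N::nat. f (of_nat N) = g (of_nat N)"
  shows "f = g"
proof -
  obtain p q where pq: "\<And>x. f x = poly p x" "\<And>x. g x = poly q x"
    using assms(1,2) unfolding polynomial_fun_def by blast
  have "p - q = 0"
  proof (rule ccontr)
    assume "p - q \<noteq> 0"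
    then have "finite {x. poly (p - q) x = 0}" by (rule poly_roots_finite)
    moreover have "range (of_nat :: nat \<Rightarrow> rat) \<subseteq> {x. poly (p - q) x = 0}"
      using assms(3) by (auto simp: pq)
    ultimately have "finite (range (of_nat :: nat \<Rightarrow> rat))"
      by (rule finite_subset[rotated])
    then show False
      by (simp add: finite_image_iff inj_on_def)
  qed
  then show ?thesis
    using pq by auto
qed

lemma fps_nth_zeval_powers:
  "fps_nth (zeval (\<lambda>i. of_int (k i) * fps_X ^ i) P :: int fps) n = weighted_eval n P k"
proof -
  have *: "fps_nth (of_int c * fps_X ^ w :: int fps) n = (if w = n then c else 0)" for c w
    by (simp add: fps_of_int[symmetric] fps_X_power_nth del: fps_of_int)
  show ?thesis
    unfolding zeval_powers fps_sum_nth * by (simp add: weighted_eval_def sum.inter_filter)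
qed

text \<open>The value m_lambda(1, ..., 1) at \<open>N\<close> ones.\<close>

definition num_shape :: "nat \<Rightarrow> nat multiset \<Rightarrow> nat" where
  "num_shape N lam = card {m. Poly_Mapping.keys m \<subseteq> {..<N} \<and> shape m = lam}"

text \<open>Specialize all \<open>N\<close> roots of \<open>m\<^sub>\<lambda>\<close> to the same value \<open>x\<close>, so that \<open>e\<^sub>i\<close> becomes \<open>binom N i x\<^sup>i\<close>.\<close>

lemma weighted_eval_msym_binomial:
  assumes "0 \<notin># lam"
  shows "weighted_eval (\<Sum>\<^sub># lam) (msym_in_esym lam) (\<lambda>i. int (N choose i)) = int (num_shape N lam)"
proof -
  let ?X = "fps_X :: int fps" and ?n = "\<Sum>\<^sub># lam" and ?P = "msym_in_esym lam"
  have e: "zeval (\<lambda>_. ?X) (esym N i) = of_int (int (N choose i)) * ?X ^ i" for i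
  proof -
    have "zeval (\<lambda>_. ?X) (esym N i) = (\<Sum>S | S \<subseteq> {..<N} \<and> card S = i. ?X ^ i)"
      unfolding esym_def zeval_sum zeval_prod by (intro sum.cong) auto
    also have "\<dots> = of_nat (card {S. S \<subseteq> {..<N} \<and> card S = i}) * ?X ^ i"
      by simp
    also have "card {S. S \<subseteq> {..<N} \<and> card S = i} = N choose i"
      using n_subsets[of "{..<N}" i] by simp
    finally show ?thesis by simp
  qed
  have "zeval (\<lambda>_. ?X) (msym N lam) =
      (\<Sum>m\<in>{m. Poly_Mapping.keys m \<subseteq> {..<N} \<and> shape m = lam}. ?X ^ ?n)"
    unfolding msym_def shape_def[symmetric] zeval_sum
    by (intro sum.cong refl) (auto simp: zeval_single sum_shape power_sum simp flip: power_sum)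
  also have "\<dots> = of_nat (num_shape N lam) * ?X ^ ?n"
    by (simp add: num_shape_def)
  finally have "zeval (\<lambda>i. of_int (int (N choose i)) * ?X ^ i) ?P = of_nat (num_shape N lam) * ?X ^ ?n"
    using msym_in_esym[OF assms, of N] zeval_zeval[of "\<lambda>_. ?X" "esym N" ?P] by (simp only: e)
  then have "weighted_eval ?n ?P (\<lambda>i. int (N choose i)) = (of_nat (num_shape N lam) * ?X ^ ?n) $ ?n"
    using fps_nth_zeval_powers[of "\<lambda>i. int (N choose i)" ?P ?n] by (simp only:)
  then show ?thesis
    by (simp add: fps_of_nat[symmetric] fps_X_power_nth del: fps_of_nat)
qed

text \<open>The total class of one root x, which is also f(x) / x for the generic series f
  (\<open>generic_series_eq\<close>); this double role links Chern numbers to Lagrange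
  inversion.\<close>

definition class_series :: "zpoly fps" where
  "class_series = Abs_fps (\<lambda>i. if i = 0 then 1 else zvar i)"

text \<open>Expanding the power means choosing an exponent for each of \<open>N\<close> roots; the
  choices are monomials of degree \<open>n\<close>, and those of equal shape give the same product
  of variables.\<close>

lemma class_series_power_nth:
  "(class_series ^ N) $ n = (\<Sum>lam\<in>partitions_of n. of_nat (num_shape N lam) * (\<Prod>i\<in>#lam. zvar i))"
proof -
  let ?M = "{m. Poly_Mapping.keys m \<subseteq> {..<N} \<and> \<Sum>\<^sub># (shape m) = n}"
  have M: "?M = (\<Union>lam\<in>partitions_of n. {m. Poly_Mapping.keys m \<subseteq> {..<N} \<and> shape m = lam})"
    using zero_notin_shape by (auto simp: partitions_of_def)
  then have fin: "finite ?M"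
    using finite_partitions_of finite_shape_set by simp
  let ?L = "\<lambda>m. map (Poly_Mapping.lookup m) [0..<N]"
  have "(class_series ^ N) $ n = (\<Sum>m\<in>?M. \<Prod>i\<in>#shape m. zvar i)"
  proof (cases "N = 0")
    case True
    have "?M = (if n = 0 then {0} else {})"
      by (auto simp: True shape_def)
    then show ?thesis
      by (simp add: True shape_def)
  next
    case False
    then obtain k where N: "N = Suc k" by (cases N) auto
    have "(class_series ^ N) $ n = (\<Sum>v\<in>natpermute n N. \<Prod>j<N. class_series $ (v ! j))"
      unfolding N fps_power_nth_Suc by (simp add: atLeast0AtMost lessThan_Suc_atMost)
    also have "\<dots> = (\<Sum>m\<in>?M. \<Prod>j<N. class_series $ (?L m ! j))"
    \<comment> \<open>\<open>N\<close>-tuples of exponents with sum \<open>n\<close> correspond to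
      exponent vectors supported in \<open>{..<N}\<close>.\<close>
    proof (rule sum.reindex_bij_witness[of _ "?L" "\<lambda>v. Abs_poly_mapping (\<lambda>j. if j < N then v ! j else 0)"])
      fix v assume v: "v \<in> natpermute n N"
      then have len: "length v = N" and sum: "sum_list v = n"
        by (auto simp: natpermute_def)
      have lk: "Poly_Mapping.lookup (Abs_poly_mapping (\<lambda>j. if j < N then v ! j else 0)) = (\<lambda>j. if j < N then v ! j else 0)"
        by (rule lookup_Abs_poly_mapping) simp
      show "?L (Abs_poly_mapping (\<lambda>j. if j < N then v ! j else 0)) = v"
        unfolding lk using len by (intro nth_equalityI) auto
      have k: "Poly_Mapping.keys (Abs_poly_mapping (\<lambda>j. if j < N then v ! j else 0)) \<subseteq> {..<N}"
        by (auto simp only: in_keys_iff lk) (auto split: if_splits)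
      have "\<Sum>\<^sub># (shape (Abs_poly_mapping (\<lambda>j. if j < N then v ! j else 0))) = (\<Sum>j<N. v ! j)"
        unfolding sum_shape_superset[OF finite_lessThan k] lk by simp
      also have "\<dots> = n"
        using sum len by (simp add: sum_list_sum_nth atLeast0LessThan)
      finally show "Abs_poly_mapping (\<lambda>j. if j < N then v ! j else 0) \<in> ?M"
        using k by simp
      show "(\<Prod>j<N. class_series $ (?L (Abs_poly_mapping (\<lambda>j. if j < N then v ! j else 0)) ! j)) =
         (\<Prod>j<N. class_series $ (v ! j))"
        unfolding lk by simp
    next
      fix m assume m: "m \<in> ?M"
      show "Abs_poly_mapping (\<lambda>j. if j < N then ?L m ! j else 0) = m"
      proof (rule poly_mapping_eqI)
        fix x
        have "Poly_Mapping.lookup (Abs_poly_mapping (\<lambda>j. if j < N then ?L m ! j else 0)) = (\<lambda>j. if j < N then ?L m ! j else 0)"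
          by (rule lookup_Abs_poly_mapping) simp
        then show "Poly_Mapping.lookup (Abs_poly_mapping (\<lambda>j. if j < N then ?L m ! j else 0)) x = Poly_Mapping.lookup m x"
          using m by (auto simp: in_keys_iff)
      qed
      have "sum_list (?L m) = (\<Sum>j<N. Poly_Mapping.lookup m j)"
        by (simp add: sum_list_sum_nth atLeast0LessThan)
      then show "?L m \<in> natpermute n N"
        using m sum_shape_superset[of "{..<N}" m] by (simp add: natpermute_def)
    qed
    also have "\<dots> = (\<Sum>m\<in>?M. \<Prod>i\<in>#shape m. zvar i)"
    proof (intro sum.cong refl)
      fix m assume m: "m \<in> ?M"
      have "(\<Prod>j<N. class_series $ (?L m ! j)) = (\<Prod>j<N. class_series $ Poly_Mapping.lookup m j)"
        by (intro prod.cong) auto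
      \<comment> \<open>Roots with exponent 0 contribute the constant coefficient 1.\<close>
      also have "\<dots> = (\<Prod>j\<in>Poly_Mapping.keys m. zvar (Poly_Mapping.lookup m j))"
        using m by (intro prod.mono_neutral_cong_right) (auto simp: class_series_def in_keys_iff)
      also have "\<dots> = (\<Prod>i\<in>#shape m. zvar i)"
        by (simp add: shape_def prod_unfold_prod_mset multiset.map_comp o_def)
      finally show "(\<Prod>j<N. class_series $ (?L m ! j)) = (\<Prod>i\<in>#shape m. zvar i)" .
    qed
    finally show ?thesis .
  qed
  also have "\<dots> = (\<Sum>lam\<in>partitions_of n. \<Sum>m\<in>{m \<in> ?M. shape m = lam}. \<Prod>i\<in>#shape m. zvar i)"
    using fin finite_partitions_of zero_notin_shape by (intro sum.group[symmetric]) (auto simp: partitions_of_def)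
  also have "\<dots> = (\<Sum>lam\<in>partitions_of n. of_nat (num_shape N lam) * (\<Prod>i\<in>#lam. zvar i))"
  proof (intro sum.cong refl)
    fix lam assume lam: "lam \<in> partitions_of n"
    then have "{m \<in> ?M. shape m = lam} = {m. Poly_Mapping.keys m \<subseteq> {..<N} \<and> shape m = lam}"
      by (auto simp: partitions_of_def)
    then show "(\<Sum>m\<in>{m \<in> ?M. shape m = lam}. \<Prod>i\<in>#shape m. zvar i) =
        of_nat (num_shape N lam) * (\<Prod>i\<in>#lam. zvar i)"
      by (simp add: num_shape_def)
  qed
  finally show ?thesis .
qed

text \<open>Powers of \<open>class_series - 1\<close> beyond the n-th do not reach x^n. A summation
  range independent of \<open>N\<close> makes the dependence on \<open>N\<close> visibly
  polynomial.\<close>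

lemma class_series_power_nth_binomial:
  "(class_series ^ N) $ n = (\<Sum>j\<le>n. of_nat (N choose j) * ((class_series - 1) ^ j) $ n)"
proof -
  let ?G = "class_series - 1"
  have G0: "?G $ 0 = 0"
    by (simp add: class_series_def)
  have "(class_series ^ N) $ n = ((?G + 1) ^ N) $ n"
    by simp
  also have "\<dots> = (\<Sum>j\<le>N. of_nat (N choose j) * (?G ^ j) $ n)"
    unfolding binomial_ring fps_sum_nth
    by (intro sum.cong refl) (simp add: fps_of_nat[symmetric] del: fps_of_nat)
  also have "\<dots> = (\<Sum>j\<le>max N n. of_nat (N choose j) * (?G ^ j) $ n)"
    by (intro sum.mono_neutral_left) auto
  also have "\<dots> = (\<Sum>j\<le>n. of_nat (N choose j) * (?G ^ j) $ n)"
    using startsby_zero_power_prefix[OF G0] by (intro sum.mono_neutral_right) auto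
  finally show ?thesis .
qed

lemma lookup_of_int_mult:
  "Poly_Mapping.lookup (of_int a * P :: zpoly) m = a * Poly_Mapping.lookup P m"
proof -
  have "of_int a * P = Poly_Mapping.map ((*) a) P"
    using single_of_int[of a, where 'a = "nat \<Rightarrow>\<^sub>0 nat" and 'b = int] by (simp add: mult_map_scale_conv_mult)
  then show ?thesis
    by (simp add: map.rep_eq when_def)
qed

text \<open>For each monomial \<open>mu\<close> in the t_i, its coefficients on both sides are
  values at y = -(q + 1) of rational polynomials \<open>f\<close> and \<open>g\<close> in the
  exponent y. These agree at y = N by the two expansions of \<open>class_series ^ N\<close>.\<close>

lemma sum_msym_neg_binom:
  "(\<Sum>lam\<in>partitions_of n. of_int (weighted_eval n (msym_in_esym lam) (neg_binom q)) * (\<Prod>i\<in>#lam. zvar i)) =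
   (\<Sum>j\<le>n. of_int (neg_binom q j) * ((class_series - 1) ^ j) $ n)"
proof (rule poly_mapping_eqI)
  fix mu :: "nat \<Rightarrow>\<^sub>0 nat"
  let ?l = "\<lambda>P. Poly_Mapping.lookup P mu"
  define f where "f y = (\<Sum>lam\<in>partitions_of n. weighted_eval n (msym_in_esym lam) (\<lambda>i. y gchoose i) *
      rat_of_int (?l (\<Prod>i\<in>#lam. zvar i)))" for y
  define g where "g y = (\<Sum>j\<le>n. (y gchoose j) * rat_of_int (?l (((class_series - 1) ^ j) $ n)))" for y
  have "f = g"
  proof (rule polynomial_fun_eqI)
    show "polynomial_fun f" "polynomial_fun g"
      unfolding f_def g_def
      by (intro polynomial_fun_sum polynomial_fun_mult polynomial_fun_weighted_eval polynomial_fun_const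
          polynomial_fun_gchoose)+
    fix N :: nat
    have "weighted_eval n (msym_in_esym lam) (\<lambda>i. rat_of_nat N gchoose i) = rat_of_int (int (num_shape N lam))"
      if "lam \<in> partitions_of n" for lam
    proof -
      have *: "0 \<notin># lam" "\<Sum>\<^sub># lam = n"
        using that by (auto simp: partitions_of_def)
      show ?thesis
        using weighted_eval_msym_binomial[OF *(1), of N, unfolded *(2)]
          of_int_weighted_eval[of n "msym_in_esym lam" "\<lambda>i. int (N choose i)", where 'a = rat]
        by (simp add: binomial_gbinomial)
    qed
    then have "f (of_nat N) = rat_of_int (?l (\<Sum>lam\<in>partitions_of n. of_int (int (num_shape N lam)) * (\<Prod>i\<in>#lam. zvar i)))"
      unfolding f_def lookup_sum lookup_of_int_mult by simp
    also have "\<dots> = rat_of_int (?l (\<Sum>j\<le>n. of_int (int (N choose j)) * ((class_series - 1) ^ j) $ n))"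
      using class_series_power_nth[of N n] class_series_power_nth_binomial[of N n] by simp
    also have "\<dots> = g (of_nat N)"
      unfolding g_def lookup_sum lookup_of_int_mult by (simp add: binomial_gbinomial)
    finally show "f (of_nat N) = g (of_nat N)" .
  qed
  then have "f (- of_nat (q + 1)) = g (- of_nat (q + 1))" by simp
  moreover have "f (- of_nat (q + 1)) = rat_of_int (?l (\<Sum>lam\<in>partitions_of n.
      of_int (weighted_eval n (msym_in_esym lam) (neg_binom q)) * (\<Prod>i\<in>#lam. zvar i)))"
    unfolding f_def lookup_sum lookup_of_int_mult of_int_sum of_int_mult of_int_weighted_eval[where 'a = rat] neg_binom_gchoose ..
  moreover have "g (- of_nat (q + 1)) = rat_of_int (?l (\<Sum>j\<le>n. of_int (neg_binom q j) * ((class_series - 1) ^ j) $ n))"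
    unfolding g_def lookup_sum lookup_of_int_mult of_int_sum of_int_mult neg_binom_gchoose ..
  ultimately show "?l (\<Sum>lam\<in>partitions_of n. of_int (weighted_eval n (msym_in_esym lam) (neg_binom q)) * (\<Prod>i\<in>#lam. zvar i)) =
    ?l (\<Sum>j\<le>n. of_int (neg_binom q j) * ((class_series - 1) ^ j) $ n)"
    by (simp only: of_int_eq_iff)
qed

text \<open>The binomial series of exponent -(q + 1), expanded around 1.\<close>

definition class_series_neg_power :: "nat \<Rightarrow> zpoly fps" where
  "class_series_neg_power q = Abs_fps (\<lambda>j. of_int (neg_binom q j)) oo (class_series - 1)"

lemma class_series_neg_power: "class_series ^ (q + 1) * class_series_neg_power q = 1"
proof -
  let ?G = "class_series - 1"
  have G0: "?G $ 0 = 0"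
    by (simp add: class_series_def)
  have "(1 + fps_X) ^ (q + 1) * Abs_fps (\<lambda>j. of_int (neg_binom q j)) = (1 :: zpoly fps)"
  proof (rule fps_ext)
    fix m
    have "((1 + fps_X :: zpoly fps) ^ (q + 1)) $ i = of_int (int ((q + 1) choose i))" for i
    proof -
      have "((1 + fps_X :: zpoly fps) ^ (q + 1)) $ i = (\<Sum>k\<le>q + 1. of_nat ((q + 1) choose k) * (if i = k then 1 else 0))"
        unfolding add.commute[of 1 fps_X] binomial_ring fps_sum_nth
        by (intro sum.cong refl) (simp add: fps_of_nat[symmetric] fps_X_power_nth del: fps_of_nat)
      also have "\<dots> = of_nat ((q + 1) choose i)"
        by (auto simp: if_distrib not_le cong: if_cong)
      finally show ?thesis by simp
    qed
    then have "((1 + fps_X) ^ (q + 1) * Abs_fps (\<lambda>j. of_int (neg_binom q j))) $ m =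
       (of_int (\<Sum>i\<le>m. int ((q + 1) choose i) * neg_binom q (m - i)) :: zpoly)"
      by (simp add: fps_mult_nth atLeast0AtMost)
    also have "\<dots> = 1 $ m"
      unfolding neg_binom_convolution by simp
    finally show "((1 + fps_X) ^ (q + 1) * Abs_fps (\<lambda>j. of_int (neg_binom q j))) $ m = (1 :: zpoly fps) $ m" .
  qed
  then have "((1 + fps_X) ^ (q + 1) * Abs_fps (\<lambda>j. of_int (neg_binom q j)) :: zpoly fps) oo ?G = 1"
    by simp
  moreover have "(1 + fps_X) ^ (q + 1) oo ?G = class_series ^ (q + 1)"
  proof -
    have "(1 + fps_X) oo ?G = class_series"
      by (rule fps_ext) (auto simp: fps_compose_add_distrib fps_X_fps_compose class_series_def)
    then show ?thesis
      by (simp only: fps_compose_power[OF G0, symmetric])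
  qed
  ultimately show ?thesis
    unfolding class_series_neg_power_def by (simp only: fps_compose_mult_distrib[OF G0])
qed

lemma generic_series_eq: "generic_series = fps_X * class_series"
  by (rule fps_ext) (auto simp: generic_series_def class_series_def fps_X_mult_nth)

lemma lagrange_poly_eq:
  "of_nat (n + 1) * lagrange_poly n = class_series_neg_power n $ n"
proof -
  have f: "generic_series $ 0 = 0" "generic_series $ 1 = 1"
    by (simp_all add: generic_series_def)
  \<comment> \<open>Existence comes from the recursion \<open>left_compinv\<close>, uniqueness from
    injectivity of composition with a series that starts with x.\<close>
  have g: "(THE g. g oo generic_series = fps_X) oo generic_series = fps_X"
  proof (rule theI)
    show "Abs_fps (left_compinv generic_series) oo generic_series = fps_X"
      by (rule left_compinv[OF f])
    fix g assume "g oo generic_series = fps_X"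
    then show "g = Abs_fps (left_compinv generic_series)"
      using left_compinv[OF f] f
        fps_compose_inj_right[of generic_series g "Abs_fps (left_compinv generic_series)"] by simp
  qed
  have T0: "class_series $ 0 = 1"
    by (simp add: class_series_def)
  have inv: "class_series * class_series_neg_power 0 = 1"
    using class_series_neg_power[of 0] by simp
  \<comment> \<open>Both sides are inverse to \<open>class_series ^ (n + 1)\<close>.\<close>
  have "class_series_neg_power 0 ^ (n + 1) = class_series_neg_power n"
  proof -
    have "class_series ^ (n + 1) * class_series_neg_power 0 ^ (n + 1) = 1"
      by (simp only: power_mult_distrib[symmetric] inv power_one)
    then have "class_series_neg_power 0 ^ (n + 1) * (class_series ^ (n + 1) * class_series_neg_power n) = class_series_neg_power n"
      by (simp only: mult.assoc[symmetric] mult.commute[of "class_series_neg_power 0 ^ (n + 1)"] mult_1_left)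
    then show ?thesis
      by (simp only: class_series_neg_power mult_1_right)
  qed
  then show ?thesis
    using lagrange_inversion[OF T0 inv g[unfolded generic_series_eq]]
    unfolding lagrange_poly_def generic_series_eq by simp
qed

theorem sum_msym_neg_binom_eq_lagrange:
  "(\<Sum>lam\<in>partitions_of n. of_int (weighted_eval n (msym_in_esym lam) (neg_binom n)) * (\<Prod>i\<in>#lam. zvar i)) =
   of_nat (n + 1) * lagrange_poly n"
  unfolding sum_msym_neg_binom lagrange_poly_eq class_series_neg_power_def
  by (simp add: fps_compose_nth atLeast0AtMost)

section \<open>The cohomology ring\<close>

lemma pairing_superset:
  assumes "finite A" "Poly_Mapping.keys z \<subseteq> A"
  shows "pairing p a z = (\<Sum>s\<in>A. Poly_Mapping.lookup z s * cochain_val a p s)"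
  unfolding pairing_def using assms by (intro sum.mono_neutral_left) (auto simp: in_keys_iff)

lemma pairing_0 [simp]: "pairing p a 0 = 0"
  by (simp add: pairing_def)

lemma pairing_frag_of [simp]: "pairing p a (frag_of s) = cochain_val a p s"
  by (simp add: pairing_def)

lemma pairing_add: "pairing p a (z + w) = pairing p a z + pairing p a w"
proof -
  let ?A = "Poly_Mapping.keys z \<union> Poly_Mapping.keys w"
  have "Poly_Mapping.keys (z + w) \<subseteq> ?A"
    by (rule keys_add)
  then show ?thesis
    by (simp add: pairing_superset[of ?A] lookup_add distrib_right sum.distrib)
qed

lemma pairing_cmul: "pairing p a (frag_cmul k z) = k * pairing p a z"
proof -
  have "Poly_Mapping.keys (frag_cmul k z) \<subseteq> Poly_Mapping.keys z"
    by (rule keys_cmul)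
  then show ?thesis
    by (simp add: pairing_superset[of "Poly_Mapping.keys z"] sum_distrib_left mult.assoc)
qed

lemma pairing_diff: "pairing p a (z - w) = pairing p a z - pairing p a w"
  using pairing_add[of p a "z - w" w] by simp

lemma pairing_sum: "pairing p a (sum f I) = (\<Sum>i\<in>I. pairing p a (f i))"
  by (induction I rule: infinite_finite_induct) (simp_all add: pairing_add)

lemma pairing_frag_extend:
  "pairing q b (frag_extend f z) = (\<Sum>s\<in>Poly_Mapping.keys z. Poly_Mapping.lookup z s * pairing q b (f s))"
  by (simp add: frag_extend_def pairing_sum pairing_cmul)

lemma pairing_cochain_add: "pairing p (a + b) z = pairing p a z + pairing p b z"
  by (simp add: pairing_def plus_cochain.rep_eq distrib_left sum.distrib)

lemma pairing_cochain_0 [simp]: "pairing p 0 z = 0"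
  by (simp add: pairing_def zero_cochain.rep_eq)

lemma pairing_cochain_sum: "pairing p (sum f I) z = (\<Sum>i\<in>I. pairing p (f i) z)"
  by (induction I rule: infinite_finite_induct) (simp_all add: pairing_cochain_add)

lemma cochain_val_of_nat: "cochain_val (of_nat k * a) p s = int k * cochain_val a p s"
  by (induction k) (simp_all add: zero_cochain.rep_eq plus_cochain.rep_eq distrib_right)

lemma cochain_val_of_int: "cochain_val (of_int k * a) p s = k * cochain_val a p s"
  by (cases k rule: int_cases2) (simp_all add: cochain_val_of_nat uminus_cochain.rep_eq)

lemma pairing_of_int: "pairing p (of_int k * a) z = k * pairing p a z"
  by (simp add: pairing_def cochain_val_of_int sum_distrib_left mult.left_commute)

text \<open>The coboundary is kept as a number instead of a cochain;
  \<open>pairing_boundary_frag_of\<close> ties it to \<open>chain_boundary\<close>.\<close>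

definition coboundary_val :: "'a cochain \<Rightarrow> nat \<Rightarrow> ((nat \<Rightarrow> real) \<Rightarrow> 'a) \<Rightarrow> int" where
  "coboundary_val e p s = (\<Sum>k\<le>Suc p. (- 1) ^ k * cochain_val e p (singular_face (Suc p) k s))"

lemma pairing_boundary_frag_of:
  "pairing p e (chain_boundary (Suc p) (frag_of s)) = coboundary_val e p s"
  by (simp add: chain_boundary_of pairing_sum pairing_cmul coboundary_val_def del: sum.atMost_Suc)

lemma pairing_boundary:
  "pairing p e (chain_boundary (Suc p) z) = (\<Sum>s\<in>Poly_Mapping.keys z. Poly_Mapping.lookup z s * coboundary_val e p s)"
proof -
  have "chain_boundary (Suc p) z = frag_extend (\<lambda>s. chain_boundary (Suc p) (frag_of s)) z"
    by (simp add: chain_boundary_def)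
  then show ?thesis
    by (simp only: pairing_frag_extend pairing_boundary_frag_of)
qed

section \<open>Faces of front and back faces, and the Leibniz rule\<close>

lemma simplical_face_vertex: "k > p \<Longrightarrow> x \<in> standard_simplex p \<Longrightarrow> simplical_face k x = x"
  by (auto simp: simplical_face_def standard_simplex_def fun_eq_iff)

lemma front_face_singular_face_le:
  assumes "k \<le> p" "p \<le> n"
  shows "front_face p (singular_face (Suc n) k s) = singular_face (Suc p) k (front_face (Suc p) s)"
proof -
  have "simplical_face k x \<in> standard_simplex (Suc p)" if "x \<in> standard_simplex p" for x
    using simplical_face_in_standard_simplex[of "Suc p" k x] that assms by simp
  then show ?thesis
    using assms by (auto simp: front_face_def singular_face_def restrict_def fun_eq_iff intro: standard_simplex_le)
qed

lemma front_face_singular_face_gt: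
  assumes "p < k" "p \<le> n"
  shows "front_face p (singular_face (Suc n) k s) = front_face p s"
  using assms by (auto simp: front_face_def singular_face_def restrict_def fun_eq_iff simplical_face_vertex
      intro: standard_simplex_le)

lemma back_face_singular_face_le:
  assumes "k \<le> p"
  shows "back_face p q (singular_face (Suc (p + q)) k s) = back_face (Suc p) q s"
proof -
  have 1: "simplical_face k (\<lambda>i. if i < p then 0 else x (i - p)) = (\<lambda>i. if i < Suc p then 0 else x (i - Suc p))"
    for x :: "nat \<Rightarrow> real"
    using assms by (auto simp: simplical_face_def fun_eq_iff)
  then show ?thesis
    by (auto simp: back_face_def singular_face_def restrict_def fun_eq_iff back_shift_in_simplex 1)
qed

lemma back_face_singular_face_gt:
  assumes "p \<le> k" "k \<le> Suc (p + q)"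
  shows "back_face p q (singular_face (Suc (p + q)) k s) = singular_face (Suc q) (k - p) (back_face p (Suc q) s)"
proof -
  have 1: "simplical_face k (\<lambda>i. if i < p then 0 else x (i - p)) = (\<lambda>i. if i < p then 0 else simplical_face (k - p) x (i - p))"
    for x :: "nat \<Rightarrow> real"
  proof
    fix i
    show "simplical_face k (\<lambda>i. if i < p then 0 else x (i - p)) i = (if i < p then 0 else simplical_face (k - p) x (i - p))"
      using assms(1) by (auto simp: simplical_face_def)
  qed
  have "simplical_face (k - p) x \<in> standard_simplex (Suc q)" if "x \<in> standard_simplex q" for x
    using simplical_face_in_standard_simplex[of "Suc q" "k - p" x] that assms by simp
  then show ?thesis
    by (auto simp: back_face_def singular_face_def restrict_def fun_eq_iff back_shift_in_simplex 1)
qed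

text \<open>Faces 0 to p change only the front part, faces p + 1 to p + q + 1 only the back part.
  Completing the two sums to coboundaries adds the last face of the front (p + 1)-face and the first
  face of the back (q + 1)-face; both give \<open>?a * ?b\<close>, with opposite signs, and
  cancel.\<close>

lemma leibniz:
  "(\<Sum>k\<le>Suc (p + q). (- 1) ^ k * (cochain_val a p (front_face p (singular_face (Suc (p + q)) k s)) *
      cochain_val b q (back_face p q (singular_face (Suc (p + q)) k s)))) =
   coboundary_val a p (front_face (Suc p) s) * cochain_val b q (back_face (Suc p) q s) +
   (- 1) ^ p * (cochain_val a p (front_face p s) * coboundary_val b q (back_face p (Suc q) s))"
  (is "?L = _")
proof -
  let ?A = "\<lambda>k. cochain_val a p (singular_face (Suc p) k (front_face (Suc p) s))"
  let ?B = "\<lambda>k. cochain_val b q (singular_face (Suc q) k (back_face p (Suc q) s))"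
  let ?a = "cochain_val a p (front_face p s)" and ?b = "cochain_val b q (back_face (Suc p) q s)"
  have "singular_face (Suc p) (Suc p) (front_face (Suc p) s) = front_face p s"
    by (auto simp: front_face_def singular_face_def restrict_def fun_eq_iff simplical_face_vertex[of p "Suc p"]
        standard_simplex_le[of p "Suc p"])
  then have A: "?A (Suc p) = ?a" by simp
  have B: "?B 0 = ?b"
    using back_face_singular_face_le[of p p q s] back_face_singular_face_gt[of p p q s] by simp
  have split: "{..Suc (p + q)} = {..p} \<union> {Suc p..Suc (p + q)}" by auto
  have "?L = (\<Sum>k\<le>p. (- 1) ^ k * (?A k * ?b)) + (\<Sum>k=Suc p..Suc (p + q). (- 1) ^ k * (?a * ?B (k - p)))"
    unfolding split
    by (subst sum.union_disjoint)
      (auto intro!: arg_cong2[of _ _ _ _ "(+)"] sum.cong simp: front_face_singular_face_le front_face_singular_face_gt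
        back_face_singular_face_le back_face_singular_face_gt)
  also have "(\<Sum>k\<le>p. (- 1) ^ k * (?A k * ?b)) = (coboundary_val a p (front_face (Suc p) s) - (- 1) ^ Suc p * ?a) * ?b"
    unfolding coboundary_val_def by (simp add: A sum_distrib_right mult.assoc)
  also have "(\<Sum>k=Suc p..Suc (p + q). (- 1) ^ k * (?a * ?B (k - p))) = (\<Sum>j=1..Suc q. (- 1) ^ (j + p) * (?a * ?B j))"
    using sum.shift_bounds_cl_nat_ivl[of "\<lambda>k. (- 1) ^ k * (?a * ?B (k - p))" 1 p "Suc q"] by (simp add: add.commute)
  also have "\<dots> = (- 1) ^ p * (?a * (\<Sum>j=1..Suc q. (- 1) ^ j * ?B j))"
    by (simp add: sum_distrib_left power_add mult_ac del: sum.cl_ivl_Suc)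
  also have "(\<Sum>j=1..Suc q. (- 1) ^ j * ?B j) = coboundary_val b q (back_face p (Suc q) s) - ?b"
    unfolding coboundary_val_def atMost_atLeast0 B[symmetric]
    by (subst sum.atLeast_Suc_atMost[of 0 "Suc q"]) simp_all
  finally show ?thesis
    by (simp add: algebra_simps)
qed

lemma singular_simplex_front_face:
  assumes "singular_simplex n X s" "p \<le> n"
  shows "singular_simplex p X (front_face p s)"
proof -
  have "continuous_map (subtopology (powertop_real UNIV) (standard_simplex p)) X s"
    using assms standard_simplex_mono[of p n] unfolding singular_simplex_def
    by (blast intro: continuous_map_from_subtopology_mono)
  then show ?thesis
    unfolding singular_simplex_def front_face_def
    by (auto elim!: continuous_map_eq)
qed

lemma singular_simplex_back_face:
  assumes "singular_simplex (p + q) X s"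
  shows "singular_simplex q X (back_face p q s)"
proof -
  let ?f = "\<lambda>x i. if i < p then 0 else x (i - p) :: real"
  have "continuous_map (subtopology (powertop_real UNIV) (standard_simplex q))
      (subtopology (powertop_real UNIV) (standard_simplex (p + q))) ?f"
    unfolding continuous_map_in_subtopology continuous_map_componentwise
    by (auto simp: back_shift_in_simplex intro!: continuous_map_from_subtopology continuous_map_product_projection)
  then have "continuous_map (subtopology (powertop_real UNIV) (standard_simplex q)) X (s \<circ> ?f)"
    using assms unfolding singular_simplex_def by (blast intro: continuous_map_compose)
  then show ?thesis
    unfolding singular_simplex_def back_face_def
    by (auto elim!: continuous_map_eq)
qed

section \<open>Closed cochains and cohomology in all degrees at once\<close>

definition closed_cochain :: "'a topology \<Rightarrow> 'a cochain \<Rightarrow> bool" where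
  "closed_cochain X a \<longleftrightarrow> (\<forall>p s. singular_simplex (Suc p) X s \<longrightarrow> coboundary_val a p s = 0)"

text \<open>One primitive for all degrees makes this a relation on the whole ring of inhomogeneous
  cochains. In degree 0 there are no coboundaries.\<close>

definition coh :: "'a topology \<Rightarrow> 'a cochain \<Rightarrow> 'a cochain \<Rightarrow> bool" where
  "coh X a b \<longleftrightarrow> (\<exists>e. \<forall>p s. singular_simplex p X s \<longrightarrow> cochain_val a p s - cochain_val b p s =
     (case p of 0 \<Rightarrow> 0 | Suc q \<Rightarrow> coboundary_val e q s))"

text \<open>For \<open>p = 0\<close> the truncated \<open>p - 1\<close> is 0, but
  \<open>chain_boundary 0\<close> vanishes, so equality on 0-simplices results.\<close>

lemma cohomologous_iff:
  "cohomologous p X a b \<longleftrightarrow> (\<exists>e. \<forall>s. singular_simplex p X s \<longrightarrow> cochain_val a p s - cochain_val b p s =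
     (case p of 0 \<Rightarrow> 0 | Suc q \<Rightarrow> coboundary_val e q s))"
  unfolding cohomologous_def
  by (cases p) (simp_all add: pairing_boundary_frag_of, simp_all add: chain_boundary_def)

lemma coh_imp_cohomologous: "coh X a b \<Longrightarrow> cohomologous p X a b"
  unfolding coh_def cohomologous_iff by blast

lemma cochain_val_Abs:
  assumes "\<And>n s. f n (restrict s (standard_simplex n)) = f n s"
  shows "cochain_val (Abs_cochain f) = f"
  using assms by (simp add: Abs_cochain_inverse)

lemma cochain_val_restrict [simp]: "cochain_val a n (restrict s (standard_simplex n)) = cochain_val a n s"
  using cochain_val[of a] by simp

lemma coboundary_val_cong:
  "(\<And>s. cochain_val e p s = cochain_val e' p s) \<Longrightarrow> coboundary_val e p s = coboundary_val e' p s"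
  by (simp add: coboundary_val_def)

text \<open>Of a primitive in degree p only the part of degree p - 1 matters, so primitives chosen
  degree by degree can be glued; the part in degree n is taken from the one for degree n +
  1.\<close>

lemma coh_iff_cohomologous: "coh X a b \<longleftrightarrow> (\<forall>p. cohomologous p X a b)"
proof
  assume "\<forall>p. cohomologous p X a b"
  then obtain e where e: "\<And>p s. singular_simplex p X s \<Longrightarrow> cochain_val a p s - cochain_val b p s =
     (case p of 0 \<Rightarrow> 0 | Suc q \<Rightarrow> coboundary_val (e p) q s)"
    unfolding cohomologous_iff by metis
  let ?e = "Abs_cochain (\<lambda>n. cochain_val (e (Suc n)) n)"
  have e': "cochain_val ?e = (\<lambda>n. cochain_val (e (Suc n)) n)"
    by (rule cochain_val_Abs) simp
  have "coboundary_val (e (Suc q)) q s = coboundary_val ?e q s" for q s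
    by (rule coboundary_val_cong) (simp add: e')
  then show "coh X a b"
    unfolding coh_def using e by (intro exI[of _ ?e]) (auto split: nat.splits)
qed (simp add: coh_imp_cohomologous)

lemma coboundary_val_0 [simp]: "coboundary_val 0 p s = 0"
  by (simp add: coboundary_val_def zero_cochain.rep_eq)

lemma coboundary_val_add: "coboundary_val (a + b) p s = coboundary_val a p s + coboundary_val b p s"
  by (simp add: coboundary_val_def plus_cochain.rep_eq distrib_left sum.distrib)

lemma coboundary_val_uminus: "coboundary_val (- a) p s = - coboundary_val a p s"
  using coboundary_val_add[of a "- a" p s] by simp

lemma coh_refl [simp]: "coh X a a"
  unfolding coh_def by (intro exI[of _ 0]) (simp split: nat.splits)

lemma coh_sym: "coh X a b \<Longrightarrow> coh X b a"
proof -
  assume "coh X a b"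
  then obtain e where e: "\<And>p s. singular_simplex p X s \<Longrightarrow> cochain_val a p s - cochain_val b p s =
     (case p of 0 \<Rightarrow> 0 | Suc q \<Rightarrow> coboundary_val e q s)"
    unfolding coh_def by blast
  have "cochain_val b p s - cochain_val a p s = (case p of 0 \<Rightarrow> 0 | Suc q \<Rightarrow> coboundary_val (- e) q s)"
    if "singular_simplex p X s" for p s
    using e[OF that] by (auto simp: coboundary_val_uminus split: nat.splits)
  then show ?thesis unfolding coh_def by blast
qed

lemma coh_add: "coh X a b \<Longrightarrow> coh X c d \<Longrightarrow> coh X (a + c) (b + d)"
proof -
  assume "coh X a b" "coh X c d"
  then obtain e f where e: "\<And>p s. singular_simplex p X s \<Longrightarrow> cochain_val a p s - cochain_val b p s =
     (case p of 0 \<Rightarrow> 0 | Suc q \<Rightarrow> coboundary_val e q s)"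
    and f: "\<And>p s. singular_simplex p X s \<Longrightarrow> cochain_val c p s - cochain_val d p s =
     (case p of 0 \<Rightarrow> 0 | Suc q \<Rightarrow> coboundary_val f q s)"
    unfolding coh_def by blast
  have "cochain_val (a + c) p s - cochain_val (b + d) p s = (case p of 0 \<Rightarrow> 0 | Suc q \<Rightarrow> coboundary_val (e + f) q s)"
    if "singular_simplex p X s" for p s
    using e[OF that] f[OF that] by (auto simp: coboundary_val_add plus_cochain.rep_eq split: nat.splits)
  then show ?thesis unfolding coh_def by blast
qed

lemma coh_uminus: "coh X a b \<Longrightarrow> coh X (- a) (- b)"
  using coh_add[OF coh_sym, of X a b "- a - b" "- a - b"] by (simp add: algebra_simps)

lemma coh_diff: "coh X a b \<Longrightarrow> coh X c d \<Longrightarrow> coh X (a - c) (b - d)"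
  using coh_add[of X a b "- c" "- d"] coh_uminus[of X c d] by simp

lemma coh_trans [trans]: "coh X a b \<Longrightarrow> coh X b c \<Longrightarrow> coh X a c"
  using coh_add[of X a b b c] coh_diff[of X "a + b" "b + c" b b] by simp

lemma coh_sum: "(\<And>i. i \<in> I \<Longrightarrow> coh X (f i) (g i)) \<Longrightarrow> coh X (sum f I) (sum g I)"
  by (induction I rule: infinite_finite_induct) (auto intro: coh_add)

lemma cochain_val_mult: "cochain_val (a * b) n s =
    (\<Sum>p\<le>n. cochain_val a p (front_face p s) * cochain_val b (n - p) (back_face p (n - p) s))"
  by (simp add: times_cochain.rep_eq atLeast0AtMost)

lemma coboundary_val_mult:
  "coboundary_val (a * b) n s =
   (\<Sum>p\<le>n. coboundary_val a p (front_face (Suc p) s) * cochain_val b (n - p) (back_face (Suc p) (n - p) s) +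
     (- 1) ^ p * (cochain_val a p (front_face p s) * coboundary_val b (n - p) (back_face p (Suc (n - p)) s)))"
proof -
  have "coboundary_val (a * b) n s = (\<Sum>p\<le>n. \<Sum>k\<le>Suc n. (- 1) ^ k *
      (cochain_val a p (front_face p (singular_face (Suc n) k s)) *
       cochain_val b (n - p) (back_face p (n - p) (singular_face (Suc n) k s))))"
    unfolding coboundary_val_def cochain_val_mult sum_distrib_left by (rule sum.swap)
  also have "\<dots> = (\<Sum>p\<le>n. coboundary_val a p (front_face (Suc p) s) * cochain_val b (n - p) (back_face (Suc p) (n - p) s) +
     (- 1) ^ p * (cochain_val a p (front_face p s) * coboundary_val b (n - p) (back_face p (Suc (n - p)) s)))"
  proof (intro sum.cong refl)
    fix p assume "p \<in> {..n}"
    then show "(\<Sum>k\<le>Suc n. (- 1) ^ k *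
      (cochain_val a p (front_face p (singular_face (Suc n) k s)) *
       cochain_val b (n - p) (back_face p (n - p) (singular_face (Suc n) k s)))) =
      coboundary_val a p (front_face (Suc p) s) * cochain_val b (n - p) (back_face (Suc p) (n - p) s) +
     (- 1) ^ p * (cochain_val a p (front_face p s) * coboundary_val b (n - p) (back_face p (Suc (n - p)) s))"
      using leibniz[where p = p and q = "n - p" and a = a and b = b and s = s] by simp
  qed
  finally show ?thesis .
qed

lemma closed_cochain_mult:
  assumes "closed_cochain X a" "closed_cochain X b"
  shows "closed_cochain X (a * b)"
  unfolding closed_cochain_def
proof (intro allI impI)
  fix n s assume s: "singular_simplex (Suc n) X s"
  have "coboundary_val a p (front_face (Suc p) s) = 0" "coboundary_val b (n - p) (back_face p (Suc (n - p)) s) = 0"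
    if "p \<le> n" for p
    using assms singular_simplex_front_face[OF s, of "Suc p"] singular_simplex_back_face[of p "Suc (n - p)" X s] s that
    unfolding closed_cochain_def by auto
  then show "coboundary_val (a * b) n s = 0"
    unfolding coboundary_val_mult by (intro sum.neutral) auto
qed

lemma closed_cochain_0 [simp]: "closed_cochain X 0"
  by (simp add: closed_cochain_def)

lemma closed_cochain_add: "closed_cochain X a \<Longrightarrow> closed_cochain X b \<Longrightarrow> closed_cochain X (a + b)"
  by (simp add: closed_cochain_def coboundary_val_add)

lemma closed_cochain_uminus: "closed_cochain X a \<Longrightarrow> closed_cochain X (- a)"
  by (simp add: closed_cochain_def coboundary_val_uminus)

lemma closed_cochain_1 [simp]: "closed_cochain X 1"
proof -
  have "coboundary_val 1 p s = 0" for p and s :: "(nat \<Rightarrow> real) \<Rightarrow> 'a"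
    by (cases "p = 0") (auto simp: coboundary_val_def one_cochain.rep_eq)
  then show ?thesis by (simp add: closed_cochain_def)
qed

lemma closed_cochain_of_int [simp]: "closed_cochain X (of_int k)"
proof -
  have "closed_cochain X (of_nat n)" for n
    by (induction n) (auto intro: closed_cochain_add)
  then show ?thesis
    by (cases k rule: int_cases2) (auto intro: closed_cochain_uminus)
qed

lemma closed_cochain_power: "closed_cochain X a \<Longrightarrow> closed_cochain X (a ^ n)"
  by (induction n) (auto intro: closed_cochain_mult)

text \<open>If \<open>b - b' = \<delta>e\<close> and \<open>a\<close> is closed, then \<open>ab - ab' = \<delta>(a'e)\<close>, where \<open>a'\<close> is \<open>a\<close> with alternating
  signs.\<close>

lemma coh_mult_left:
  assumes a: "closed_cochain X a" and b: "coh X b b'"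
  shows "coh X (a * b) (a * b')"
proof -
  obtain e where e: "\<And>p s. singular_simplex p X s \<Longrightarrow> cochain_val b p s - cochain_val b' p s =
     (case p of 0 \<Rightarrow> 0 | Suc q \<Rightarrow> coboundary_val e q s)"
    using b unfolding coh_def by blast
  let ?a = "Abs_cochain (\<lambda>p s. (- 1) ^ p * cochain_val a p s)"
  have a': "cochain_val ?a = (\<lambda>p s. (- 1) ^ p * cochain_val a p s)"
    by (rule cochain_val_Abs) simp
  have da: "coboundary_val ?a p s = (- 1) ^ p * coboundary_val a p s" for p s
    by (simp add: coboundary_val_def a' sum_distrib_left mult.left_commute del: sum.atMost_Suc)
  have "cochain_val (a * b) n s - cochain_val (a * b') n s = (case n of 0 \<Rightarrow> 0 | Suc q \<Rightarrow> coboundary_val (?a * e) q s)"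
    if s: "singular_simplex n X s" for n s
  proof -
    have "cochain_val (a * b) n s - cochain_val (a * b') n s = (\<Sum>p\<le>n. cochain_val a p (front_face p s) *
        (cochain_val b (n - p) (back_face p (n - p) s) - cochain_val b' (n - p) (back_face p (n - p) s)))"
      by (simp add: cochain_val_mult sum_subtractf right_diff_distrib)
    also have "\<dots> = (\<Sum>p\<le>n. cochain_val a p (front_face p s) *
        (case n - p of 0 \<Rightarrow> 0 | Suc q \<Rightarrow> coboundary_val e q (back_face p (n - p) s)))"
      using singular_simplex_back_face[of _ "n - _" X s] s
      by (intro sum.cong refl arg_cong2[of _ _ _ _ "(*)"] e) auto
    also have "\<dots> = (case n of 0 \<Rightarrow> 0 | Suc q \<Rightarrow> coboundary_val (?a * e) q s)"
    proof (cases n)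
      case (Suc N)
      have "coboundary_val a p (front_face (Suc p) s) = 0" if "p \<le> N" for p
        using a singular_simplex_front_face[OF s, of "Suc p"] that Suc unfolding closed_cochain_def by auto
      then show ?thesis
        by (simp add: Suc coboundary_val_mult da a' Suc_diff_le mult.assoc[symmetric] flip: power_add power_mult_distrib)
    qed simp
    finally show ?thesis .
  qed
  then show ?thesis unfolding coh_def by blast
qed

text \<open>The primitive is \<open>e * b\<close>; with \<open>e\<close> as the left factor no sign
  appears.\<close>

lemma coh_mult_right:
  assumes b: "closed_cochain X b" and a: "coh X a a'"
  shows "coh X (a * b) (a' * b)"
proof -
  obtain e where e: "\<And>p s. singular_simplex p X s \<Longrightarrow> cochain_val a p s - cochain_val a' p s =
     (case p of 0 \<Rightarrow> 0 | Suc q \<Rightarrow> coboundary_val e q s)"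
    using a unfolding coh_def by blast
  have "cochain_val (a * b) n s - cochain_val (a' * b) n s = (case n of 0 \<Rightarrow> 0 | Suc q \<Rightarrow> coboundary_val (e * b) q s)"
    if s: "singular_simplex n X s" for n s
  proof -
    have "cochain_val (a * b) n s - cochain_val (a' * b) n s = (\<Sum>p\<le>n.
        (cochain_val a p (front_face p s) - cochain_val a' p (front_face p s)) * cochain_val b (n - p) (back_face p (n - p) s))"
      by (simp add: cochain_val_mult sum_subtractf left_diff_distrib)
    also have "\<dots> = (\<Sum>p\<le>n. (case p of 0 \<Rightarrow> 0 | Suc q \<Rightarrow> coboundary_val e q (front_face p s)) *
        cochain_val b (n - p) (back_face p (n - p) s))"
      using singular_simplex_front_face[OF s]
      by (intro sum.cong refl arg_cong2[of _ _ _ _ "(*)"] e) auto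
    also have "\<dots> = (case n of 0 \<Rightarrow> 0 | Suc q \<Rightarrow> coboundary_val (e * b) q s)"
    proof (cases n)
      case (Suc N)
      have "coboundary_val b (N - p) (back_face p (Suc (N - p)) s) = 0" if "p \<le> N" for p
        using b singular_simplex_back_face[of p "Suc (N - p)" X s] s that Suc unfolding closed_cochain_def by auto
      \<comment> \<open>The term p = 0 is zero; the index shift then matches the front faces of
        dimension p + 1 in the Leibniz rule.\<close>
      then show ?thesis
        unfolding Suc by (subst sum.atMost_Suc_shift) (simp add: coboundary_val_mult)
    qed simp
    finally show ?thesis .
  qed
  then show ?thesis unfolding coh_def by blast
qed

text \<open>The passage goes through \<open>a * b'\<close>, hence the closedness of just these two
  factors.\<close>

lemma coh_mult:
  "closed_cochain X a \<Longrightarrow> closed_cochain X b' \<Longrightarrow> coh X a a' \<Longrightarrow> coh X b b' \<Longrightarrow> coh X (a * b) (a' * b')"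
  using coh_mult_left[of X a b b'] coh_mult_right[of X b' a a'] coh_trans by blast

lemma coh_power: "closed_cochain X a \<Longrightarrow> closed_cochain X b \<Longrightarrow> coh X a b \<Longrightarrow> coh X (a ^ n) (b ^ n)"
  by (induction n) (auto intro!: coh_mult closed_cochain_power)

lemma coh_zeval:
  assumes "\<And>m i. m \<in> Poly_Mapping.keys P \<Longrightarrow> i \<in> Poly_Mapping.keys m \<Longrightarrow>
     closed_cochain X (a i) \<and> closed_cochain X (b i) \<and> coh X (a i) (b i)"
  shows "coh X (zeval a P) (zeval b P)"
  unfolding zeval_def
proof (rule coh_sum, rule coh_mult_left)
  fix m assume m: "m \<in> Poly_Mapping.keys P"
  \<comment> \<open>Closedness of the partial products is carried along because
    \<open>coh_mult\<close> asks for it.\<close>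
  have "coh X (\<Prod>i\<leftarrow>xs. a i ^ Poly_Mapping.lookup m i) (\<Prod>i\<leftarrow>xs. b i ^ Poly_Mapping.lookup m i) \<and>
      closed_cochain X (\<Prod>i\<leftarrow>xs. a i ^ Poly_Mapping.lookup m i) \<and> closed_cochain X (\<Prod>i\<leftarrow>xs. b i ^ Poly_Mapping.lookup m i)"
    if "set xs \<subseteq> Poly_Mapping.keys m" for xs
    using that assms[OF m] by (induction xs) (auto intro!: coh_mult coh_power closed_cochain_mult closed_cochain_power)
  then show "coh X (\<Prod>i\<leftarrow>sorted_list_of_set (Poly_Mapping.keys m). a i ^ Poly_Mapping.lookup m i)
      (\<Prod>i\<leftarrow>sorted_list_of_set (Poly_Mapping.keys m). b i ^ Poly_Mapping.lookup m i)"
    by simp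
qed simp

lemma pairing_boundary_closed:
  assumes "closed_cochain X a" "singular_chain (Suc p) X z"
  shows "pairing p a (chain_boundary (Suc p) z) = 0"
  unfolding pairing_boundary using assms
  by (intro sum.neutral) (auto simp: closed_cochain_def singular_chain_def)

lemma pairing_homologous:
  assumes "closed_cochain X a" "homologous_rel p X {} z w"
  shows "pairing p a z = pairing p a w"
proof -
  obtain d where d: "singular_chain (Suc p) X d" "chain_boundary (Suc p) d = z - w"
    using assms(2) unfolding homologous_rel_def singular_boundary by blast
  show ?thesis
    using pairing_boundary_closed[OF assms(1) d(1)] unfolding d(2) by (simp add: pairing_diff)
qed

lemma pairing_coh:
  assumes ab: "coh X a b" and z: "singular_relcycle p X {} z"
  shows "pairing p a z = pairing p b z"
proof -
  obtain e where e: "\<And>p s. singular_simplex p X s \<Longrightarrow> cochain_val a p s - cochain_val b p s =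
     (case p of 0 \<Rightarrow> 0 | Suc q \<Rightarrow> coboundary_val e q s)"
    using ab unfolding coh_def by blast
  have z: "\<And>s. s \<in> Poly_Mapping.keys z \<Longrightarrow> singular_simplex p X s" "chain_boundary p z = 0"
    using z by (auto simp: singular_cycle singular_chain_def)
  have "pairing p a z - pairing p b z =
      (\<Sum>s\<in>Poly_Mapping.keys z. Poly_Mapping.lookup z s * (cochain_val a p s - cochain_val b p s))"
    by (simp add: pairing_def sum_subtractf right_diff_distrib)
  also have "\<dots> = (\<Sum>s\<in>Poly_Mapping.keys z. Poly_Mapping.lookup z s * (case p of 0 \<Rightarrow> 0 | Suc q \<Rightarrow> coboundary_val e q s))"
    by (intro sum.cong refl arg_cong2[of _ _ _ _ "(*)"] e z)
  also have "\<dots> = 0"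
  proof (cases p)
    case (Suc q)
    then show ?thesis
      using pairing_boundary[of q e z] z(2) by simp
  qed simp
  finally show ?thesis by simp
qed

section \<open>Homogeneous cochains and the cap product\<close>

definition concentrated :: "nat \<Rightarrow> 'a cochain \<Rightarrow> bool" where
  "concentrated p a \<longleftrightarrow> (\<forall>q s. q \<noteq> p \<longrightarrow> cochain_val a q s = 0)"

lemma concentrated_0 [simp]: "concentrated p 0"
  by (simp add: concentrated_def zero_cochain.rep_eq)

lemma concentrated_1 [simp]: "concentrated 0 1"
  by (simp add: concentrated_def one_cochain.rep_eq)

lemma concentrated_mult: "concentrated p a \<Longrightarrow> concentrated q b \<Longrightarrow> concentrated (p + q) (a * b)"
  unfolding concentrated_def cochain_val_mult
proof (intro allI impI sum.neutral ballI)
  fix n s k assume *: "\<forall>q s. q \<noteq> p \<longrightarrow> cochain_val a q s = 0" "\<forall>qa s. qa \<noteq> q \<longrightarrow> cochain_val b qa s = 0"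
    and "n \<noteq> p + q" "k \<in> {..n}"
  then have "k \<noteq> p \<or> n - k \<noteq> q" by auto
  with * show "cochain_val a k (front_face k s) * cochain_val b (n - k) (back_face k (n - k) s) = 0"
    by (elim disjE) simp_all
qed

lemma concentrated_power: "concentrated p a \<Longrightarrow> concentrated (p * n) (a ^ n)"
  by (induction n) (auto intro!: concentrated_mult)

lemma concentrated_add: "concentrated p a \<Longrightarrow> concentrated p b \<Longrightarrow> concentrated p (a + b)"
  by (simp add: concentrated_def plus_cochain.rep_eq)

lemma concentrated_sum: "(\<And>i. i \<in> I \<Longrightarrow> concentrated p (f i)) \<Longrightarrow> concentrated p (sum f I)"
  by (induction I rule: infinite_finite_induct) (auto intro: concentrated_add)

lemma cocycle_iff: "cocycle p X a \<longleftrightarrow> concentrated p a \<and> closed_cochain X a"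
proof -
  have "coboundary_val a q s = 0" if "concentrated p a" "q \<noteq> p" for q s
    using that by (simp add: concentrated_def coboundary_val_def)
  then show ?thesis
    unfolding cocycle_def pairing_boundary_frag_of closed_cochain_def concentrated_def by metis
qed

text \<open>In the other degrees both cochains vanish and 0 is a primitive. Through this the Chern
  class axioms, each about one degree, become statements about \<open>coh\<close>.\<close>

lemma cohomologous_imp_coh:
  assumes "concentrated p a" "concentrated p b" "cohomologous p X a b"
  shows "coh X a b"
  unfolding coh_iff_cohomologous
proof
  fix q
  show "cohomologous q X a b"
  proof (cases "q = p")
    case False
    then have "cochain_val a q s - cochain_val b q s = pairing (q - 1) 0 (chain_boundary q (frag_of s))" for s
      using assms by (simp add: concentrated_def)
    then show ?thesis
      unfolding cohomologous_def by blast
  qed (use assms in simp)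
qed

lemma pairing_concentrated: "concentrated p a \<Longrightarrow> q \<noteq> p \<Longrightarrow> pairing q a z = 0"
  by (simp add: concentrated_def pairing_def)

text \<open>With \<open>a\<close> in degree \<open>p\<close>, one term of the cup product survives;
  \<open>a\<close> stands on the left since \<open>cap\<close> evaluates it on the front
  face.\<close>

lemma pairing_cap:
  assumes "concentrated p a"
  shows "pairing q b (cap p q a z) = pairing (p + q) (a * b) z"
proof -
  have "cochain_val (a * b) (p + q) s = cochain_val a p (front_face p s) * cochain_val b q (back_face p q s)" for s
  proof -
    have "cochain_val (a * b) (p + q) s = (\<Sum>k\<le>p + q. if k = p then
        cochain_val a p (front_face p s) * cochain_val b q (back_face p q s) else 0)"
      unfolding cochain_val_mult using assms by (intro sum.cong) (auto simp: concentrated_def)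
    then show ?thesis by simp
  qed
  then show ?thesis
    unfolding cap_def pairing_frag_extend by (simp add: pairing_cmul pairing_def[of "p + q"])
qed

section \<open>The topology of complex projective space\<close>

lemma topspace_cp_top [simp]: "topspace (cp_top n) = cspan ` punctured_space n"
proof -
  have "{z \<in> punctured_space n. cspan z \<in> cspan ` punctured_space n} = punctured_space n"
    by auto
  then have "openin (cp_top n) (cspan ` punctured_space n)"
    unfolding openin_cp_top by simp
  then show ?thesis
    by (metis openin_cp_top openin_subset openin_topspace subset_antisym)
qed

lemma cspan_scale: "c \<noteq> 0 \<Longrightarrow> cspan (\<lambda>i. c * z i) = cspan z"
  unfolding cspan_def
proof safe
  fix d assume c: "c \<noteq> 0"
  show "(\<lambda>i. d * (c * z i)) \<in> range (\<lambda>c i. c * z i)"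
    by (rule range_eqI[of _ _ "d * c"]) (simp add: mult.assoc)
  show "(\<lambda>i. d * z i) \<in> range (\<lambda>d i. d * (c * z i))"
    using c by (intro range_eqI[of _ _ "d / c"]) simp
qed

lemma homog_cspan:
  assumes "z \<noteq> (\<lambda>_. 0)"
  shows "\<exists>c. c \<noteq> 0 \<and> homog (cspan z) = (\<lambda>i. c * z i)"
proof -
  have "z \<in> cspan z \<and> z \<noteq> (\<lambda>_. 0)"
    using assms by (auto simp: cspan_def intro: range_eqI[of _ _ 1])
  then have *: "homog (cspan z) \<in> cspan z \<and> homog (cspan z) \<noteq> (\<lambda>_. 0)"
    using someI[of "\<lambda>w. w \<in> cspan z \<and> w \<noteq> (\<lambda>_. 0)" z] by (simp add: homog_def)
  then obtain c where c: "homog (cspan z) = (\<lambda>i. c * z i)"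
    by (auto simp: cspan_def)
  with * have "c \<noteq> 0" by auto
  with c show ?thesis by blast
qed

text \<open>Functions invariant under scaling do not see which representative \<open>homog\<close>
  chooses.\<close>

lemma homog_invariant:
  assumes "z \<noteq> (\<lambda>_. 0)" "\<And>c. c \<noteq> 0 \<Longrightarrow> F (\<lambda>i. c * z i) = F z"
  shows "F (homog (cspan z)) = F z"
  using homog_cspan[OF assms(1)] assms(2) by force

lemma punctured_nonzero: "z \<in> punctured_space n \<Longrightarrow> z \<noteq> (\<lambda>_. 0)"
  by (simp add: punctured_space_def)

lemma punctured_coordinate:
  assumes "z \<in> punctured_space n"
  shows "\<exists>j\<le>n. z j \<noteq> 0"
proof (rule ccontr)
  assume "\<not> (\<exists>j\<le>n. z j \<noteq> 0)"
  then have "z i = 0" for i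
    using assms by (cases "i \<le> n") (auto simp: punctured_space_def)
  with assms show False by (auto simp: punctured_space_def)
qed

lemma homog_cspan_nonzero_iff: "z \<in> punctured_space n \<Longrightarrow> homog (cspan z) j \<noteq> 0 \<longleftrightarrow> z j \<noteq> 0"
  using homog_cspan[OF punctured_nonzero, of z n] by auto

lemma homog_in_punctured:
  assumes "L \<in> topspace (cp_top n)"
  shows "homog L \<in> punctured_space n" "cspan (homog L) = L"
proof -
  obtain z where z: "z \<in> punctured_space n" "L = cspan z"
    using assms by auto
  then obtain c where c: "c \<noteq> 0" "homog L = (\<lambda>i. c * z i)"
    using homog_cspan[OF punctured_nonzero] by blast
  show "cspan (homog L) = L"
    using cspan_scale[OF c(1), of z] c(2) z(2) by simp
  show "homog L \<in> punctured_space n"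
    unfolding c(2) using c(1) z(1) by (auto simp: punctured_space_def fun_eq_iff)
qed

text \<open>The universal property of the quotient topology: \<open>homog\<close> is an arbitrary
  choice, but a scale-invariant function composed with it pulls back to \<open>F\<close> itself on
  the punctured space.\<close>

lemma continuous_map_cp_top:
  assumes U: "openin (cp_top n) U"
    and inv: "\<And>c z. z \<in> punctured_space n \<Longrightarrow> cspan z \<in> U \<Longrightarrow> c \<noteq> 0 \<Longrightarrow> F (\<lambda>i. c * z i) = F z"
    and cont: "continuous_on {z \<in> punctured_space n. cspan z \<in> U} F"
  shows "continuous_map (subtopology (cp_top n) U) euclidean (\<lambda>L. F (homog L) :: 'b::topological_space)"
proof -
  let ?S = "{z \<in> punctured_space n. cspan z \<in> U}"
  have S: "openin (top_of_set (punctured_space n)) ?S" and US: "U \<subseteq> topspace (cp_top n)"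
    using U unfolding openin_cp_top topspace_cp_top by auto
  have "openin (cp_top n) {L \<in> U. F (homog L) \<in> V}" if "open V" for V
  proof -
    have "{z \<in> punctured_space n. cspan z \<in> {L \<in> U. F (homog L) \<in> V}} = ?S \<inter> F -` V"
      using homog_invariant[OF punctured_nonzero, of _ n F] inv by auto
    moreover have "openin (top_of_set ?S) (?S \<inter> F -` V)"
      using cont that by (rule continuous_openin_preimage_gen)
    ultimately show ?thesis
      using openin_trans[OF _ S] US unfolding openin_cp_top by auto
  qed
  then show ?thesis
    using US U unfolding continuous_map_def
    by (auto simp: openin_subtopology_alt topspace_subtopology inf_absorb2 openin_open_subtopology intro!: openin_subtopology_Int2)
qed

lemma openin_cp_dom: "openin (cp_top n) (cp_dom n j)"
  unfolding openin_cp_top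
proof
  have "{z \<in> punctured_space n. cspan z \<in> cp_dom n j} = punctured_space n \<inter> (\<lambda>z. z j) -` (- {0})"
    using homog_cspan_nonzero_iff by (auto simp: cp_dom_def)
  moreover have "openin (top_of_set (punctured_space n)) (punctured_space n \<inter> (\<lambda>z. z j) -` (- {0}))"
    by (rule continuous_openin_preimage_gen[OF continuous_on_subset[OF continuous_on_product_coordinates]]) auto
  ultimately show "openin (top_of_set (punctured_space n)) {z \<in> punctured_space n. cspan z \<in> cp_dom n j}"
    by simp
qed (auto simp: cp_dom_def)

lemma cp_dom_cover: "(\<Union>j\<in>{..n}. cp_dom n j) = topspace (cp_top n)"
proof
  show "topspace (cp_top n) \<subseteq> (\<Union>j\<in>{..n}. cp_dom n j)"
  proof
    fix L assume L: "L \<in> topspace (cp_top n)"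
    then have "homog L \<in> punctured_space n" by (rule homog_in_punctured)
    then obtain j where "j \<le> n" "homog L j \<noteq> 0"
      using punctured_coordinate by blast
    with L show "L \<in> (\<Union>j\<in>{..n}. cp_dom n j)"
      by (auto simp: cp_dom_def)
  qed
qed (auto simp: cp_dom_def)

lemma cp_dom_subset: "cp_dom n j \<subseteq> topspace (cp_top n)"
  by (auto simp: cp_dom_def)

lemma continuous_map_cspan: "continuous_map (top_of_set (punctured_space n)) (cp_top n) cspan"
  unfolding continuous_map by (auto simp: openin_cp_top)

text \<open>Dividing a representative by a coordinate of largest modulus puts it into one of the
  compact polydiscs \<open>K j\<close>, whose j-th coordinate is 1; their images cover the
  space.\<close>

lemma compact_space_cp_top: "compact_space (cp_top n)"
proof -
  define K where "K j = (PiE UNIV (\<lambda>i. if i = j then {1} else if i \<le> n then cball 0 1 else {0}) :: (nat \<Rightarrow> complex) set)" for j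
  have memK: "z \<in> K j \<longleftrightarrow> (\<forall>i. z i \<in> (if i = j then {1} else if i \<le> n then cball 0 1 else {0}))" for z j
    by (auto simp: K_def PiE_iff)
  have KP: "K j \<subseteq> punctured_space n" if "j \<le> n" for j
  proof
    fix z assume "z \<in> K j"
    then have z: "z i \<in> (if i = j then {1} else if i \<le> n then cball 0 1 else {0})" for i
      unfolding memK by blast
    have "z j = 1"
      using z[of j] by simp
    moreover have "z i = 0" if "i > n" for i
      using z[of i] that \<open>j \<le> n\<close> by simp
    ultimately show "z \<in> punctured_space n"
      by (auto simp: punctured_space_def)
  qed
  have "compactin (top_of_set (punctured_space n)) (K j)" if "j \<le> n" for j
  proof -
    have "compactin euclidean (K j)"
      unfolding K_def euclidean_product_topology[symmetric] compactin_PiE by auto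
    then show ?thesis
      using KP[OF that] by (simp add: compactin_subtopology)
  qed
  then have "compactin (cp_top n) (\<Union>j\<in>{..n}. cspan ` K j)"
    by (intro compactin_Union) (auto intro: image_compactin[OF _ continuous_map_cspan])
  moreover have "(\<Union>j\<in>{..n}. cspan ` K j) = topspace (cp_top n)"
  proof
    show "topspace (cp_top n) \<subseteq> (\<Union>j\<in>{..n}. cspan ` K j)"
    proof
      fix L assume "L \<in> topspace (cp_top n)"
      then obtain z where z: "z \<in> punctured_space n" "L = cspan z" by auto
      have "Max ((\<lambda>i. cmod (z i)) ` {..n}) \<in> (\<lambda>i. cmod (z i)) ` {..n}"
        by (rule Max_in) auto
      then obtain j where j: "Max ((\<lambda>i. cmod (z i)) ` {..n}) = cmod (z j)" "j \<in> {..n}"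
        by (rule imageE)
      then have le: "cmod (z i) \<le> cmod (z j)" if "i \<le> n" for i
        using that j Max_ge[of "(\<lambda>i. cmod (z i)) ` {..n}" "cmod (z i)"] by simp
      have "z j \<noteq> 0"
        using punctured_coordinate[OF z(1)] le by force
      then have "(\<lambda>i. inverse (z j) * z i) \<in> K j"
        using z(1) le by (auto simp: memK punctured_space_def norm_divide divide_simps)
      moreover have "cspan (\<lambda>i. inverse (z j) * z i) = L"
        using cspan_scale[of "inverse (z j)" z] \<open>z j \<noteq> 0\<close> z(2) by simp
      ultimately show "L \<in> (\<Union>j\<in>{..n}. cspan ` K j)"
        using j(2) by blast
    qed
  qed (use KP in auto)
  ultimately show ?thesis
    by (simp add: compact_space_def)
qed

text \<open>The squared Hermitian norm, complex valued so that it can enter matrix entries.\<close>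

definition sqnorm :: "nat \<Rightarrow> (nat \<Rightarrow> complex) \<Rightarrow> complex" where
  "sqnorm n z = (\<Sum>k\<le>n. z k * cnj (z k))"

lemma sqnorm_nonzero:
  assumes "z \<in> punctured_space n"
  shows "sqnorm n z \<noteq> 0"
proof
  assume "sqnorm n z = 0"
  moreover have "sqnorm n z = of_real (\<Sum>k\<le>n. (cmod (z k))\<^sup>2)"
    by (simp add: sqnorm_def complex_norm_square del: of_real_power)
  ultimately have "(\<Sum>k\<le>n. (cmod (z k))\<^sup>2) = 0"
    by (metis of_real_eq_0_iff)
  then have "\<forall>k\<le>n. z k = 0"
    by (simp add: sum_nonneg_eq_0_iff)
  with punctured_coordinate[OF assms] show False by auto
qed

lemma sqnorm_scale: "sqnorm n (\<lambda>i. c * z i) = c * cnj c * sqnorm n z"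
  by (simp add: sqnorm_def sum_distrib_left mult_ac)

lemma continuous_on_sqnorm [continuous_intros]: "continuous_on S (sqnorm n)"
proof -
  have "continuous_on S (\<lambda>z. \<Sum>k\<le>n. z k * cnj (z k))"
    by (intro continuous_intros continuous_on_subset[OF continuous_on_product_coordinates]) auto
  then show ?thesis
    by (simp add: sqnorm_def[abs_def])
qed

lemma continuous_on_coordinate [continuous_intros]: "continuous_on S (\<lambda>z :: nat \<Rightarrow> complex. z i)"
  by (rule continuous_on_subset[OF continuous_on_product_coordinates]) auto

text \<open>The functions \<open>F i j\<close> are the entries of the orthogonal projection onto the
  line. They are continuous and separate lines, since a line is the image of its projection.\<close>

lemma Hausdorff_space_cp_top: "Hausdorff_space (cp_top n)"
  unfolding Hausdorff_space_def
proof (intro allI impI)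
  fix L M assume LM: "L \<in> topspace (cp_top n) \<and> M \<in> topspace (cp_top n) \<and> L \<noteq> M"
  define F where "F i j z = z i * cnj (z j) / sqnorm n z" for i j and z :: "nat \<Rightarrow> complex"
  let ?u = "homog L" and ?v = "homog M"
  have u: "?u \<in> punctured_space n" "cspan ?u = L" and v: "?v \<in> punctured_space n" "cspan ?v = M"
    using homog_in_punctured[of L n] homog_in_punctured[of M n] LM by blast+
  obtain i j where ij: "F i j ?u \<noteq> F i j ?v"
  proof (rule ccontr)
    assume "\<not> thesis"
    then have eq: "F i j ?u = F i j ?v" for i j using that by blast
    obtain j where j: "?v j \<noteq> 0"
      using punctured_nonzero[OF v(1)] by auto
    \<comment> \<open>The j-th columns of the two projections are multiples of \<open>?u\<close> and
      \<open>?v\<close>; equating them gives this factor.\<close>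
    let ?c = "(cnj (?u j) / sqnorm n ?u) / (cnj (?v j) / sqnorm n ?v)"
    have c: "?v i = ?c * ?u i" for i
      using eq[of i j] sqnorm_nonzero[OF u(1)] sqnorm_nonzero[OF v(1)] j by (simp add: F_def field_simps)
    then have "?c \<noteq> 0"
      using j by (metis mult_zero_left)
    moreover have "?v = (\<lambda>i. ?c * ?u i)"
      using c by (rule ext)
    ultimately have "cspan ?v = cspan ?u"
      using cspan_scale by metis
    with u v LM show False by simp
  qed
  have "continuous_map (subtopology (cp_top n) (topspace (cp_top n))) euclidean (\<lambda>L. F i j (homog L))"
  proof (rule continuous_map_cp_top)
    show "openin (cp_top n) (topspace (cp_top n))"
      by (rule openin_topspace)
    show "continuous_on {z \<in> punctured_space n. cspan z \<in> topspace (cp_top n)} (F i j)"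
      unfolding F_def by (intro continuous_intros) (auto simp: sqnorm_nonzero)
  qed (auto simp: F_def sqnorm_scale)
  then have cont: "continuous_map (cp_top n) euclidean (\<lambda>L. F i j (homog L))"
    by (simp only: subtopology_topspace)
  obtain U V where UV: "open U" "open V" "F i j ?u \<in> U" "F i j ?v \<in> V" "U \<inter> V = {}"
    using ij by (rule hausdorff[elim_format]) blast
  have "openin (cp_top n) {x \<in> topspace (cp_top n). F i j (homog x) \<in> W}" if "open W" for W
    using cont that by (simp add: continuous_map)
  then show "\<exists>U V. openin (cp_top n) U \<and> openin (cp_top n) V \<and> L \<in> U \<and> M \<in> V \<and> disjnt U V"
    using UV LM
    by (intro exI[of _ "{x \<in> topspace (cp_top n). F i j (homog x) \<in> U}"]
        exI[of _ "{x \<in> topspace (cp_top n). F i j (homog x) \<in> V}"]) (auto simp: disjnt_def)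
qed

section \<open>Vector bundles\<close>

lemma continuous_matrixI:
  assumes "\<And>x. x \<in> U \<Longrightarrow> g x \<in> carrier_mat r r"
    and "\<And>a b. a < r \<Longrightarrow> b < r \<Longrightarrow> continuous_map (subtopology X U) euclidean (\<lambda>x. g x $$ (a, b))"
  shows "continuous_matrix X U r g"
  using assms by (auto simp: continuous_matrix_def)

lemma continuous_map_subtopology_cong:
  assumes "continuous_map (subtopology X U) Y f" "\<And>x. x \<in> U \<Longrightarrow> f x = g x"
  shows "continuous_map (subtopology X U) Y g"
  using assms by (auto elim!: continuous_map_eq simp: topspace_subtopology)

lemma invertible_mat_if_right_inverse:
  fixes A :: "complex Matrix.mat"
  assumes "A \<in> carrier_mat n n" "B \<in> carrier_mat n n" "A * B = 1\<^sub>m n"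
  shows "invertible_mat A"
proof -
  have "B * A = 1\<^sub>m n"
    by (rule mat_mult_left_right_inverse[OF assms])
  with assms show ?thesis
    unfolding invertible_mat_def inverts_mat_def by (auto intro!: exI[of _ B])
qed

lemma vector_bundle_trivial: "vector_bundle X (trivial_bundle X r)"
  by (auto simp: vector_bundle_def trivial_bundle_def intro!: continuous_matrixI)

lemma vector_bundle_direct_sum:
  assumes E: "vector_bundle X E" and F: "vector_bundle X F"
  shows "vector_bundle X (direct_sum E F)"
proof -
  let ?S = "direct_sum E F"
  have idx: "idx ?S = prod_encode ` (idx E \<times> idx F)"
    and cov: "cov ?S (prod_encode (i, j)) = cov E i \<inter> cov F j"
    and trn: "trn ?S (prod_encode (i, j)) (prod_encode (k, l)) x =
      four_block_mat (trn E i k x) (0\<^sub>m (rk E) (rk F)) (0\<^sub>m (rk F) (rk E)) (trn F j l x)"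
    and rk: "rk ?S = rk E + rk F" for i j k l x
    by (simp_all add: direct_sum_def)
  have cE: "trn E i k x \<in> carrier_mat (rk E) (rk E)" if "i \<in> idx E" "k \<in> idx E" "x \<in> cov E i" "x \<in> cov E k" for i k x
    using E that by (auto simp: vector_bundle_def continuous_matrix_def)
  have cF: "trn F i k x \<in> carrier_mat (rk F) (rk F)" if "i \<in> idx F" "k \<in> idx F" "x \<in> cov F i" "x \<in> cov F k" for i k x
    using F that by (auto simp: vector_bundle_def continuous_matrix_def)
  have "continuous_matrix X (cov ?S (prod_encode (i, j)) \<inter> cov ?S (prod_encode (k, l))) (rk ?S)
     (trn ?S (prod_encode (i, j)) (prod_encode (k, l)))" (is "continuous_matrix X ?U _ _")
    if "i \<in> idx E" "j \<in> idx F" "k \<in> idx E" "l \<in> idx F" for i j k l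
  proof (rule continuous_matrixI)
    fix x assume "x \<in> ?U"
    then show "trn ?S (prod_encode (i, j)) (prod_encode (k, l)) x \<in> carrier_mat (rk ?S) (rk ?S)"
      using cE[of i k x] cF[of j l x] that by (simp add: cov trn rk)
  next
    fix a b assume ab: "a < rk ?S" "b < rk ?S"
    have sub: "?U \<subseteq> cov E i \<inter> cov E k" "?U \<subseteq> cov F j \<inter> cov F l"
      by (auto simp: cov)
    have contE: "continuous_map (subtopology X ?U) euclidean (\<lambda>x. trn E i k x $$ (a', b'))" if "a' < rk E" "b' < rk E" for a' b'
      using E that \<open>i \<in> idx E\<close> \<open>k \<in> idx E\<close> continuous_map_from_subtopology_mono[OF _ sub(1)]
      unfolding vector_bundle_def continuous_matrix_def by blast
    have contF: "continuous_map (subtopology X ?U) euclidean (\<lambda>x. trn F j l x $$ (a', b'))" if "a' < rk F" "b' < rk F" for a' b'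
      using F that \<open>j \<in> idx F\<close> \<open>l \<in> idx F\<close> continuous_map_from_subtopology_mono[OF _ sub(2)]
      unfolding vector_bundle_def continuous_matrix_def by blast
    have "continuous_map (subtopology X ?U) euclidean (\<lambda>x. if a < rk E then if b < rk E then trn E i k x $$ (a, b) else 0
        else if b < rk E then 0 else trn F j l x $$ (a - rk E, b - rk E))"
      using contE[of a b] contF[of "a - rk E" "b - rk E"] ab by (auto simp: rk)
    then show "continuous_map (subtopology X ?U) euclidean (\<lambda>x. trn ?S (prod_encode (i, j)) (prod_encode (k, l)) x $$ (a, b))"
    proof (rule continuous_map_subtopology_cong)
      fix x assume "x \<in> ?U"
      then show "(if a < rk E then if b < rk E then trn E i k x $$ (a, b) else 0
        else if b < rk E then 0 else trn F j l x $$ (a - rk E, b - rk E)) =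
        trn ?S (prod_encode (i, j)) (prod_encode (k, l)) x $$ (a, b)"
        using cE[of i k x] cF[of j l x] that ab by (auto simp: cov trn rk)
    qed
  qed
  moreover have "trn ?S (prod_encode (i, j)) (prod_encode (k, l)) x * trn ?S (prod_encode (k, l)) (prod_encode (p, q)) x =
      trn ?S (prod_encode (i, j)) (prod_encode (p, q)) x"
    if "i \<in> idx E" "j \<in> idx F" "k \<in> idx E" "l \<in> idx F" "p \<in> idx E" "q \<in> idx F"
      "x \<in> cov E i \<inter> cov E k \<inter> cov E p" "x \<in> cov F j \<inter> cov F l \<inter> cov F q" for i j k l p q x
  proof -
    have eqE: "trn E i k x * trn E k p x = trn E i p x" and eqF: "trn F j l x * trn F l q x = trn F j q x"
      using E F that unfolding vector_bundle_def by blast+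
    note c = cE[of i k x] cE[of k p x] cE[of i p x] cF[of j l x] cF[of l q x] cF[of j q x]
    show ?thesis
      unfolding trn
      by (subst mult_four_block_mat[of _ "rk E" "rk E" _ "rk F" _ "rk F" _ _ "rk E" _ "rk F"])
        (use that c in \<open>simp_all add: eqE eqF\<close>)
  qed
  moreover have "openin X (cov E i \<inter> cov F j)" if "i \<in> idx E" "j \<in> idx F" for i j
    using E F that by (auto simp: vector_bundle_def)
  moreover have "(\<Union>k\<in>idx ?S. cov ?S k) = topspace X"
  proof -
    have "(\<Union>k\<in>idx ?S. cov ?S k) = (\<Union>i\<in>idx E. cov E i) \<inter> (\<Union>j\<in>idx F. cov F j)"
      by (auto simp: idx cov)
    then show ?thesis
      using E F by (simp add: vector_bundle_def)
  qed
  moreover have "trn ?S (prod_encode (i, j)) (prod_encode (i, j)) x = 1\<^sub>m (rk ?S)"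
    if "i \<in> idx E" "j \<in> idx F" "x \<in> cov E i" "x \<in> cov F j" for i j x
    using E F that by (simp add: vector_bundle_def trn rk)
  ultimately show ?thesis
    unfolding vector_bundle_def by (auto simp: idx cov)
qed

text \<open>The k-fold sum of the hyperplane bundle on the standard cover, with scalar transition
  matrices; iterated \<open>direct_sum\<close> would index the charts by nested pairs.\<close>

definition hyperplane_sum :: "nat \<Rightarrow> nat \<Rightarrow> cline vbundle" where
  "hyperplane_sum n k = \<lparr>rk = k, idx = {..n}, cov = cp_dom n,
     trn = (\<lambda>i j L. (homog L j / homog L i) \<cdot>\<^sub>m 1\<^sub>m k)\<rparr>"

lemma hyperplane_sum_1: "hyperplane_sum n 1 = hyperplane_bundle n"
  unfolding hyperplane_sum_def hyperplane_bundle_def by (auto simp: fun_eq_iff)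

lemma cp_domD: "L \<in> cp_dom n i \<Longrightarrow> homog L i \<noteq> 0"
  by (simp add: cp_dom_def)

lemma cspan_in_cp_dom: "z \<in> punctured_space n \<Longrightarrow> cspan z \<in> cp_dom n i \<longleftrightarrow> z i \<noteq> 0"
  using homog_cspan_nonzero_iff[of z n i] by (auto simp: cp_dom_def)

lemma continuous_map_homog_ratio:
  assumes "openin (cp_top n) U" "U \<subseteq> cp_dom n i"
  shows "continuous_map (subtopology (cp_top n) U) euclidean (\<lambda>L. homog L j / homog L i)"
proof (rule continuous_map_cp_top[OF assms(1)])
  show "continuous_on {z \<in> punctured_space n. cspan z \<in> U} (\<lambda>z. z j / z i)"
    using assms(2) cspan_in_cp_dom by (intro continuous_intros) blast
qed auto

lemma smult_1_one_mat: "(1 :: complex) \<cdot>\<^sub>m 1\<^sub>m k = 1\<^sub>m k"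
  by (rule eq_matI) auto

lemma smult_one_mult: "(a \<cdot>\<^sub>m 1\<^sub>m k) * (b \<cdot>\<^sub>m 1\<^sub>m k) = (a * b :: complex) \<cdot>\<^sub>m 1\<^sub>m k"
proof -
  have "(a \<cdot>\<^sub>m 1\<^sub>m k) * (b \<cdot>\<^sub>m 1\<^sub>m k) = a \<cdot>\<^sub>m (b \<cdot>\<^sub>m 1\<^sub>m k)"
    by (subst mult_smult_assoc_mat[of _ k k _ k]) simp_all
  also have "\<dots> = (a * b) \<cdot>\<^sub>m 1\<^sub>m k"
    by (rule eq_matI) auto
  finally show ?thesis .
qed

lemma vector_bundle_hyperplane_sum: "vector_bundle (cp_top n) (hyperplane_sum n k)"
  unfolding vector_bundle_def
proof (intro conjI ballI)
  show "(\<Union>i\<in>idx (hyperplane_sum n k). cov (hyperplane_sum n k) i) = topspace (cp_top n)"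
    using cp_dom_cover by (simp add: hyperplane_sum_def)
next
  fix i j assume "i \<in> idx (hyperplane_sum n k)" "j \<in> idx (hyperplane_sum n k)"
  have *: "continuous_map (subtopology (cp_top n) (cp_dom n i \<inter> cp_dom n j)) euclidean (\<lambda>L. homog L j / homog L i)"
    by (rule continuous_map_homog_ratio) (auto intro: openin_cp_dom)
  show "continuous_matrix (cp_top n) (cov (hyperplane_sum n k) i \<inter> cov (hyperplane_sum n k) j)
      (rk (hyperplane_sum n k)) (trn (hyperplane_sum n k) i j)"
    by (rule continuous_matrixI) (use * in \<open>auto simp: hyperplane_sum_def\<close>)
next
  fix i x assume "x \<in> cov (hyperplane_sum n k) i"
  then show "trn (hyperplane_sum n k) i i x = 1\<^sub>m (rk (hyperplane_sum n k))"
    using cp_domD[of x n i] by (auto simp: hyperplane_sum_def)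
next
  fix i j l x assume "x \<in> cov (hyperplane_sum n k) i \<inter> cov (hyperplane_sum n k) j \<inter> cov (hyperplane_sum n k) l"
  then show "trn (hyperplane_sum n k) i j x * trn (hyperplane_sum n k) j l x = trn (hyperplane_sum n k) i l x"
    using cp_domD[of x n i] cp_domD[of x n j] by (auto simp: hyperplane_sum_def smult_one_mult)
qed (auto simp: hyperplane_sum_def openin_cp_dom)

text \<open>The isomorphism is itself built from transition functions: from chart i to chart a on
  the first k coordinates and to chart b on the last.\<close>

lemma bundle_iso_hyperplane_sum_Suc:
  "bundle_iso (cp_top n) (hyperplane_sum n (Suc k)) (direct_sum (hyperplane_sum n k) (hyperplane_bundle n))"
proof -
  let ?E = "hyperplane_sum n (Suc k)" and ?F = "direct_sum (hyperplane_sum n k) (hyperplane_sum n 1)"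
  let ?g = "\<lambda>i j L. homog L j / homog L i"
  define h where "h p i L = four_block_mat (?g (fst (prod_decode p)) i L \<cdot>\<^sub>m 1\<^sub>m k) (0\<^sub>m k 1) (0\<^sub>m 1 k)
    (?g (snd (prod_decode p)) i L \<cdot>\<^sub>m 1\<^sub>m 1)" for p i L
  have hc: "h p i L \<in> carrier_mat (Suc k) (Suc k)" for p i L
    by (rule carrier_matI) (simp_all add: h_def)
  have block: "c \<cdot>\<^sub>m 1\<^sub>m (Suc k) = four_block_mat (c \<cdot>\<^sub>m 1\<^sub>m k) (0\<^sub>m k 1) (0\<^sub>m 1 k) (c \<cdot>\<^sub>m 1\<^sub>m 1)" for c :: complex
    by (rule eq_matI) auto
  have mult: "four_block_mat (a \<cdot>\<^sub>m 1\<^sub>m k) (0\<^sub>m k 1) (0\<^sub>m 1 k) (b \<cdot>\<^sub>m 1\<^sub>m 1) *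
     four_block_mat (c \<cdot>\<^sub>m 1\<^sub>m k) (0\<^sub>m k 1) (0\<^sub>m 1 k) (d \<cdot>\<^sub>m 1\<^sub>m 1) =
     four_block_mat ((a * c) \<cdot>\<^sub>m 1\<^sub>m k) (0\<^sub>m k 1) (0\<^sub>m 1 k) ((b * d) \<cdot>\<^sub>m 1\<^sub>m 1)" for a b c d :: complex
    by (subst mult_four_block_mat[of _ k k _ 1 _ 1 _ _ k _ 1]) (simp_all add: smult_one_mult)
  have "bundle_iso (cp_top n) ?E ?F"
    unfolding bundle_iso_def
  proof (intro conjI exI[of _ h] ballI)
    fix p i assume p: "p \<in> idx ?F" and i: "i \<in> idx ?E"
    then obtain a b where ab: "p = prod_encode (a, b)" "a \<le> n" "b \<le> n"
      by (auto simp: direct_sum_def hyperplane_sum_def)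
    let ?U = "cov ?F p \<inter> cov ?E i"
    have U: "?U = cp_dom n a \<inter> cp_dom n b \<inter> cp_dom n i"
      by (auto simp: direct_sum_def hyperplane_sum_def ab)
    have open_U: "openin (cp_top n) ?U"
      unfolding U by (intro openin_Int openin_cp_dom)
    show "continuous_matrix (cp_top n) ?U (rk ?E) (h p i)"
    proof (rule continuous_matrixI)
      fix r s assume rs: "r < rk ?E" "s < rk ?E"
      have "continuous_map (subtopology (cp_top n) ?U) euclidean (?g j i)" if "j = a \<or> j = b" for j
        by (rule continuous_map_homog_ratio[OF open_U]) (use that in \<open>auto simp: U simp del: One_nat_def\<close>)
      then show "continuous_map (subtopology (cp_top n) ?U) euclidean (\<lambda>x. h p i x $$ (r, s))"
        using rs by (auto simp: h_def ab hyperplane_sum_def)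
    qed (simp add: hyperplane_sum_def hc)
    fix x assume x: "x \<in> ?U"
    have nz: "homog x a \<noteq> 0" "homog x b \<noteq> 0" "homog x i \<noteq> 0"
      using x cp_domD unfolding U by blast+
    have "h p i x * four_block_mat (?g i a x \<cdot>\<^sub>m 1\<^sub>m k) (0\<^sub>m k 1) (0\<^sub>m 1 k) (?g i b x \<cdot>\<^sub>m 1\<^sub>m 1) = 1 \<cdot>\<^sub>m 1\<^sub>m (Suc k)"
      unfolding h_def ab prod_encode_inverse fst_conv snd_conv mult block using nz by simp
    then have "h p i x * four_block_mat (?g i a x \<cdot>\<^sub>m 1\<^sub>m k) (0\<^sub>m k 1) (0\<^sub>m 1 k) (?g i b x \<cdot>\<^sub>m 1\<^sub>m 1) = 1\<^sub>m (Suc k)"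
      by (simp add: smult_1_one_mat)
    then show "invertible_mat (h p i x)"
      by (intro invertible_mat_if_right_inverse[OF hc]) (simp_all add: carrier_matI)
  next
    fix p q i j x assume p: "p \<in> idx ?F" and q: "q \<in> idx ?F" and "i \<in> idx ?E" "j \<in> idx ?E"
      and x: "x \<in> cov ?F p \<inter> cov ?F q \<inter> cov ?E i \<inter> cov ?E j"
    then obtain a b c d where ab: "p = prod_encode (a, b)" "q = prod_encode (c, d)"
      by (auto simp: direct_sum_def hyperplane_sum_def)
    have nz: "homog x a \<noteq> 0" "homog x b \<noteq> 0" "homog x c \<noteq> 0" "homog x d \<noteq> 0" "homog x i \<noteq> 0" "homog x j \<noteq> 0"
      using x cp_domD[of x n] by (simp_all add: ab direct_sum_def hyperplane_sum_def)
    show "trn ?F p q x * h q j x = h p i x * trn ?E i j x"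
      using nz by (simp add: direct_sum_def hyperplane_sum_def h_def ab block mult del: One_nat_def)
  qed (simp add: direct_sum_def hyperplane_sum_def)
  then show ?thesis
    unfolding hyperplane_sum_1 .
qed

text \<open>The same ratios are transition functions on both sides; the extra chart of index n has
  empty domain on the hyperplane.\<close>

lemma bundle_iso_hyperplane_restrict:
  assumes "n \<ge> 1"
  shows "bundle_iso (cp_top (n - 1)) (pullback_bundle (cp_top (n - 1)) id (hyperplane_bundle n)) (hyperplane_bundle (n - 1))"
proof -
  let ?E = "pullback_bundle (cp_top (n - 1)) id (hyperplane_sum n 1)" and ?F = "hyperplane_sum (n - 1) 1"
  let ?g = "\<lambda>i j L. homog L j / homog L i"
  have covE: "cov ?E i = cp_dom (n - 1) i" for i
  proof -
    have "punctured_space (n - 1) \<subseteq> punctured_space n"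
      by (auto simp: punctured_space_def)
    then show ?thesis
      by (auto simp: pullback_bundle_def hyperplane_sum_def cp_dom_def)
  qed
  have "bundle_iso (cp_top (n - 1)) ?E ?F"
    unfolding bundle_iso_def
  proof (intro conjI exI[of _ "\<lambda>a i L. ?g a i L \<cdot>\<^sub>m 1\<^sub>m 1"] ballI)
    fix a i
    let ?U = "cov ?F a \<inter> cov ?E i"
    have U: "?U = cp_dom (n - 1) a \<inter> cp_dom (n - 1) i"
      unfolding covE by (simp add: hyperplane_sum_def)
    have "continuous_map (subtopology (cp_top (n - 1)) ?U) euclidean (?g a i)"
      unfolding U by (rule continuous_map_homog_ratio) (auto intro: openin_cp_dom)
    then show "continuous_matrix (cp_top (n - 1)) ?U (rk ?E) (\<lambda>L. ?g a i L \<cdot>\<^sub>m 1\<^sub>m 1)"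
      by (intro continuous_matrixI) (auto simp: pullback_bundle_def hyperplane_sum_def)
    fix x assume "x \<in> ?U"
    then have "(?g a i x \<cdot>\<^sub>m 1\<^sub>m 1) * (?g i a x \<cdot>\<^sub>m 1\<^sub>m 1) = (1\<^sub>m 1 :: complex Matrix.mat)"
      using cp_domD[of x "n - 1" a] cp_domD[of x "n - 1" i] unfolding U smult_one_mult
      by (simp add: smult_1_one_mat)
    then show "invertible_mat (?g a i x \<cdot>\<^sub>m 1\<^sub>m 1)"
      by (intro invertible_mat_if_right_inverse[of _ 1]) simp_all
  next
    fix a b i j x assume "x \<in> cov ?F a \<inter> cov ?F b \<inter> cov ?E i \<inter> cov ?E j"
    then show "trn ?F a b x * (?g b j x \<cdot>\<^sub>m 1\<^sub>m 1) = (?g a i x \<cdot>\<^sub>m 1\<^sub>m 1) * trn ?E i j x"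
      using cp_domD[of x "n - 1"] unfolding covE
      by (simp add: hyperplane_sum_def pullback_bundle_def smult_one_mult)
  qed (simp add: hyperplane_sum_def pullback_bundle_def)
  then show ?thesis
    unfolding hyperplane_sum_1 .
qed

lemma continuous_map_cp_inclusion: "continuous_map (cp_top (n - 1)) (cp_top n) id"
proof -
  have P: "punctured_space (n - 1) \<subseteq> punctured_space n"
    by (auto simp: punctured_space_def)
  have "openin (cp_top (n - 1)) (topspace (cp_top (n - 1)) \<inter> U)" if "openin (cp_top n) U" for U
  proof -
    obtain T where T: "open T" "{z \<in> punctured_space n. cspan z \<in> U} = punctured_space n \<inter> T"
      using \<open>openin (cp_top n) U\<close> unfolding openin_cp_top openin_open by blast
    then have "punctured_space (n - 1) \<inter> {z \<in> punctured_space n. cspan z \<in> U} = punctured_space (n - 1) \<inter> T"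
      using P by auto
    then have "openin (top_of_set (punctured_space (n - 1))) (punctured_space (n - 1) \<inter> {z \<in> punctured_space n. cspan z \<in> U})"
      using T(1) unfolding openin_open by blast
    moreover have "punctured_space (n - 1) \<inter> {z \<in> punctured_space n. cspan z \<in> U} =
       {z \<in> punctured_space (n - 1). cspan z \<in> topspace (cp_top (n - 1)) \<inter> U}"
      using P by auto
    ultimately show ?thesis
      unfolding openin_cp_top by auto
  qed
  moreover have "{x \<in> topspace (cp_top (n - 1)). x \<in> U} = topspace (cp_top (n - 1)) \<inter> U" for U by auto
  ultimately show ?thesis
    unfolding continuous_map using P by auto
qed

section \<open>The tangent bundle\<close>

text \<open>The a-th affine coordinate in chart i comes from the homogeneous coordinate
  \<open>skip i a\<close>: the increasing enumeration of the indices other than i.\<close>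

definition skip :: "nat \<Rightarrow> nat \<Rightarrow> nat" where
  "skip i a = (if a < i then a else Suc a)"

lemma skip_neq [simp]: "skip i a \<noteq> i" "i \<noteq> skip i a"
  by (auto simp: skip_def)

lemma skip_eq_iff [simp]: "skip i a = skip i b \<longleftrightarrow> a = b"
  by (auto simp: skip_def)

lemma skip_le: "a < n \<Longrightarrow> skip i a \<le> n"
  by (auto simp: skip_def)

lemma sum_skip:
  fixes g :: "nat \<Rightarrow> complex"
  assumes "j \<le> n"
  shows "(\<Sum>b<n. g (skip j b)) = (\<Sum>k\<le>n. g k) - g j"
proof -
  have "(\<Sum>b<n. g (skip j b)) = (\<Sum>k\<in>{..n} - {j}. g k)"
    by (rule sum.reindex_bij_witness[of _ "\<lambda>k. if k < j then k else k - 1" "skip j"])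
      (use assms in \<open>auto simp: skip_def\<close>)
  then show ?thesis
    using assms by (simp add: sum_diff1)
qed

text \<open>The inverse of the affine chart, as a homogeneous vector normalized at j.\<close>

definition insert_one :: "nat \<Rightarrow> (nat \<Rightarrow> complex) \<Rightarrow> nat \<Rightarrow> complex" where
  "insert_one j w k = (if k < j then w k else if k = j then 1 else w (k - 1))"

lemma insert_one_skip [simp]: "insert_one j w (skip j b) = w b"
  by (auto simp: insert_one_def skip_def)

lemma insert_one_same [simp]: "insert_one j w j = 1"
  by (simp add: insert_one_def)

lemma insert_one_upd: "insert_one j (w(b := z)) = (insert_one j w)(skip j b := z)"
  by (auto simp: insert_one_def skip_def fun_eq_iff)

lemma insert_one_punctured:
  assumes "j \<le> n" "\<And>a. a \<ge> n \<Longrightarrow> w a = 0"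
  shows "insert_one j w \<in> punctured_space n"
proof -
  have "insert_one j w j \<noteq> 0" by simp
  then have "insert_one j w \<noteq> (\<lambda>_. 0)" by metis
  then show ?thesis
    using assms by (auto simp: punctured_space_def insert_one_def)
qed

lemma cp_chart_altdef: "cp_chart n j L a = (if a < n then homog L (skip j a) / homog L j else 0)"
  by (simp add: cp_chart_def skip_def)

lemma cp_chart_cspan:
  assumes "z \<noteq> (\<lambda>_. 0)"
  shows "cp_chart n j (cspan z) a = (if a < n then z (skip j a) / z j else 0)"
  using homog_cspan[OF assms] by (auto simp: cp_chart_altdef)

lemma insert_one_cp_chart:
  assumes L: "L \<in> cp_dom n j" and j: "j \<le> n"
  shows "insert_one j (cp_chart n j L) = (\<lambda>k. inverse (homog L j) * homog L k)"
proof
  fix k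
  have "homog L \<in> punctured_space n"
    using L cp_dom_subset homog_in_punctured by blast
  then have "homog L k = 0" if "k > n" using that by (simp add: punctured_space_def)
  then show "insert_one j (cp_chart n j L) k = inverse (homog L j) * homog L k"
    using cp_domD[OF L] j
    by (cases k; auto simp: insert_one_def cp_chart_def divide_inverse_commute not_less less_Suc_eq_le)
qed

lemma mchart_inv_CP:
  assumes j: "j \<le> n" and w: "\<And>a. a \<ge> n \<Longrightarrow> w a = 0"
  shows "mchart_inv (CP n) j w = cspan (insert_one j w)"
proof -
  have P: "insert_one j w \<in> punctured_space n"
    by (rule insert_one_punctured[OF j w])
  \<comment> \<open>\<open>mchart_inv\<close> is an \<open>inv_into\<close>, so any preimage in the
    domain is its value once the chart is injective there.\<close>
  have "inj_on (cp_chart n j) (cp_dom n j)"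
  proof (rule inj_onI)
    fix L M assume L: "L \<in> cp_dom n j" and M: "M \<in> cp_dom n j" and eq: "cp_chart n j L = cp_chart n j M"
    have "N = cspan (insert_one j (cp_chart n j N))" if "N \<in> cp_dom n j" for N
      unfolding insert_one_cp_chart[OF that j]
      using cp_domD[OF that] cp_dom_subset[of n j] that homog_in_punctured(2)[of N n]
      by (subst cspan_scale) auto
    from this[OF L] this[OF M] eq show "L = M" by simp
  qed
  moreover have "cspan (insert_one j w) \<in> cp_dom n j"
    using cspan_in_cp_dom[OF P] by simp
  moreover have "cp_chart n j (cspan (insert_one j w)) = w"
    using w by (auto simp: fun_eq_iff cp_chart_cspan[OF punctured_nonzero[OF P]])
  ultimately show ?thesis
    unfolding mchart_inv_def by (simp add: CP_def inv_into_f_eq)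
qed

text \<open>The quotient rule for y_(skip i a) / y_i, differentiated in y_(skip j b) at y = u / u_j
  and written in terms of u.\<close>

definition cp_jacobian :: "nat \<Rightarrow> nat \<Rightarrow> (nat \<Rightarrow> complex) \<Rightarrow> nat \<Rightarrow> nat \<Rightarrow> complex" where
  "cp_jacobian i j u a b = u j / u i * ((if skip i a = skip j b then 1 else 0) -
     (if skip j b = i then u (skip i a) / u i else 0))"

lemma deriv_cp_chart:
  assumes L: "L \<in> cp_dom n i" "L \<in> cp_dom n j" and ij: "i \<le> n" "j \<le> n" and ab: "a < n" "b < n"
  shows "deriv (\<lambda>z. cp_chart n i (mchart_inv (CP n) j ((cp_chart n j L)(b := z))) a) (cp_chart n j L b) =
    cp_jacobian i j (homog L) a b"
proof -
  let ?u = "homog L"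
  define y where "y = (\<lambda>k. inverse (?u j) * ?u k)"
  have y: "insert_one j (cp_chart n j L) = y"
    unfolding y_def by (rule insert_one_cp_chart[OF L(2) ij(2)])
  have u: "?u i \<noteq> 0" "?u j \<noteq> 0"
    using L cp_domD by blast+
  have "cp_chart n i (mchart_inv (CP n) j ((cp_chart n j L)(b := z))) a =
      (y(skip j b := z)) (skip i a) / (y(skip j b := z)) i" for z
  proof -
    let ?w = "(cp_chart n j L)(b := z)"
    have w: "?w c = 0" if "c \<ge> n" for c
      using that ab by (simp add: cp_chart_def)
    have inv: "mchart_inv (CP n) j ?w = cspan (insert_one j ?w)"
      by (rule mchart_inv_CP[OF ij(2) w])
    have nz: "insert_one j ?w \<noteq> (\<lambda>_. 0)"
      by (rule punctured_nonzero[OF insert_one_punctured[OF ij(2) w]])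
    show ?thesis
      unfolding inv cp_chart_cspan[OF nz] unfolding insert_one_upd y using ab by simp
  qed
  then have eq: "(\<lambda>z. cp_chart n i (mchart_inv (CP n) j ((cp_chart n j L)(b := z))) a) =
      (\<lambda>z. (y(skip j b := z)) (skip i a) / (y(skip j b := z)) i)" by (rule ext)
  have z0: "cp_chart n j L b = y (skip j b)"
    using ab by (simp add: cp_chart_altdef y_def divide_inverse_commute)
  have yi: "y i \<noteq> 0" using u by (simp add: y_def)
  \<comment> \<open>The moving coordinate is the denominator, the numerator, or neither; it is never
    both, as \<open>skip i a\<close> differs from i.\<close>
  consider "skip j b = i" | "skip j b = skip i a" "skip j b \<noteq> i" | "skip j b \<noteq> skip i a" "skip j b \<noteq> i" by blast
  then have "((\<lambda>z. (y(skip j b := z)) (skip i a) / (y(skip j b := z)) i) has_field_derivative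
     cp_jacobian i j ?u a b) (at (y (skip j b)))"
  proof cases
    case 1
    then have "((\<lambda>z. y (skip i a) / z) has_field_derivative cp_jacobian i j ?u a b) (at (y (skip j b)))"
      using u yi by (auto intro!: derivative_eq_intros simp: cp_jacobian_def y_def field_simps)
    with 1 show ?thesis by simp
  next
    case 2
    then have "((\<lambda>z. z / y i) has_field_derivative cp_jacobian i j ?u a b) (at (y (skip j b)))"
      using u yi by (auto intro!: derivative_eq_intros simp: cp_jacobian_def y_def field_simps)
    with 2 show ?thesis by simp
  next
    case 3
    then have "((\<lambda>z. y (skip i a) / y i) has_field_derivative cp_jacobian i j ?u a b) (at (y (skip j b)))"
      by (auto simp: cp_jacobian_def)
    with 3 show ?thesis by simp
  qed
  then show ?thesis
    unfolding eq z0 by (rule DERIV_imp_deriv)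
qed

lemma tangent_bundle_CP_simps:
  "rk (tangent_bundle (CP n)) = n" "idx (tangent_bundle (CP n)) = {..n}" "cov (tangent_bundle (CP n)) = cp_dom n"
  by (simp_all add: tangent_bundle_def CP_def)

lemma trn_tangent_bundle_CP:
  assumes "L \<in> cp_dom n i" "L \<in> cp_dom n j" "i \<le> n" "j \<le> n"
  shows "trn (tangent_bundle (CP n)) i j L = Matrix.mat n n (\<lambda>(a, b). cp_jacobian i j (homog L) a b)"
  unfolding tangent_bundle_def using deriv_cp_chart[OF assms]
  by (auto simp: CP_def intro!: cong_mat)

lemma trn_tangent_bundle_carrier: "trn (tangent_bundle (CP n)) i j L \<in> carrier_mat n n"
  by (simp add: tangent_bundle_def CP_def)

section \<open>The Jacobian as a projection modulo the line\<close>

definition delta :: "nat \<Rightarrow> nat \<Rightarrow> complex" where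
  "delta a b = (if a = b then 1 else 0)"

lemma sum_delta:
  "a \<le> n \<Longrightarrow> (\<Sum>k\<le>n. delta a k * f k) = f a" "a \<le> n \<Longrightarrow> (\<Sum>k\<le>n. delta k a * f k) = f a"
  by (simp_all add: delta_def if_distrib[of "\<lambda>x. x * _"] cong: if_cong)

text \<open>Over the \<open>j\<close>-th chart, a tangent vector is an element of \<open>\<complex>\<^sup>n\<^sup>+\<^sup>1\<close> modulo the line spanned by \<open>u\<close>,
  normalized to have \<open>j\<close>-th coordinate zero; \<open>\<delta> a k - \<delta> k j u\<^sub>a / u\<^sub>j\<close> is the matrix of this projection.\<close>

lemma projection_compose:
  assumes u: "u i \<noteq> 0" "u j \<noteq> 0" and le: "al \<le> n" "ga \<le> n" "i \<le> n" "j \<le> n"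
  shows "(\<Sum>b<n. (delta al (skip j b) - delta (skip j b) i * (u al / u i)) *
      (delta (skip j b) ga - delta ga j * (u (skip j b) / u j))) =
    delta al ga - delta ga i * (u al / u i)"
proof -
  define f where "f k = delta k ga - delta ga j * (u k / u j)" for k
  \<comment> \<open>\<open>f\<close> vanishes at j, so the index omitted by \<open>skip j\<close>
    can be restored and the Kronecker deltas summed.\<close>
  have "(\<Sum>b<n. (delta al (skip j b) - delta (skip j b) i * (u al / u i)) * f (skip j b)) =
     (\<Sum>k\<le>n. (delta al k - delta k i * (u al / u i)) * f k) - (delta al j - delta j i * (u al / u i)) * f j"
    by (rule sum_skip[OF le(4)])
  also have "f j = 0"
    using u by (simp add: f_def delta_def)
  also have "(\<Sum>k\<le>n. (delta al k - delta k i * (u al / u i)) * f k) = f al - (u al / u i) * f i"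
  proof -
    have "(\<Sum>k\<le>n. (delta al k - delta k i * (u al / u i)) * f k) =
       (\<Sum>k\<le>n. delta al k * f k) - (u al / u i) * (\<Sum>k\<le>n. delta k i * f k)"
      unfolding sum_distrib_left by (simp add: algebra_simps sum_subtractf)
    then show ?thesis using le by (simp only: sum_delta)
  qed
  also have "f al - (u al / u i) * f i = delta al ga - delta ga i * (u al / u i)"
    using u by (auto simp: f_def delta_def)
  finally show ?thesis by (simp add: f_def)
qed

text \<open>A transition function of the hyperplane bundle times the projection modulo u: the
  tangent bundle is Hom(L, C^(n+1) / L) for the tautological line L.\<close>

lemma cp_jacobian_delta:
  "cp_jacobian i j u a b = u j / u i * (delta (skip i a) (skip j b) - delta (skip j b) i * (u (skip i a) / u i))"
  by (simp add: cp_jacobian_def delta_def)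

lemma cp_jacobian_compose:
  assumes "u i \<noteq> 0" "u j \<noteq> 0" "u k \<noteq> 0" and le: "i \<le> n" "j \<le> n" "k \<le> n" and ac: "a < n" "c < n"
  shows "(\<Sum>b<n. cp_jacobian i j u a b * cp_jacobian j k u b c) = cp_jacobian i k u a c"
proof -
  have "(\<Sum>b<n. cp_jacobian i j u a b * cp_jacobian j k u b c) = (u k / u i) *
     (\<Sum>b<n. (delta (skip i a) (skip j b) - delta (skip j b) i * (u (skip i a) / u i)) *
      (delta (skip j b) (skip k c) - delta (skip k c) j * (u (skip j b) / u j)))"
    unfolding sum_distrib_left using assms by (intro sum.cong) (auto simp: cp_jacobian_delta)
  also have "\<dots> = u k / u i * (delta (skip i a) (skip k c) - delta (skip k c) i * (u (skip i a) / u i))"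
    by (subst projection_compose) (use assms skip_le in auto)
  also have "\<dots> = cp_jacobian i k u a c"
    by (simp only: cp_jacobian_delta)
  finally show ?thesis .
qed

lemma continuous_map_cp_jacobian:
  assumes U: "openin (cp_top n) U" "U \<subseteq> cp_dom n i"
  shows "continuous_map (subtopology (cp_top n) U) euclidean (\<lambda>L. cp_jacobian i j (homog L) a b)"
proof -
  have nz: "z i \<noteq> 0" if "z \<in> punctured_space n" "cspan z \<in> U" for z
    using that U(2) cspan_in_cp_dom by blast
  show ?thesis
  proof (rule continuous_map_cp_top[OF U(1)])
    show "continuous_on {z \<in> punctured_space n. cspan z \<in> U} (\<lambda>z. cp_jacobian i j z a b)"
      unfolding cp_jacobian_delta by (intro continuous_intros) (auto simp: nz)
  qed (simp add: cp_jacobian_delta)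
qed

lemma vector_bundle_tangent_CP: "vector_bundle (cp_top n) (tangent_bundle (CP n))"
  unfolding vector_bundle_def tangent_bundle_CP_simps
proof (intro conjI ballI)
  fix i j assume ij: "i \<in> {..n}" "j \<in> {..n}"
  let ?U = "cp_dom n i \<inter> cp_dom n j"
  show "continuous_matrix (cp_top n) ?U n (trn (tangent_bundle (CP n)) i j)"
  proof (rule continuous_matrixI)
    fix a b assume ab: "a < n" "b < n"
    have "continuous_map (subtopology (cp_top n) ?U) euclidean (\<lambda>L. cp_jacobian i j (homog L) a b)"
      by (rule continuous_map_cp_jacobian) (auto intro: openin_cp_dom)
    then show "continuous_map (subtopology (cp_top n) ?U) euclidean (\<lambda>L. trn (tangent_bundle (CP n)) i j L $$ (a, b))"
      by (rule continuous_map_subtopology_cong) (use ij ab in \<open>auto simp: trn_tangent_bundle_CP\<close>)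
  qed (rule trn_tangent_bundle_carrier)
next
  fix i x assume "i \<in> {..n}" "x \<in> cp_dom n i"
  then show "trn (tangent_bundle (CP n)) i i x = 1\<^sub>m n"
    using cp_domD[of x n i]
    by (intro eq_matI) (auto simp: trn_tangent_bundle_CP cp_jacobian_def)
next
  fix i j k x assume *: "i \<in> {..n}" "j \<in> {..n}" "k \<in> {..n}" "x \<in> cp_dom n i \<inter> cp_dom n j \<inter> cp_dom n k"
  have u: "homog x i \<noteq> 0" "homog x j \<noteq> 0" "homog x k \<noteq> 0"
    using * cp_domD by blast+
  show "trn (tangent_bundle (CP n)) i j x * trn (tangent_bundle (CP n)) j k x = trn (tangent_bundle (CP n)) i k x"
  proof (rule eq_matI)
    fix a c assume "a < dim_row (trn (tangent_bundle (CP n)) i k x)" "c < dim_col (trn (tangent_bundle (CP n)) i k x)"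
    then have "a < n" "c < n"
      using trn_tangent_bundle_carrier[of n i k x] by auto
    then show "(trn (tangent_bundle (CP n)) i j x * trn (tangent_bundle (CP n)) j k x) $$ (a, c) =
        trn (tangent_bundle (CP n)) i k x $$ (a, c)"
      using * u cp_jacobian_compose[of "homog x" i j k n a c]
      by (simp add: trn_tangent_bundle_CP scalar_prod_def atLeast0LessThan)
  qed (simp_all add: carrier_matD[OF trn_tangent_bundle_carrier])
qed (auto simp: openin_cp_dom cp_dom_cover simp del: topspace_cp_top)

section \<open>The Euler sequence\<close>

text \<open>The splitting \<open>\<eta>\<^sup>n\<^sup>+\<^sup>1 \<cong> T \<oplus> \<epsilon>\<close> of the Euler sequence: on the fibre \<open>\<complex>\<^sup>n\<^sup>+\<^sup>1\<close> over \<open>[u]\<close>, the first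
  \<open>n\<close> rows project modulo \<open>u\<close>, the last row is the Hermitian product with \<open>u\<close>.\<close>

definition euler_entry :: "nat \<Rightarrow> nat \<Rightarrow> (nat \<Rightarrow> complex) \<Rightarrow> nat \<Rightarrow> nat \<Rightarrow> complex" where
  "euler_entry n a u r k = (if r < n then delta (skip a r) k - delta k a * (u (skip a r) / u a)
     else cnj (u k) * u a / sqnorm n u)"

text \<open>For c < n, the basis vector of index \<open>skip a c\<close> minus its Hermitian
  projection to u; the last column is u normalized at a.\<close>

definition euler_inverse_entry :: "nat \<Rightarrow> nat \<Rightarrow> (nat \<Rightarrow> complex) \<Rightarrow> nat \<Rightarrow> nat \<Rightarrow> complex" where
  "euler_inverse_entry n a u k c = (if c < n then delta k (skip a c) - cnj (u (skip a c)) * u a / sqnorm n u * (u k / u a)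
     else u k / u a)"

lemma sum_euler_entry:
  assumes "r < n" "a \<le> n"
  shows "(\<Sum>k\<le>n. euler_entry n a u r k * f k) = f (skip a r) - u (skip a r) / u a * f a"
proof -
  have "(\<Sum>k\<le>n. euler_entry n a u r k * f k) =
     (\<Sum>k\<le>n. delta (skip a r) k * f k) - (\<Sum>k\<le>n. delta k a * (u (skip a r) / u a * f k))"
    using assms by (simp add: euler_entry_def algebra_simps sum_subtractf)
  then show ?thesis
    using assms skip_le by (simp only: sum_delta)
qed

text \<open>The first rows annihilate multiples of u, and the last row annihilates vectors
  orthogonal to u.\<close>

lemma euler_inverse:
  assumes u: "u a \<noteq> 0" "sqnorm n u \<noteq> 0" and le: "a \<le> n" "r \<le> n" "c \<le> n"
  shows "(\<Sum>k\<le>n. euler_entry n a u r k * euler_inverse_entry n a u k c) = delta r c"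
proof (cases "r < n")
  case True
  show ?thesis
  proof (cases "c < n")
    case c: True
    show ?thesis
      unfolding sum_euler_entry[OF True le(1)]
      using c u by (simp add: euler_inverse_entry_def delta_def)
  next
    case False
    then show ?thesis
      unfolding sum_euler_entry[OF True le(1)]
      using True u le by (simp add: euler_inverse_entry_def delta_def)
  qed
next
  case False
  then have r: "r = n" using le by simp
  have N: "(\<Sum>k\<le>n. cnj (u k) * u a / sqnorm n u * (u k / u a)) = 1"
  proof -
    have "(\<Sum>k\<le>n. cnj (u k) * u a / sqnorm n u * (u k / u a)) = (\<Sum>k\<le>n. u k * cnj (u k)) / sqnorm n u"
      unfolding sum_divide_distrib using u by (intro sum.cong) auto
    then show ?thesis using u by (simp add: sqnorm_def)
  qed
  show ?thesis
  proof (cases "c < n")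
    case c: True
    let ?t = "cnj (u (skip a c)) * u a / sqnorm n u"
    have "(\<Sum>k\<le>n. euler_entry n a u r k * euler_inverse_entry n a u k c) =
      (\<Sum>k\<le>n. delta k (skip a c) * (cnj (u k) * u a / sqnorm n u)) -
      ?t * (\<Sum>k\<le>n. cnj (u k) * u a / sqnorm n u * (u k / u a))"
      unfolding sum_distrib_left sum_subtractf[symmetric] using c
      by (intro sum.cong refl) (simp add: r euler_entry_def euler_inverse_entry_def right_diff_distrib mult_ac)
    also have "\<dots> = 0"
      unfolding N using c skip_le by (simp only: sum_delta) simp
    finally show ?thesis using c r by (simp add: delta_def)
  next
    case False
    then show ?thesis
      using N le r by (simp add: euler_entry_def euler_inverse_entry_def delta_def)
  qed
qed

text \<open>Projecting modulo u in chart b and then in chart a is projecting in chart a, so only the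
  scalar twist of the Jacobian remains.\<close>

lemma jacobian_euler_entry:
  assumes u: "u a \<noteq> 0" "u b \<noteq> 0" and le: "a \<le> n" "b \<le> n" "r < n" "k \<le> n"
  shows "(\<Sum>l<n. cp_jacobian a b u r l * euler_entry n b u l k) = u b / u a * euler_entry n a u r k"
proof -
  have "(\<Sum>l<n. cp_jacobian a b u r l * euler_entry n b u l k) = u b / u a *
     (\<Sum>l<n. (delta (skip a r) (skip b l) - delta (skip b l) a * (u (skip a r) / u a)) *
      (delta (skip b l) k - delta k b * (u (skip b l) / u b)))"
    unfolding sum_distrib_left by (intro sum.cong) (auto simp: cp_jacobian_delta euler_entry_def)
  also have "\<dots> = u b / u a * (delta (skip a r) k - delta k a * (u (skip a r) / u a))"
    by (subst projection_compose) (use assms skip_le in auto)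
  finally show ?thesis
    using le by (simp add: euler_entry_def)
qed

text \<open>The factors \<open>u a\<close> and \<open>sqnorm n u\<close> make the Hermitian row
  invariant under scaling of u, as \<open>continuous_map_cp_top\<close> requires.\<close>

lemma continuous_map_euler_entry:
  assumes U: "openin (cp_top n) U" "U \<subseteq> cp_dom n a"
  shows "continuous_map (subtopology (cp_top n) U) euclidean (\<lambda>L. homog L i / homog L a * euler_entry n a (homog L) r k)"
proof (rule continuous_map_cp_top[OF U(1)])
  have nz: "z a \<noteq> 0" if "z \<in> punctured_space n" "cspan z \<in> U" for z
    using that U(2) cspan_in_cp_dom by blast
  show "continuous_on {z \<in> punctured_space n. cspan z \<in> U} (\<lambda>z. z i / z a * euler_entry n a z r k)"
    unfolding euler_entry_def
    by (cases "r < n"; simp only: if_True if_False; intro continuous_intros) (auto simp: nz sqnorm_nonzero)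
qed (auto simp: euler_entry_def sqnorm_scale)

lemma mat_mult_index:
  fixes A B :: "complex Matrix.mat"
  assumes "A \<in> carrier_mat m m" "B \<in> carrier_mat m m" "r < m" "k < m"
  shows "(A * B) $$ (r, k) = (\<Sum>l<m. A $$ (r, l) * B $$ (l, k))"
  using assms by (auto simp: scalar_prod_def atLeast0LessThan intro!: sum.cong)

text \<open>Coordinates pass from chart i to chart a by the transition function of the hyperplane
  bundle and are then split by \<open>euler_entry\<close>. The trivial summand has the single chart
  0, so the charts of the sum are pairs (a, 0).\<close>

lemma bundle_iso_euler:
  "bundle_iso (cp_top n) (hyperplane_sum n (n + 1))
     (direct_sum (tangent_bundle (CP n)) (trivial_bundle (cp_top n) 1))"
proof -
  let ?E = "hyperplane_sum n (n + 1)" and ?F = "direct_sum (tangent_bundle (CP n)) (trivial_bundle (cp_top n) 1)"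
  define h where "h p i L = Matrix.mat (n + 1) (n + 1) (\<lambda>(r, k).
    homog L i / homog L (fst (prod_decode p)) * euler_entry n (fst (prod_decode p)) (homog L) r k)" for p i L
  have hc: "h p i L \<in> carrier_mat (n + 1) (n + 1)" for p i L
    by (simp add: h_def)
  have idxF: "idx ?F = prod_encode ` ({..n} \<times> {0})"
    by (simp add: direct_sum_def trivial_bundle_def tangent_bundle_CP_simps)
  have covF: "cov ?F (prod_encode (a, 0)) = cp_dom n a" for a
    using cp_dom_subset[of n a] by (auto simp: direct_sum_def trivial_bundle_def tangent_bundle_CP_simps)
  have rk: "rk ?E = n + 1" "rk ?F = n + 1" and E: "idx ?E = {..n}" "cov ?E = cp_dom n"
    by (simp_all add: direct_sum_def trivial_bundle_def tangent_bundle_CP_simps hyperplane_sum_def)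
  show ?thesis
    unfolding bundle_iso_def
  proof (intro conjI exI[of _ h] ballI)
    fix p i assume p: "p \<in> idx ?F" and i: "i \<in> idx ?E"
    then obtain a where a: "p = prod_encode (a, 0)" "a \<le> n"
      unfolding idxF by auto
    let ?U = "cov ?F p \<inter> cov ?E i"
    have U: "?U = cp_dom n a \<inter> cp_dom n i"
      unfolding a covF E ..
    show "continuous_matrix (cp_top n) ?U (rk ?E) (h p i)"
      unfolding U rk
    proof (rule continuous_matrixI[OF hc])
      fix r k assume "r < n + 1" "k < n + 1"
      then show "continuous_map (subtopology (cp_top n) (cp_dom n a \<inter> cp_dom n i)) euclidean (\<lambda>L. h p i L $$ (r, k))"
        using continuous_map_euler_entry[of n "cp_dom n a \<inter> cp_dom n i" a i r k]
        by (simp add: h_def a openin_Int openin_cp_dom)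
    qed
    fix x assume "x \<in> ?U"
    then have x: "x \<in> cp_dom n a" "x \<in> cp_dom n i" unfolding U by auto
    have nz: "homog x a \<noteq> 0" "homog x i \<noteq> 0" "sqnorm n (homog x) \<noteq> 0"
      using x cp_domD sqnorm_nonzero homog_in_punctured(1) cp_dom_subset by blast+
    let ?B = "Matrix.mat (n + 1) (n + 1) (\<lambda>(k, c). homog x a / homog x i * euler_inverse_entry n a (homog x) k c)"
    have "h p i x * ?B = 1\<^sub>m (n + 1)"
    proof (rule eq_matI)
      fix r c assume "r < dim_row (1\<^sub>m (n + 1) :: complex Matrix.mat)" "c < dim_col (1\<^sub>m (n + 1) :: complex Matrix.mat)"
      then have rc: "r \<le> n" "c \<le> n" by auto
      then have "(h p i x * ?B) $$ (r, c) = (\<Sum>k\<le>n. euler_entry n a (homog x) r k * euler_inverse_entry n a (homog x) k c)"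
        using nz by (auto simp: h_def a scalar_prod_def atLeast0LessThan lessThan_Suc_atMost intro!: sum.cong)
      then show "(h p i x * ?B) $$ (r, c) = 1\<^sub>m (n + 1) $$ (r, c)"
        using rc nz a(2) by (simp add: euler_inverse delta_def)
    qed (simp_all add: h_def)
    then show "invertible_mat (h p i x)"
      by (intro invertible_mat_if_right_inverse[OF hc]) simp_all
  next
    fix p q i j x assume "p \<in> idx ?F" "q \<in> idx ?F" "i \<in> idx ?E" "j \<in> idx ?E"
      and x: "x \<in> cov ?F p \<inter> cov ?F q \<inter> cov ?E i \<inter> cov ?E j"
    then obtain a b where ab: "p = prod_encode (a, 0)" "a \<le> n" "q = prod_encode (b, 0)" "b \<le> n"
      and ij: "i \<le> n" "j \<le> n"
      unfolding idxF E by auto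
    have xd: "x \<in> cp_dom n a" "x \<in> cp_dom n b" "x \<in> cp_dom n i" "x \<in> cp_dom n j"
      using x unfolding ab covF E by auto
    have nz: "homog x a \<noteq> 0" "homog x b \<noteq> 0" "homog x i \<noteq> 0" "homog x j \<noteq> 0"
      using xd cp_domD by blast+
    let ?T = "Matrix.mat n n (\<lambda>(r, l). cp_jacobian a b (homog x) r l)"
    define M where "M = four_block_mat ?T (0\<^sub>m n 1) (0\<^sub>m 1 n) (1\<^sub>m 1)"
    have trnF: "trn ?F p q x = M"
      unfolding ab M_def by (simp add: direct_sum_def trivial_bundle_def tangent_bundle_CP_simps trn_tangent_bundle_CP[OF xd(1,2) ab(2,4)])
    have M: "M \<in> carrier_mat (n + 1) (n + 1)"
      unfolding M_def by (rule carrier_matI) simp_all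
    have M_entries: "r < n \<Longrightarrow> l < n \<Longrightarrow> M $$ (r, l) = cp_jacobian a b (homog x) r l"
      "r < n \<Longrightarrow> M $$ (r, n) = 0" "l < n \<Longrightarrow> M $$ (n, l) = 0" "M $$ (n, n) = 1" for r l
      unfolding M_def by simp_all
    have trnE: "trn ?E i j x = (homog x j / homog x i) \<cdot>\<^sub>m 1\<^sub>m (n + 1)"
      by (simp add: hyperplane_sum_def)
    show "trn ?F p q x * h q j x = h p i x * trn ?E i j x"
      unfolding trnF
    proof (rule eq_matI)
      fix r k assume "r < dim_row (h p i x * trn ?E i j x)" "k < dim_col (h p i x * trn ?E i j x)"
      then have rk: "r < n + 1" "k < n + 1" by (simp_all add: h_def hyperplane_sum_def)
      have "h p i x * trn ?E i j x = (homog x j / homog x i) \<cdot>\<^sub>m h p i x"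
        unfolding trnE using hc[of p i x] by (simp add: mult_smult_distrib[of _ "n + 1" "n + 1" _ "n + 1"])
      then have R: "(h p i x * trn ?E i j x) $$ (r, k) = homog x j / homog x a * euler_entry n a (homog x) r k"
        using rk nz by (simp add: h_def ab)
      have "(M * h q j x) $$ (r, k) = (\<Sum>l<n + 1. M $$ (r, l) * h q j x $$ (l, k))"
        by (rule mat_mult_index[OF M hc rk])
      also have "\<dots> = (\<Sum>l<n. M $$ (r, l) * h q j x $$ (l, k)) + M $$ (r, n) * h q j x $$ (n, k)"
        by simp
      also have "\<dots> = homog x j / homog x a * euler_entry n a (homog x) r k"
      proof (cases "r < n")
        case True
        have "(\<Sum>l<n. M $$ (r, l) * h q j x $$ (l, k)) =
          homog x j / homog x b * (\<Sum>l<n. cp_jacobian a b (homog x) r l * euler_entry n b (homog x) l k)"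
          unfolding sum_distrib_left using True rk by (intro sum.cong) (auto simp: M_entries h_def ab)
        also have "\<dots> = homog x j / homog x a * euler_entry n a (homog x) r k"
          using jacobian_euler_entry[of "homog x" a b n r k] nz ab True rk by simp
        finally show ?thesis
          using True by (simp add: M_entries)
      next
        \<comment> \<open>In the last row the factor \<open>u a\<close> of
          \<open>euler_entry\<close> cancels the denominator of the twist, so its entries do not
          depend on the chart, as a trivial summand demands.\<close>
        case False
        then have r: "r = n" using rk by simp
        have "(\<Sum>l<n. M $$ (r, l) * h q j x $$ (l, k)) = 0"
          by (intro sum.neutral) (auto simp: M_entries r)
        moreover have "M $$ (r, n) = 1"
          by (simp add: M_entries r)
        ultimately show ?thesis
          using rk nz by (simp add: h_def ab r euler_entry_def)
      qed
      finally show "(M * h q j x) $$ (r, k) = (h p i x * trn ?E i j x) $$ (r, k)"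
        unfolding R .
    qed (use M in \<open>simp_all add: h_def hyperplane_sum_def\<close>)
  qed (simp only: rk)
qed

section \<open>Chern classes\<close>

lemma vector_bundle_pullback:
  assumes f: "continuous_map X Y f" and E: "vector_bundle Y E"
  shows "vector_bundle X (pullback_bundle X f E)"
proof -
  let ?P = "pullback_bundle X f E"
  have P: "rk ?P = rk E" "idx ?P = idx E" "cov ?P = (\<lambda>i. topspace X \<inter> f -` cov E i)"
    "trn ?P = (\<lambda>i j x. trn E i j (f x))"
    by (simp_all add: pullback_bundle_def)
  have op: "openin X (topspace X \<inter> f -` V)" if "openin Y V" for V
    using openin_continuous_map_preimage[OF f that] by (simp add: vimage_def Int_def)
  have comp: "continuous_map (subtopology X (topspace X \<inter> f -` V \<inter> (topspace X \<inter> f -` W))) euclidean (\<lambda>x. g (f x))"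
    if "continuous_map (subtopology Y (V \<inter> W)) euclidean g" for V W and g :: "_ \<Rightarrow> complex"
  proof -
    have "continuous_map (subtopology X (topspace X \<inter> f -` V \<inter> (topspace X \<inter> f -` W))) (subtopology Y (V \<inter> W)) f"
      using f by (auto simp: continuous_map_in_subtopology intro: continuous_map_from_subtopology)
    from continuous_map_compose[OF this that] show ?thesis by (simp add: o_def)
  qed
  show ?thesis
    unfolding vector_bundle_def P
  proof (intro conjI ballI)
    fix i assume "i \<in> idx E"
    then show "openin X (topspace X \<inter> f -` cov E i)"
      using E by (intro op) (simp add: vector_bundle_def)
  next
    have "f x \<in> (\<Union>i\<in>idx E. cov E i)" if "x \<in> topspace X" for x
      using E continuous_map_image_subset_topspace[OF f] that by (auto simp: vector_bundle_def)
    then show "(\<Union>i\<in>idx E. topspace X \<inter> f -` cov E i) = topspace X"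
      by auto
  next
    fix i j assume "i \<in> idx E" "j \<in> idx E"
    then have "continuous_matrix Y (cov E i \<inter> cov E j) (rk E) (trn E i j)"
      using E by (simp add: vector_bundle_def)
    then show "continuous_matrix X (topspace X \<inter> f -` cov E i \<inter> (topspace X \<inter> f -` cov E j)) (rk E) (\<lambda>x. trn E i j (f x))"
      unfolding continuous_matrix_def using comp[where g = "\<lambda>x. trn E i j x $$ (_, _)"] by auto
  next
    fix i x assume "i \<in> idx E" "x \<in> topspace X \<inter> f -` cov E i"
    then show "trn E i i (f x) = 1\<^sub>m (rk E)"
      using E by (simp add: vector_bundle_def)
  next
    fix i j k x assume "i \<in> idx E" "j \<in> idx E" "k \<in> idx E"
      "x \<in> topspace X \<inter> f -` cov E i \<inter> (topspace X \<inter> f -` cov E j) \<inter> (topspace X \<inter> f -` cov E k)"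
    then show "trn E i j (f x) * trn E j k (f x) = trn E i k (f x)"
      using E by (simp add: vector_bundle_def)
  qed
qed

lemma concentrated_pullback: "concentrated p a \<Longrightarrow> concentrated p (cochain_pullback f a)"
  by (simp add: concentrated_def cochain_pullback.rep_eq)

lemma cochain_pullback_id [simp]: "cochain_pullback id a = a"
  by (simp add: cochain_val_inject[symmetric] fun_eq_iff cochain_pullback.rep_eq)

text \<open>Cochains are defined on all functions, so restricting to a subspace keeps the cochain
  and merely leaves fewer simplices to test.\<close>

lemma closed_cochain_mono:
  assumes "closed_cochain Y a" "continuous_map X Y id"
  shows "closed_cochain X a"
  unfolding closed_cochain_def
proof (intro allI impI)
  fix p s assume s: "singular_simplex (Suc p) X s"
  then have "singular_simplex (Suc p) Y (simplex_map (Suc p) id s)"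
    using assms(2) by (rule singular_simplex_simplex_map)
  moreover have "simplex_map (Suc p) id s = s"
    using s by (simp add: singular_simplex_def extensional_restrict)
  ultimately show "coboundary_val a p s = 0"
    using assms(1) by (simp add: closed_cochain_def)
qed

text \<open>All simplices become the same constant one, with value \<open>v\<close>. The constant
  cochain \<open>v\<close> in degree 2i - 1 is a primitive, because the alternating sum over the 2i
  + 1 faces is \<open>v\<close>.\<close>

lemma coh_pullback_const:
  fixes X :: "'a topology" and b :: "'b cochain"
  assumes "i > 0" "concentrated (2 * i) b"
  shows "coh X (cochain_pullback (\<lambda>_. a) b) 0"
proof -
  define v where "v = cochain_val b (2 * i) (restrict (\<lambda>_. a) (standard_simplex (2 * i)))"
  define e :: "'a cochain" where "e = Abs_cochain (\<lambda>_ _. v)"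
  have e: "cochain_val e = (\<lambda>_ _. v)"
    unfolding e_def by (rule cochain_val_Abs) simp
  obtain q where q: "2 * i = Suc q" "odd q"
    using assms(1) by (metis Suc_pred even_Suc even_mult_iff even_numeral nat_0_less_mult_iff zero_less_numeral)
  have "(\<Sum>k\<le>m. (- 1) ^ k * v) = (if even m then v else 0)" for m :: nat
    by (induction m) auto
  then have de: "coboundary_val e q s = v" for s
    using q by (simp add: coboundary_val_def e del: sum.atMost_Suc)
  have pb: "cochain_val (cochain_pullback (\<lambda>_. a) b) (Suc q) s = v" for s
  proof -
    have "simplex_map (Suc q) (\<lambda>_. a) s = restrict (\<lambda>_. a) (standard_simplex (Suc q))"
      by (simp add: simplex_map_def o_def)
    then show ?thesis by (simp add: cochain_pullback.rep_eq v_def q)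
  qed
  have "cohomologous (2 * i) X (cochain_pullback (\<lambda>_. a) b) 0"
    unfolding cohomologous_iff q by (rule exI[of _ e]) (simp add: zero_cochain.rep_eq de pb)
  then show ?thesis
    using assms(2) by (intro cohomologous_imp_coh[of "2 * i"] concentrated_pullback) auto
qed

lemma of_int_power_mult:
  "(of_int a * h ^ i) * (of_int b * h ^ j) = of_int (a * b) * (h :: 'r::ring_1) ^ (i + j)"
proof -
  have "(of_int a * h ^ i) * (of_int b * h ^ j) = of_int a * (h ^ i * of_int b) * h ^ j"
    by (simp only: mult.assoc)
  also have "h ^ i * of_int b = of_int b * h ^ i"
    by (rule mult_of_int_commute[symmetric])
  finally show ?thesis
    by (simp only: of_int_mult power_add mult.assoc)
qed

lemma coh_sum_mult:
  fixes k :: nat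
  assumes "\<And>i. i \<le> k \<Longrightarrow> closed_cochain X (f i)" "\<And>i. i \<le> k \<Longrightarrow> closed_cochain X (g' i)"
    "\<And>i. i \<le> k \<Longrightarrow> coh X (f i) (f' i)" "\<And>i. i \<le> k \<Longrightarrow> coh X (g i) (g' i)"
  shows "coh X (\<Sum>i\<le>k. f i * g (k - i)) (\<Sum>i\<le>k. f' i * g' (k - i))"
  by (intro coh_sum coh_mult assms) auto

section \<open>Consequences of the Chern class axioms\<close>

locale chern_theory =
  fixes c :: "cline topology \<Rightarrow> cline vbundle \<Rightarrow> nat \<Rightarrow> cline cochain"
  assumes chern: "chern_classes c"
begin

definition compact_base :: "cline topology \<Rightarrow> bool" where
  "compact_base X \<longleftrightarrow> compact_space X \<and> Hausdorff_space X"

lemma compact_base_cp [simp]: "compact_base (cp_top n)"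
  by (simp add: compact_base_def compact_space_cp_top Hausdorff_space_cp_top)

lemma c_cocycle:
  assumes "compact_base X" "vector_bundle X E"
  shows "concentrated (2 * i) (c X E i)" "closed_cochain X (c X E i)"
  using chern assms unfolding chern_classes_def compact_base_def cocycle_iff by blast+

lemma c_0:
  assumes "compact_base X" "vector_bundle X E"
  shows "coh X (c X E 0) 1"
proof (rule cohomologous_imp_coh[of 0])
  show "cohomologous 0 X (c X E 0) 1"
    using chern assms unfolding chern_classes_def compact_base_def by blast
qed (use c_cocycle[OF assms, of 0] in auto)

lemma c_above_rank:
  assumes "compact_base X" "vector_bundle X E" "i > rk E"
  shows "coh X (c X E i) 0"
proof (rule cohomologous_imp_coh)
  show "cohomologous (2 * i) X (c X E i) 0"
    using chern assms unfolding chern_classes_def compact_base_def by blast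
qed (use c_cocycle[OF assms(1,2)] in auto)

lemma c_iso:
  assumes "compact_base X" "vector_bundle X E" "vector_bundle X F" "bundle_iso X E F"
  shows "coh X (c X E i) (c X F i)"
proof (rule cohomologous_imp_coh)
  show "cohomologous (2 * i) X (c X E i) (c X F i)"
    using chern assms unfolding chern_classes_def compact_base_def by blast
qed (use c_cocycle assms in auto)

lemma c_pullback:
  assumes "compact_base X" "compact_base Y" "continuous_map X Y f" "vector_bundle Y E"
  shows "coh X (c X (pullback_bundle X f E) i) (cochain_pullback f (c Y E i))"
proof (rule cohomologous_imp_coh)
  show "cohomologous (2 * i) X (c X (pullback_bundle X f E) i) (cochain_pullback f (c Y E i))"
    using chern assms unfolding chern_classes_def compact_base_def by blast
qed (use c_cocycle(1)[OF assms(1) vector_bundle_pullback[OF assms(3,4)]] c_cocycle(1)[OF assms(2,4)]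
    in \<open>auto intro: concentrated_pullback\<close>)

lemma c_direct_sum:
  assumes "compact_base X" "vector_bundle X E" "vector_bundle X F"
  shows "coh X (c X (direct_sum E F) k) (\<Sum>i\<le>k. c X E i * c X F (k - i))"
proof (rule cohomologous_imp_coh)
  show "cohomologous (2 * k) X (c X (direct_sum E F) k) (\<Sum>i\<le>k. c X E i * c X F (k - i))"
    using chern assms unfolding chern_classes_def compact_base_def by blast
  show "concentrated (2 * k) (c X (direct_sum E F) k)"
    using assms by (intro c_cocycle vector_bundle_direct_sum)
  show "concentrated (2 * k) (\<Sum>i\<le>k. c X E i * c X F (k - i))"
  proof (rule concentrated_sum)
    fix i assume "i \<in> {..k}"
    then show "concentrated (2 * k) (c X E i * c X F (k - i))"
      using concentrated_mult[OF c_cocycle(1)[OF assms(1,2), of i] c_cocycle(1)[OF assms(1,3), of "k - i"]]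
      by (simp add: add_mult_distrib2[symmetric])
  qed
qed

text \<open>A trivial bundle is pulled back from a point, whose positive even cohomology vanishes.
  The point is an arbitrary value of type \<open>cline\<close>, since the axioms speak about spaces
  of that type.\<close>

lemma c_trivial:
  assumes X: "compact_base X"
  shows "coh X (c X (trivial_bundle X r) i) (if i = 0 then 1 else 0)"
proof (cases "i = 0")
  case True
  then show ?thesis
    using c_0[OF X vector_bundle_trivial] by simp
next
  case False
  fix a :: cline
  let ?Y = "discrete_topology {a}"
  have Y: "compact_base ?Y"
    by (simp add: compact_base_def compact_space_discrete_topology)
  have f: "continuous_map X ?Y (\<lambda>_. a)"
    by simp
  have "pullback_bundle X (\<lambda>_. a) (trivial_bundle ?Y r) = trivial_bundle X r"
    by (simp add: pullback_bundle_def trivial_bundle_def)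
  then have "coh X (c X (trivial_bundle X r) i) (cochain_pullback (\<lambda>_. a) (c ?Y (trivial_bundle ?Y r) i))"
    using c_pullback[OF X Y f vector_bundle_trivial, of r i] by simp
  also have "coh X (cochain_pullback (\<lambda>_. a) (c ?Y (trivial_bundle ?Y r) i)) 0"
    using False by (intro coh_pullback_const[of i] c_cocycle Y vector_bundle_trivial) auto
  finally show ?thesis
    using False by simp
qed

lemma c_direct_sum_trivial:
  assumes "compact_base X" "vector_bundle X E"
  shows "coh X (c X (direct_sum E (trivial_bundle X r)) k) (c X E k)"
proof -
  have "coh X (c X (direct_sum E (trivial_bundle X r)) k) (\<Sum>i\<le>k. c X E i * c X (trivial_bundle X r) (k - i))"
    using assms by (intro c_direct_sum vector_bundle_trivial)
  also have "coh X (\<Sum>i\<le>k. c X E i * c X (trivial_bundle X r) (k - i)) (\<Sum>i\<le>k. c X E i * (if k - i = 0 then 1 else 0))"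
    using assms by (intro coh_sum_mult c_cocycle c_trivial) auto
  also have "(\<Sum>i\<le>k. c X E i * (if k - i = 0 then 1 else 0)) = (\<Sum>i\<le>k. if i = k then c X E k else 0)"
    by (intro sum.cong) auto
  also have "\<dots> = c X E k"
    by simp
  finally show ?thesis .
qed

section \<open>Chern classes of the bundles on projective space\<close>

abbreviation hyp :: "nat \<Rightarrow> cline cochain" where
  "hyp n \<equiv> c (cp_top n) (hyperplane_bundle n) 1"

lemma vector_bundle_hyperplane: "vector_bundle (cp_top n) (hyperplane_bundle n)"
  using vector_bundle_hyperplane_sum[of n 1] unfolding hyperplane_sum_1 .

lemma hyp_cocycle: "concentrated 2 (hyp n)" "closed_cochain (cp_top n) (hyp n)"
  using c_cocycle[OF compact_base_cp[of n] vector_bundle_hyperplane[of n], of 1] by auto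

lemma closed_hyp_power: "closed_cochain (cp_top n) (of_int k * hyp n ^ i)"
  by (intro closed_cochain_mult closed_cochain_power hyp_cocycle closed_cochain_of_int)

lemma c_hyperplane:
  "coh (cp_top n) (c (cp_top n) (hyperplane_bundle n) i) (of_int (int (1 choose i)) * hyp n ^ i)"
proof -
  consider "i = 0" | "i = 1" | "i > 1" by linarith
  then show ?thesis
  proof cases
    case 1
    then show ?thesis using c_0[OF compact_base_cp vector_bundle_hyperplane] by simp
  next
    case 3
    then show ?thesis
      using c_above_rank[OF compact_base_cp vector_bundle_hyperplane, of n i]
      by (simp add: hyperplane_bundle_def binomial_eq_0)
  qed simp
qed

text \<open>The Whitney formula multiplies the total class by 1 + h at each step; Vandermonde's
  identity collects the coefficients.\<close>

lemma c_hyperplane_sum: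
  "coh (cp_top n) (c (cp_top n) (hyperplane_sum n k) i) (of_int (int (k choose i)) * hyp n ^ i)"
proof (induction k arbitrary: i)
  case 0
  show ?case
  proof (cases "i = 0")
    case True
    then show ?thesis
      using c_0[OF compact_base_cp vector_bundle_hyperplane_sum] by simp
  next
    case False
    then show ?thesis
      using c_above_rank[OF compact_base_cp vector_bundle_hyperplane_sum, of n 0 i]
      by (simp add: hyperplane_sum_def binomial_eq_0)
  qed
next
  case (Suc k)
  let ?X = "cp_top n" and ?h = "hyp n"
  have "coh ?X (c ?X (hyperplane_sum n (Suc k)) i) (c ?X (direct_sum (hyperplane_sum n k) (hyperplane_bundle n)) i)"
    by (intro c_iso compact_base_cp vector_bundle_hyperplane_sum vector_bundle_direct_sum vector_bundle_hyperplane
        bundle_iso_hyperplane_sum_Suc)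
  also have "coh ?X \<dots> (\<Sum>j\<le>i. c ?X (hyperplane_sum n k) j * c ?X (hyperplane_bundle n) (i - j))"
    by (intro c_direct_sum compact_base_cp vector_bundle_hyperplane_sum vector_bundle_hyperplane)
  also have "coh ?X \<dots> (\<Sum>j\<le>i. (of_int (int (k choose j)) * ?h ^ j) * (of_int (int (1 choose (i - j))) * ?h ^ (i - j)))"
    by (intro coh_sum_mult Suc.IH c_hyperplane closed_hyp_power
        c_cocycle compact_base_cp vector_bundle_hyperplane_sum)
  also have "\<dots> = (\<Sum>j\<le>i. of_int (int ((k choose j) * (1 choose (i - j))))) * ?h ^ i"
    unfolding sum_distrib_right
  proof (intro sum.cong refl)
    fix j assume "j \<in> {..i}"
    then show "(of_int (int (k choose j)) * ?h ^ j) * (of_int (int (1 choose (i - j))) * ?h ^ (i - j)) =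
        of_int (int ((k choose j) * (1 choose (i - j)))) * ?h ^ i"
      unfolding of_int_power_mult by simp
  qed
  also have "\<dots> = of_int (int (\<Sum>j\<le>i. (k choose j) * (1 choose (i - j)))) * ?h ^ i"
    by simp
  also have "(\<Sum>j\<le>i. (k choose j) * (1 choose (i - j))) = (Suc k choose i)"
    using vandermonde[of k 1 i] by simp
  finally show ?case .
qed

lemma c_tangent:
  "coh (cp_top n) (c (cp_top n) (tangent_bundle (CP n)) i) (of_int (int ((n + 1) choose i)) * hyp n ^ i)"
proof -
  let ?X = "cp_top n" and ?T = "tangent_bundle (CP n)"
  have "coh ?X (c ?X (hyperplane_sum n (n + 1)) i) (c ?X (direct_sum ?T (trivial_bundle ?X 1)) i)"
    by (intro c_iso compact_base_cp vector_bundle_hyperplane_sum vector_bundle_direct_sum vector_bundle_tangent_CP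
        vector_bundle_trivial bundle_iso_euler)
  also have "coh ?X \<dots> (c ?X ?T i)"
    by (intro c_direct_sum_trivial compact_base_cp vector_bundle_tangent_CP)
  finally show ?thesis
    using c_hyperplane_sum[of n "n + 1" i] coh_sym coh_trans by blast
qed

text \<open>In degree j the relation c(T) c(nu) = 1 expresses c_j(nu) through lower classes, and
  \<open>neg_binom_convolution\<close> is the same recursion for the coefficients.\<close>

lemma c_normal:
  assumes nu: "vector_bundle (cp_top n) nu"
    and st: "stably_trivial (cp_top n) (direct_sum (tangent_bundle (CP n)) nu)"
  shows "coh (cp_top n) (c (cp_top n) nu j) (of_int (neg_binom n j) * hyp n ^ j)"
proof (induction j rule: less_induct)
  case (less j)
  let ?X = "cp_top n" and ?T = "tangent_bundle (CP n)" and ?h = "hyp n"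
  let ?B = "\<lambda>i. int ((n + 1) choose i)"
  obtain k m where iso: "bundle_iso ?X (direct_sum (direct_sum ?T nu) (trivial_bundle ?X k)) (trivial_bundle ?X m)"
    using st unfolding stably_trivial_def by blast
  have TN: "vector_bundle ?X (direct_sum ?T nu)"
    by (intro vector_bundle_direct_sum vector_bundle_tangent_CP nu)
  have "coh ?X (\<Sum>i\<le>j. c ?X ?T i * c ?X nu (j - i)) (c ?X (direct_sum ?T nu) j)"
    by (intro coh_sym[OF c_direct_sum] compact_base_cp vector_bundle_tangent_CP nu)
  also have "coh ?X \<dots> (c ?X (direct_sum (direct_sum ?T nu) (trivial_bundle ?X k)) j)"
    by (intro coh_sym[OF c_direct_sum_trivial] compact_base_cp TN)
  also have "coh ?X \<dots> (c ?X (trivial_bundle ?X m) j)"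
    by (intro c_iso compact_base_cp vector_bundle_direct_sum TN vector_bundle_trivial iso)
  also have "coh ?X \<dots> (if j = 0 then 1 else 0)"
    by (intro c_trivial compact_base_cp)
  finally have total: "coh ?X (\<Sum>i\<le>j. c ?X ?T i * c ?X nu (j - i)) (if j = 0 then 1 else 0)" .
  have "coh ?X (\<Sum>i\<le>j. (of_int (?B i) * ?h ^ i) * c ?X nu (j - i)) (\<Sum>i\<le>j. c ?X ?T i * c ?X nu (j - i))"
    by (intro coh_sum_mult coh_sym[OF c_tangent] coh_refl closed_hyp_power c_cocycle compact_base_cp nu)
  then have "coh ?X (\<Sum>i\<le>j. (of_int (?B i) * ?h ^ i) * c ?X nu (j - i)) (if j = 0 then 1 else 0)"
    using total coh_trans by blast
  \<comment> \<open>The tangent class of degree 0 has been replaced by 1, so the term i = 0 is the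
    class sought.\<close>
  also have "(\<Sum>i\<le>j. (of_int (?B i) * ?h ^ i) * c ?X nu (j - i)) =
      c ?X nu j + (\<Sum>i\<in>{1..j}. (of_int (?B i) * ?h ^ i) * c ?X nu (j - i))"
  proof -
    have "{..j} = insert 0 {1..j}" by auto
    then show ?thesis by simp
  qed
  finally have 1: "coh ?X (c ?X nu j + (\<Sum>i\<in>{1..j}. (of_int (?B i) * ?h ^ i) * c ?X nu (j - i))) (if j = 0 then 1 else 0)" .
  have 2: "coh ?X (\<Sum>i\<in>{1..j}. (of_int (?B i) * ?h ^ i) * c ?X nu (j - i))
     (\<Sum>i\<in>{1..j}. (of_int (?B i) * ?h ^ i) * (of_int (neg_binom n (j - i)) * ?h ^ (j - i)))"
    by (intro coh_sum coh_mult less.IH closed_hyp_power coh_refl) auto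
  have "coh ?X (c ?X nu j) ((if j = 0 then 1 else 0) -
     (\<Sum>i\<in>{1..j}. (of_int (?B i) * ?h ^ i) * (of_int (neg_binom n (j - i)) * ?h ^ (j - i))))"
    using coh_diff[OF 1 2] by simp
  also have "(\<Sum>i\<in>{1..j}. (of_int (?B i) * ?h ^ i) * (of_int (neg_binom n (j - i)) * ?h ^ (j - i))) =
      of_int (\<Sum>i\<in>{1..j}. ?B i * neg_binom n (j - i)) * ?h ^ j"
    unfolding of_int_sum sum_distrib_right
  proof (intro sum.cong refl)
    fix i assume "i \<in> {1..j}"
    then show "(of_int (?B i) * ?h ^ i) * (of_int (neg_binom n (j - i)) * ?h ^ (j - i)) =
        of_int (?B i * neg_binom n (j - i)) * ?h ^ j"
      unfolding of_int_power_mult by simp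
  qed
  also have "(\<Sum>i\<in>{1..j}. ?B i * neg_binom n (j - i)) = (if j = 0 then 1 else 0) - neg_binom n j"
  proof -
    have "{..j} = insert 0 {1..j}" by auto
    then have "(\<Sum>i\<le>j. ?B i * neg_binom n (j - i)) = neg_binom n j + (\<Sum>i\<in>{1..j}. ?B i * neg_binom n (j - i))"
      by simp
    then show ?thesis
      using neg_binom_convolution[of n j] by simp
  qed
  also have "(if j = 0 then 1 else 0) - of_int ((if j = 0 then 1 else 0) - neg_binom n j) * ?h ^ j = of_int (neg_binom n j) * ?h ^ j"
    by (auto simp: left_diff_distrib)
  finally show ?case .
qed

text \<open>Naturality along the inclusion, which is \<open>id\<close> as CP^(n-1) is literally a
  subset of CP^n; hence the pulled back cochain is \<open>hyp n\<close> itself.\<close>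

lemma coh_hyp_restrict:
  assumes "n \<ge> 1"
  shows "coh (cp_top (n - 1)) (hyp n) (hyp (n - 1))"
proof -
  let ?X = "cp_top (n - 1)"
  have vb: "vector_bundle ?X (pullback_bundle ?X id (hyperplane_bundle n))"
    by (intro vector_bundle_pullback[OF continuous_map_cp_inclusion] vector_bundle_hyperplane)
  have "coh ?X (cochain_pullback id (hyp n)) (c ?X (pullback_bundle ?X id (hyperplane_bundle n)) 1)"
    by (intro coh_sym[OF c_pullback] compact_base_cp continuous_map_cp_inclusion vector_bundle_hyperplane)
  also have "coh ?X \<dots> (hyp (n - 1))"
    by (intro c_iso compact_base_cp vb vector_bundle_hyperplane bundle_iso_hyperplane_restrict[OF assms])
  finally show ?thesis by simp
qed

text \<open>Removing its only point from CP^0 leaves the empty set, so the local orientation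
  condition there makes \<open>mu\<close> absolutely homologous to a single 0-simplex, on which 1
  takes the value 1.\<close>

lemma pairing_one_CP_0:
  assumes mu: "fundamental_cycle (CP 0) mu"
  shows "pairing 0 1 mu = 1"
proof -
  let ?l = "\<lambda>_ _. 0 :: real" and ?y = "\<lambda>j. if j = 0 then 1 else 0 :: real"
  have os: "oriented_simplex 0 ?l x = (\<lambda>_. 0)" if "x \<in> standard_simplex 0" for x
    using that by (simp add: oriented_simplex_def)
  have z: "complexify (\<lambda>_. 0) = (\<lambda>_. 0)"
    by (simp add: complexify_def fun_eq_iff complex_eq_iff)
  let ?p = "cspan (insert_one 0 (\<lambda>_. 0))"
  have P: "insert_one 0 (\<lambda>_. 0) \<in> punctured_space 0"
    by (rule insert_one_punctured) auto
  have inv: "mchart_inv (CP 0) 0 (\<lambda>_. 0) = ?p"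
    by (rule mchart_inv_CP) auto
  have y: "?y \<in> standard_simplex 0"
    by (simp add: standard_simplex_0)
  have "?p \<in> cp_dom 0 0" "cp_chart 0 0 ?p = (\<lambda>_. 0)"
    using cspan_in_cp_dom[OF P] by (auto simp: cp_chart_def)
  then have im: "(\<lambda>_. 0) \<in> cp_chart 0 0 ` cp_dom 0 0"
    by (metis image_eqI)
  \<comment> \<open>The 0 by 0 determinant is 1, hence positive.\<close>
  have "positive_simplex 0 ?l"
    by (simp add: positive_simplex_def Determinant.det_dim_zero)
  moreover have "\<forall>x\<in>standard_simplex 0. complexify (oriented_simplex 0 ?l x) \<in> cp_chart 0 0 ` cp_dom 0 0"
  proof
    fix x :: "nat \<Rightarrow> real" assume x: "x \<in> standard_simplex 0"
    show "complexify (oriented_simplex 0 ?l x) \<in> cp_chart 0 0 ` cp_dom 0 0"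
      unfolding os[OF x] z by (rule im)
  qed
  ultimately have hom: "homologous_rel 0 (cp_top 0) (topspace (cp_top 0) - {mchart_inv (CP 0) 0 (complexify (oriented_simplex 0 ?l ?y))})
     mu (frag_of (simplex_map 0 (mchart_inv (CP 0) 0 \<circ> complexify) (oriented_simplex 0 ?l)))"
    using mu y unfolding fundamental_cycle_def by (simp add: CP_def)
  have empty: "topspace (cp_top 0) - {mchart_inv (CP 0) 0 (complexify (oriented_simplex 0 ?l ?y))} = {}"
  proof -
    have "L = ?p" if "L \<in> topspace (cp_top 0)" for L
    proof -
      obtain z where z: "z \<in> punctured_space 0" "L = cspan z"
        using \<open>L \<in> topspace (cp_top 0)\<close> by auto
      have "z = (\<lambda>i. z 0 * insert_one 0 (\<lambda>_. 0) i)" "z 0 \<noteq> 0"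
        using z(1) punctured_coordinate[OF z(1)] by (auto simp: punctured_space_def insert_one_def fun_eq_iff)
      then show ?thesis
        using cspan_scale[of "z 0" "insert_one 0 (\<lambda>_. 0)"] z(2) by metis
    qed
    then show ?thesis
      unfolding os[OF y] z inv by blast
  qed
  have "pairing 0 1 mu = pairing 0 1 (frag_of (simplex_map 0 (mchart_inv (CP 0) 0 \<circ> complexify) (oriented_simplex 0 ?l)))"
    by (rule pairing_homologous[OF closed_cochain_1 hom[unfolded empty]])
  then show ?thesis
    by (simp add: one_cochain.rep_eq)
qed

text \<open>One factor h is moved onto the cycle by \<open>pairing_cap\<close>; the normalization
  axiom identifies the resulting class with the fundamental class of the hyperplane.\<close>

lemma pairing_hyp_power:
  assumes "fundamental_cycle (CP n) mu"
  shows "pairing (2 * n) (hyp n ^ n) mu = 1"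
  using assms
proof (induction n arbitrary: mu)
  case 0
  then show ?case using pairing_one_CP_0 by simp
next
  case (Suc m)
  let ?h = "hyp (Suc m)"
  have "\<forall>n mu. n \<ge> 1 \<and> fundamental_cycle (CP n) mu \<longrightarrow> (\<exists>mu'. fundamental_cycle (CP (n - 1)) mu' \<and>
      homologous_rel (2 * (n - 1)) (cp_top n) {} (cap 2 (2 * (n - 1)) (hyp n) mu) mu')"
    using chern unfolding chern_classes_def by blast
  from this[rule_format, of "Suc m" mu] Suc.prems
  obtain mu' where mu': "fundamental_cycle (CP m) mu'"
    and hom: "homologous_rel (2 * m) (cp_top (Suc m)) {} (cap 2 (2 * m) ?h mu) mu'"
    by auto
  have cyc: "singular_relcycle (2 * m) (cp_top m) {} mu'"
    using mu' by (simp add: fundamental_cycle_def CP_def)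
  have closed: "closed_cochain (cp_top m) ?h"
    using closed_cochain_mono[OF hyp_cocycle(2) continuous_map_cp_inclusion, of "Suc m"] by simp
  have "pairing (2 * Suc m) (?h ^ Suc m) mu = pairing (2 * m) (?h ^ m) (cap 2 (2 * m) ?h mu)"
    using pairing_cap[OF hyp_cocycle(1), of "2 * m" "?h ^ m"] by simp
  also have "\<dots> = pairing (2 * m) (?h ^ m) mu'"
    by (rule pairing_homologous[OF closed_cochain_power[OF hyp_cocycle(2)] hom])
  \<comment> \<open>The homology took place in CP^(m+1); since \<open>mu'\<close> is a cycle in
    CP^m, h may now be replaced by its counterpart there.\<close>
  also have "\<dots> = pairing (2 * m) (hyp m ^ m) mu'"
    using coh_hyp_restrict[of "Suc m"] closed
    by (intro pairing_coh[OF _ cyc] coh_power hyp_cocycle) auto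
  also have "\<dots> = 1"
    by (rule Suc.IH[OF mu'])
  finally show ?case .
qed

lemma pairing_monomial_chern_class:
  assumes nu: "vector_bundle (cp_top n) nu"
    and st: "stably_trivial (cp_top n) (direct_sum (tangent_bundle (CP n)) nu)"
    and mu: "fundamental_cycle (CP n) mu"
  shows "pairing (2 * n) (monomial_chern_class lam (c (cp_top n) nu)) mu =
    weighted_eval n (msym_in_esym lam) (neg_binom n)"
proof -
  let ?X = "cp_top n" and ?h = "hyp n" and ?P = "msym_in_esym lam"
  let ?a = "\<lambda>m. Poly_Mapping.lookup ?P m * (\<Prod>i\<in>Poly_Mapping.keys m. neg_binom n i ^ Poly_Mapping.lookup m i)"
  have cyc: "singular_relcycle (2 * n) ?X {} mu"
    using mu by (simp add: fundamental_cycle_def CP_def)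
  have "coh ?X (zeval (c ?X nu) ?P) (zeval (\<lambda>i. of_int (neg_binom n i) * ?h ^ i) ?P)"
    by (intro coh_zeval conjI c_cocycle compact_base_cp nu closed_hyp_power c_normal st)
  then have "pairing (2 * n) (monomial_chern_class lam (c ?X nu)) mu =
      pairing (2 * n) (zeval (\<lambda>i. of_int (neg_binom n i) * ?h ^ i) ?P) mu"
    unfolding monomial_chern_class_def by (rule pairing_coh[OF _ cyc])
  also have "\<dots> = (\<Sum>m\<in>Poly_Mapping.keys ?P. ?a m * pairing (2 * n) (?h ^ wt m) mu)"
    unfolding zeval_powers pairing_cochain_sum pairing_of_int ..
  \<comment> \<open>The power h^wt is concentrated in degree 2 wt, so evaluation on a cycle of
    dimension 2n extracts the part of weight n.\<close>
  also have "\<dots> = (\<Sum>m\<in>Poly_Mapping.keys ?P. if wt m = n then ?a m else 0)"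
  proof (intro sum.cong refl)
    fix m
    show "?a m * pairing (2 * n) (?h ^ wt m) mu = (if wt m = n then ?a m else 0)"
      using pairing_hyp_power[OF mu] pairing_concentrated[OF concentrated_power[OF hyp_cocycle(1)], of "2 * n" "wt m" n mu]
      by auto
  qed
  also have "\<dots> = weighted_eval n ?P (neg_binom n)"
    by (simp add: weighted_eval_def sum.inter_filter)
  finally show ?thesis .
qed

end

theorem theorem1p1:
  fixes n :: nat
    and c :: "cline topology \<Rightarrow> cline vbundle \<Rightarrow> nat \<Rightarrow> cline cochain"
    and nu :: "cline vbundle"
    and mu :: "cline chain"
  assumes "n \<ge> 1"
    and "chern_classes c"
    and "vector_bundle (cp_top n) nu"
    and "stably_trivial (cp_top n) (direct_sum (tangent_bundle (CP n)) nu)"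
    and "fundamental_cycle (CP n) mu"
  shows "chern_number_gf n (c (cp_top n) nu) mu = of_nat (n + 1) * lagrange_poly n"
proof -
  interpret chern_theory c
    by unfold_locales fact
  show ?thesis
    unfolding chern_number_gf_def pairing_monomial_chern_class[OF assms(3-5)]
    by (rule sum_msym_neg_binom_eq_lagrange)
qed

end
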